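(* Let $r,s\in\mathbb{C}^*$ be roots of unity with $r^2\neq s^2$, and let $m=\operatorname{ord}(r)$, $n=\operatorname{ord}(s)$. If both $m$ and $n$ are odd, then $$\operatorname{PI-deg}\left(U^+_{r,s}(B_2)\right)=\operatorname{ord}(r^2s^2)\operatorname{ord}(r^2s^{-2}).$$ If at least one of $m$, $n$ is even, then $$\operatorname{PI-deg}\left(U^+_{r,s}(B_2)\right)=\begin{cases}2\operatorname{ord}(r^2s^2)\operatorname{ord}(r^2s^{-2}), & e_2(m)\neq e_2(n),\\ \operatorname{ord}(r^2s^2)\operatorname{ord}(r^2s^{-2}), & e_2(m)=e_2(n)=1,\\ 2\operatorname{ord}(r^2s^2)\operatorname{ord}(r^2s^{-2}), & e_2(m)=e_2(n)=k\geq 2.\end{cases}$$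
   Context: For $r,s\in\mathbb{C}^*$, $U^+_{r,s}(B_2)$ is the unital associative $\mathbb{C}$-algebra generated by $e_1,e_2$ subject to $$e_1^2 e_2-(r^2+s^2)e_1e_2e_1+r^2s^2e_2e_1^2=0,$$ $$e_1e_2^3-(r^2+rs+s^2)e_2e_1e_2^2+rs(r^2+rs+s^2)e_2^2e_1e_2-r^3s^3e_2^3e_1=0.$$ When $r,s$ are roots of unity with $r^2\neq s^2$ this is a prime PI algebra. For a prime PI algebra $A$, $\operatorname{PI-deg}(A)$ denotes its PI degree (half the minimal degree of a polynomial identity of $A$; equivalently, the square root of the dimension of the full quotient ring of $A$ over its center). $\operatorname{ord}(z)$ is the multiplicative order of a root of unity $z$. For a nonzero integer $k$, $e_2(k)$ is the exponent of $2$ in the prime factorization of $k$. *)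

theory Defs
  imports
    Complex_Main
    "HOL-Library.Poly_Mapping"
    "HOL-Computational_Algebra.Factorial_Ring"
    "HOL-Algebra.Multiplicative_Group"
    "HOL-Algebra.QuotRing"
    "HOL-Algebra.Module"
    "HOL-Algebra.Algebraic_Closure_Type"
begin

section \<open>Free associative algebras over the complex numbers\<close>

text \<open>A copy of \<^typ>\<open>'x list\<close>, made into the free monoid on \<^typ>\<open>'x\<close>. It is written additively
  because \<^theory>\<open>HOL-Library.Poly_Mapping\<close> defines the convolution product over exponents
  in an additive monoid, which need not be commutative.\<close>

datatype 'x fword = FWord (letters: "'x list")

instantiation fword :: (type) monoid_add
begin

definition "(0 :: 'a fword) = FWord []"

definition "(u :: 'a fword) + v = FWord (letters u @ letters v)"

instance
  by standard (simp_all add: zero_fword_def plus_fword_def)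

end

text \<open>Finitely supported functions on words, with convolution as multiplication: noncommutative
  polynomials in variables from \<^typ>\<open>'x\<close>.\<close>

type_synonym 'x free_alg = "'x fword \<Rightarrow>\<^sub>0 complex"

definition var :: "'x \<Rightarrow> 'x free_alg" where
  "var x = Poly_Mapping.single (FWord [x]) 1"

definition scalar :: "complex \<Rightarrow> 'x free_alg" where
  "scalar c = Poly_Mapping.single 0 c"

text \<open>The total degree; its value at \<open>0\<close> is irrelevant below.\<close>

definition free_degree :: "'x free_alg \<Rightarrow> nat" where
  "free_degree f = Max ((\<lambda>w. length (letters w)) ` Poly_Mapping.keys f)"

section \<open>Algebras by generators and relations\<close>

text \<open>An associative unital algebra over the complex numbers is represented by a record of type
  \<^typ>\<open>(complex, 'a) module\<close>, that is, a ring together with a scalar multiplication.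
  (The locale \<^locale>\<open>algebra\<close> of the library covers commutative algebras only.)
  The following is the quotient of the free algebra by the two-sided ideal generated by
  \<open>R\<close>, with the induced scalar multiplication.\<close>

definition presented_algebra :: "'x free_alg set \<Rightarrow> (complex, 'x free_alg set) module" where
  "presented_algebra R =
    (let F = ring_of_type_algebra :: 'x free_alg ring;
         I = Idl\<^bsub>F\<^esub> R
     in ring.extend (F Quot I) (module.fields (\<lambda>c S. \<Union>x\<in>S. I +>\<^bsub>F\<^esub> (scalar c * x))))"

datatype B2_gen = E1 | E2

definition U_plus_B2 :: "complex \<Rightarrow> complex \<Rightarrow> (complex, B2_gen free_alg set) module" where
  "U_plus_B2 r s =
    (let e1 = var E1; e2 = var E2 in
     presented_algebra
      {e1\<^sup>2 * e2 - scalar (r\<^sup>2 + s\<^sup>2) * e1 * e2 * e1 + scalar (r\<^sup>2 * s\<^sup>2) * e2 * e1\<^sup>2,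
       e1 * e2 ^ 3 - scalar (r\<^sup>2 + r * s + s\<^sup>2) * e2 * e1 * e2\<^sup>2
         + scalar (r * s * (r\<^sup>2 + r * s + s\<^sup>2)) * e2\<^sup>2 * e1 * e2
         - scalar (r ^ 3 * s ^ 3) * e2 ^ 3 * e1})"

section \<open>Polynomial identities and the PI degree\<close>

definition eval_word :: "(complex, 'a) module \<Rightarrow> ('x \<Rightarrow> 'a) \<Rightarrow> 'x fword \<Rightarrow> 'a" where
  "eval_word A a w = foldr (\<lambda>x y. a x \<otimes>\<^bsub>A\<^esub> y) (letters w) \<one>\<^bsub>A\<^esub>"

definition eval_free :: "(complex, 'a) module \<Rightarrow> ('x \<Rightarrow> 'a) \<Rightarrow> 'x free_alg \<Rightarrow> 'a" where
  "eval_free A a f = (\<Oplus>\<^bsub>A\<^esub>w\<in>Poly_Mapping.keys f. Poly_Mapping.lookup f w \<odot>\<^bsub>A\<^esub> eval_word A a w)"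

text \<open>Identities are nonzero noncommutative polynomials in countably many variables, with
  complex coefficients.\<close>

definition polynomial_identity :: "(complex, 'a) module \<Rightarrow> nat free_alg \<Rightarrow> bool" where
  "polynomial_identity A f \<longleftrightarrow>
    f \<noteq> 0 \<and> (\<forall>a. (\<forall>i. a i \<in> carrier A) \<longrightarrow> eval_free A a f = \<zero>\<^bsub>A\<^esub>)"

text \<open>Half the minimal degree of a polynomial identity. The value is real, so that halving
  does not truncate; it is unspecified if there is no polynomial identity.\<close>

definition PI_deg :: "(complex, 'a) module \<Rightarrow> real" where
  "PI_deg A = real (LEAST d. \<exists>f. polynomial_identity A f \<and> free_degree f = d) / 2"

section \<open>Roots of unity\<close>

definition root_of_unity :: "complex \<Rightarrow> bool" where
  "root_of_unity z \<longleftrightarrow> (\<exists>k>0. z ^ k = 1)"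

text \<open>The order in the multiplicative group of nonzero complex numbers.\<close>

definition mult_order :: "complex \<Rightarrow> nat" where
  "mult_order z = group.ord (Multiplicative_Group.mult_of (ring_of_type_algebra :: complex ring)) z"

end

theory Submission
  imports Defs "HOL-Combinatorics.Combinatorics"
begin

text \<open>
  Put \<open>e3 = e1 e2 - s\<^sup>2 e2 e1\<close> and \<open>e4 = e3 e2 - r s e2 e3\<close>. The algebra is spanned by the ordered monomials
  \<open>e2\<^sup>i e4\<^sup>j e3\<^sup>k e1\<^sup>l\<close>, and it maps to a quantum torus in four generators by \<open>e1 \<mapsto> x1 + x3\<close>,
  \<open>e2 \<mapsto> x2 + x4\<close>, in the way of the Feigin homomorphisms. The torus acts irreducibly on a space of dimension
  \<open>N = p * A\<close>, where \<open>A\<close> is the order of \<open>r s\<close> and \<open>p\<close> is the least positive number with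
  \<open>(r/s)\<^bsup>2p\<^esup> = (r/s)\<^bsup>pA\<^esup> = 1\<close>. Rescaling the \<open>x\<^sub>i\<close> by powers of a parameter \<open>t\<close> and letting \<open>t\<close> tend to
  infinity, the root vectors \<open>e1, e2, e3, e4\<close> degenerate to the monomials \<open>x3, x2, x4 x3, x2\<^sup>2 x1\<close> with
  linearly independent exponents, which generate the torus as a group. Therefore the rescaled representations
  separate the points of the algebra, and it satisfies the standard identity of degree \<open>2 * N\<close> by the
  Amitsur-Levitzki theorem. Conversely a polynomial identity passes to the limits, hence
  to all \<open>N \<times> N\<close> matrices, and so has degree at least \<open>2 * N\<close>. It remains to
  express \<open>N\<close> through the orders of \<open>r\<^sup>2 s\<^sup>2\<close> and \<open>r\<^sup>2 / s\<^sup>2\<close>.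
\<close>

section \<open>The Amitsur-Levitzki theorem\<close>

text \<open>The two conditions on \<open>p\<close> come from diagonal operators. With
  \<open>b = r / s\<close> and \<open>c = r * s\<close>, quotients of torus monomials act on
  functions of \<open>(i, j)\<close> as multiplication by \<open>c^j\<close> and
  \<open>b^(2 i)\<close>, and on functions with period \<open>A\<close> in \<open>j\<close> the
  power \<open>X4 ^ A\<close> acts as \<open>b^(i A)\<close>. Together these values tell apart
  exactly the residues of \<open>j\<close> modulo \<open>A\<close> and of \<open>i\<close> modulo
  \<open>p\<close>. The obstacle is that \<open>e1\<close> and \<open>e2\<close> are sent to sums
  such as \<open>x1 + x3\<close> rather than to torus generators, and that no single
  finite-dimensional representation of this infinite-dimensional algebra is faithful. Limits resolve
  both: after division by the top weight, a combination of ordered monomials tends to a nonzero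
  multiple of one invertible torus monomial. Hence only the spanning of the ordered monomials is
  shown by straightening; their independence is a by-product of the separation. Since identities
  survive limits, neither the centre nor the quotient ring has to be described.\<close>

lemma sign_cycle_of_list:
  assumes "distinct cs" "cs \<noteq> []"
  shows "sign (cycle_of_list cs) = (- 1) ^ (length cs - 1)"
  using assms
proof (induction cs rule: cycle_of_list.induct)
  case (1 i j cs)
  then show ?case
    by (simp add: sign_compose permutation_swap_id permutation_of_cycle sign_swap_id del: o_apply)
qed auto

text \<open>Composition with the transposition is a sign-reversing involution of the permutations
  that does not change \<open>g\<close>, so the sum equals its own negative.\<close>

lemma sum_alternating_transpose:
  fixes g :: "('a \<Rightarrow> 'a) \<Rightarrow> 'c::field_char_0"
  assumes "finite S" "a \<in> S" "b \<in> S" "a \<noteq> b"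
    and "\<And>\<sigma>. \<sigma> permutes S \<Longrightarrow> g (transpose a b \<circ> \<sigma>) = g \<sigma>"
  shows "(\<Sum>\<sigma> | \<sigma> permutes S. of_int (sign \<sigma>) * g \<sigma>) = 0" (is "?s = 0")
proof -
  have p: "transpose a b permutes S" using assms by (simp add: permutes_swap_id)
  have "?s = (\<Sum>\<sigma> | \<sigma> permutes S. of_int (sign (transpose a b \<circ> \<sigma>)) * g (transpose a b \<circ> \<sigma>))"
    by (rule sum.reindex_bij_witness[of _ "\<lambda>\<sigma>. transpose a b \<circ> \<sigma>" "\<lambda>\<sigma>. transpose a b \<circ> \<sigma>"])
      (auto simp: p permutes_compose fun.map_comp simp flip: o_assoc)
  also have "\<dots> = (\<Sum>\<sigma> | \<sigma> permutes S. - (of_int (sign \<sigma>) * g \<sigma>))"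
    using assms by (intro sum.cong refl)
      (auto simp: sign_compose permutation_swap_id sign_swap_id permutes_imp_permutation)
  also have "\<dots> = - ?s" by (simp add: sum_negf)
  finally show ?thesis by simp
qed

text \<open>A product of traces, one for each cycle of \<open>\<pi>\<close> on \<open>{..L}\<close>:
  the trace of the product of the matrices \<open>Z p\<close> along that cycle. One sum over index
  functions avoids decomposing \<open>\<pi>\<close> into cycles.\<close>

definition cyclic_sum :: "'a set \<Rightarrow> nat \<Rightarrow> (nat \<Rightarrow> 'a \<Rightarrow> 'a \<Rightarrow> 'c) \<Rightarrow> (nat \<Rightarrow> nat) \<Rightarrow> 'c::field_char_0"
  where "cyclic_sum I L Z \<pi> = (\<Sum>j\<in>PiE {..L} (\<lambda>_. I). \<Prod>p\<le>L. Z p (j p) (j (\<pi> p)))"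

text \<open>Position \<open>L\<close> carries the fixed test matrix \<open>Y\<close>, and only the
  other positions are alternated; letting \<open>Y\<close> vary recovers a matrix identity from a
  trace identity.\<close>

definition alternating_sum ::
  "'a set \<Rightarrow> nat \<Rightarrow> (nat \<Rightarrow> 'a \<Rightarrow> 'a \<Rightarrow> 'c) \<Rightarrow> ('a \<Rightarrow> 'a \<Rightarrow> 'c) \<Rightarrow> (nat \<Rightarrow> nat) \<Rightarrow> 'c::field_char_0"
  where "alternating_sum I L M Y \<pi> = (\<Sum>\<tau> | \<tau> permutes {..<L}. of_int (sign \<tau>) *
           cyclic_sum I L (\<lambda>p. if p = L then Y else M (\<tau> p)) \<pi>)"

text \<open>Relabelling by \<open>\<kappa>\<close> acts twice, on the factors of the product and on
  the index functions; the second change turns \<open>\<pi>\<close> into its conjugate.\<close>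

lemma cyclic_sum_conjugate:
  assumes \<kappa>: "\<kappa> permutes {..L}" and \<pi>: "\<And>p. p \<le> L \<Longrightarrow> \<pi> p \<le> L" "\<And>p. p \<le> L \<Longrightarrow> \<pi>' p \<le> L"
    and conj: "\<And>p. p \<le> L \<Longrightarrow> \<kappa> (\<pi>' p) = \<pi> (\<kappa> p)"
  shows "cyclic_sum I L Z \<pi> = cyclic_sum I L (\<lambda>p. Z (\<kappa> p)) \<pi>'"
proof -
  have le: "\<kappa> p \<le> L \<longleftrightarrow> p \<le> L" for p
    using permutes_in_image[OF \<kappa>, of p] by simp
  have le': "inv_into UNIV \<kappa> p \<le> L \<longleftrightarrow> p \<le> L" for p
    using permutes_in_image[OF permutes_inv[OF \<kappa>], of p] by simp
  have "cyclic_sum I L Z \<pi> = (\<Sum>j\<in>PiE {..L} (\<lambda>_. I). \<Prod>p\<le>L. Z (\<kappa> p) (j (\<kappa> p)) (j (\<pi> (\<kappa> p))))"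
    unfolding cyclic_sum_def
    by (intro sum.cong refl prod.reindex_bij_betw[symmetric] permutes_imp_bij \<kappa>)
  also have "\<dots> = (\<Sum>j\<in>PiE {..L} (\<lambda>_. I). \<Prod>p\<le>L. Z (\<kappa> p) (j (\<kappa> p)) (j (\<kappa> (\<pi>' p))))"
    by (intro sum.cong prod.cong refl) (simp add: conj)
  also have "\<dots> = cyclic_sum I L (\<lambda>p. Z (\<kappa> p)) \<pi>'"
    unfolding cyclic_sum_def
  proof (rule sum.reindex_bij_witness[of _ "\<lambda>j. j \<circ> inv_into UNIV \<kappa>" "\<lambda>j. j \<circ> \<kappa>"])
    fix j assume j: "j \<in> PiE {..L} (\<lambda>_. I)"
    show "j \<circ> \<kappa> \<circ> inv_into UNIV \<kappa> = j" by (simp add: o_assoc[symmetric] permutes_inv_o[OF \<kappa>])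
    show "j \<circ> inv_into UNIV \<kappa> \<circ> \<kappa> = j" by (simp add: o_assoc[symmetric] permutes_inv_o[OF \<kappa>])
    show "j \<circ> \<kappa> \<in> PiE {..L} (\<lambda>_. I)" using j le by (auto simp: PiE_iff extensional_def)
    show "j \<circ> inv_into UNIV \<kappa> \<in> PiE {..L} (\<lambda>_. I)" using j le' by (auto simp: PiE_iff extensional_def)
  qed auto
  finally show ?thesis .
qed

text \<open>Since \<open>\<kappa>\<close> fixes \<open>L\<close>, the matrix \<open>Y\<close> stays
  in place, and passing from \<open>\<tau>\<close> to \<open>\<tau> \<circ> \<kappa>\<close> costs
  \<open>sign \<kappa>\<close>. An odd \<open>\<kappa>\<close> commuting with \<open>\<pi>\<close>
  thus forces the sum to be 0.\<close>

lemma alternating_sum_conjugate: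
  assumes \<kappa>: "\<kappa> permutes {..<L}" and \<pi>: "\<And>p. p \<le> L \<Longrightarrow> \<pi> p \<le> L" "\<And>p. p \<le> L \<Longrightarrow> \<pi>' p \<le> L"
    and conj: "\<And>p. p \<le> L \<Longrightarrow> \<kappa> (\<pi>' p) = \<pi> (\<kappa> p)"
  shows "alternating_sum I L M Y \<pi> = of_int (sign \<kappa>) * (alternating_sum I L M Y \<pi>' :: 'c::field_char_0)"
proof -
  have \<kappa>': "\<kappa> permutes {..L}" using \<kappa> by (rule permutes_subset) auto
  have L: "\<kappa> p = L \<longleftrightarrow> p = L" for p
    using inj_eq[OF permutes_inj[OF \<kappa>], of p L] permutes_not_in[OF \<kappa>, of L] by simp
  have "alternating_sum I L M Y \<pi> = (\<Sum>\<tau> | \<tau> permutes {..<L}. of_int (sign \<kappa>) *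
      (of_int (sign (\<tau> \<circ> \<kappa>)) * cyclic_sum I L (\<lambda>p. if p = L then Y else M ((\<tau> \<circ> \<kappa>) p)) \<pi>'))"
    unfolding alternating_sum_def
  proof (intro sum.cong refl)
    fix \<tau> assume "\<tau> \<in> {\<tau>. \<tau> permutes {..<L}}"
    then have s: "sign (\<tau> \<circ> \<kappa>) = sign \<tau> * sign \<kappa>"
      using \<kappa> by (auto intro!: sign_compose intro: permutes_imp_permutation)
    have sq: "of_int (sign \<kappa>) * (of_int (sign \<tau> * sign \<kappa>) * x) = of_int (sign \<tau>) * x" for x :: 'c
      by (cases \<kappa> rule: sign_cases) auto
    show "of_int (sign \<tau>) * cyclic_sum I L (\<lambda>p. if p = L then Y else M (\<tau> p)) \<pi> = of_int (sign \<kappa>) *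
      (of_int (sign (\<tau> \<circ> \<kappa>)) * cyclic_sum I L (\<lambda>p. if p = L then Y else M ((\<tau> \<circ> \<kappa>) p)) \<pi>')"
      using cyclic_sum_conjugate[of \<kappa> L \<pi> \<pi>' I "\<lambda>p. if p = L then Y else M (\<tau> p)", OF \<kappa>' \<pi> conj]
      unfolding s sq by (simp add: L cong: if_cong)
  qed
  also have "\<dots> = of_int (sign \<kappa>) * alternating_sum I L M Y \<pi>'"
    unfolding alternating_sum_def sum_distrib_left
    by (rule sum.reindex_bij_witness[of _ "\<lambda>\<tau>. \<tau> \<circ> inv_into UNIV \<kappa>" "\<lambda>\<tau>. \<tau> \<circ> \<kappa>"])
      (auto simp: o_assoc[symmetric] permutes_inv_o[OF \<kappa>] \<kappa> permutes_compose permutes_inv)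
  finally show ?thesis .
qed

text \<open>Along a cycle of \<open>\<sigma>\<close> every entry \<open>i < N\<close> becomes two
  consecutive positions \<open>2 * i\<close>, \<open>2 * i + 1\<close>, and the entry
  \<open>N\<close> becomes the single position \<open>2 * N\<close> of \<open>Y\<close>. In terms of
  traces, each of the \<open>N\<close> matrices other than \<open>Y\<close> is a product of two
  factors.\<close>

definition pair_perm :: "nat \<Rightarrow> (nat \<Rightarrow> nat) \<Rightarrow> nat \<Rightarrow> nat" where
  "pair_perm N \<sigma> p =
    (if p < 2 * N \<and> even p then p + 1 else if p \<le> 2 * N then 2 * \<sigma> (p div 2) else p)"

lemma pair_perm_permutes:
  assumes "\<sigma> permutes {..N}"
  shows "pair_perm N \<sigma> permutes {..2 * N}"
proof (rule inj_imp_permutes)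
  have \<sigma>: "\<sigma> i \<le> N \<longleftrightarrow> i \<le> N" for i using permutes_in_image[OF assms, of i] by simp
  show "inj_on (pair_perm N \<sigma>) {..2 * N}"
  proof (rule inj_onI)
    fix p q assume *: "p \<in> {..2 * N}" "q \<in> {..2 * N}" "pair_perm N \<sigma> p = pair_perm N \<sigma> q"
    have inj: "\<sigma> i = \<sigma> j \<longleftrightarrow> i = j" for i j using permutes_inj[OF assms] by (auto dest: injD)
    show "p = q"
    proof (cases "even p \<and> p < 2 * N"; cases "even q \<and> q < 2 * N")
      assume h: "\<not> (even p \<and> p < 2 * N)" "\<not> (even q \<and> q < 2 * N)"
      then have "p div 2 = q div 2" using * inj by (auto simp: pair_perm_def)
      moreover have "odd p \<or> p = 2 * N" "odd q \<or> q = 2 * N" using h * by auto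
      ultimately show ?thesis using * by (elim disjE) (auto elim!: oddE)
    next
      assume h: "even p \<and> p < 2 * N" "\<not> (even q \<and> q < 2 * N)"
      then have "p + 1 = 2 * \<sigma> (q div 2)" using * by (auto simp: pair_perm_def)
      then show ?thesis using h by (metis even_add even_mult_iff odd_one even_numeral)
    next
      assume h: "\<not> (even p \<and> p < 2 * N)" "even q \<and> q < 2 * N"
      then have "q + 1 = 2 * \<sigma> (p div 2)" using * by (auto simp: pair_perm_def)
      then show ?thesis using h by (metis even_add even_mult_iff odd_one even_numeral)
    qed (use * in \<open>auto simp: pair_perm_def\<close>)
  qed
  show "pair_perm N \<sigma> p \<in> {..2 * N}" if "p \<in> {..2 * N}" for p
    using that \<sigma>[of "p div 2"] unfolding pair_perm_def by auto
qed (auto simp: pair_perm_def)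

text \<open>There are \<open>N + 1\<close> even positions but only \<open>N\<close> values, so two of them agree, and swapping
  these two positions cancels the terms in pairs.\<close>

lemma sum_sign_cyclic_sum_pair_perm:
  assumes "finite I" "card I = N"
  shows "(\<Sum>\<sigma> | \<sigma> permutes {..N}. of_int (sign \<sigma>) * cyclic_sum I (2 * N) Z (pair_perm N \<sigma>)) = 0"
proof -
  have "(\<Sum>\<sigma> | \<sigma> permutes {..N}. of_int (sign \<sigma>) * cyclic_sum I (2 * N) Z (pair_perm N \<sigma>)) =
    (\<Sum>j\<in>PiE {..2 * N} (\<lambda>_. I). \<Sum>\<sigma> | \<sigma> permutes {..N}. of_int (sign \<sigma>) *
      (\<Prod>p\<le>2 * N. Z p (j p) (j (pair_perm N \<sigma> p))))"
    unfolding cyclic_sum_def sum_distrib_left by (rule sum.swap)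
  also have "\<dots> = 0"
  proof (rule sum.neutral, rule ballI)
    fix j assume j: "j \<in> PiE {..2 * N} (\<lambda>_. I)"
    have "\<not> inj_on (\<lambda>i. j (2 * i)) {..N}"
    proof
      assume "inj_on (\<lambda>i. j (2 * i)) {..N}"
      moreover have "(\<lambda>i. j (2 * i)) ` {..N} \<subseteq> I" using j by auto
      ultimately have "card {..N} \<le> card I" using assms(1) by (intro card_inj_on_le)
      then show False using assms by simp
    qed
    then obtain a b where ab: "a \<le> N" "b \<le> N" "a \<noteq> b" "j (2 * a) = j (2 * b)"
      by (auto simp: inj_on_def)
    have tr: "j (2 * transpose a b x) = j (2 * x)" for x
      using ab by (auto simp: transpose_def)
    show "(\<Sum>\<sigma> | \<sigma> permutes {..N}. of_int (sign \<sigma>) *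
      (\<Prod>p\<le>2 * N. Z p (j p) (j (pair_perm N \<sigma> p)))) = 0"
      by (rule sum_alternating_transpose[of _ a b])
        (use ab in \<open>auto simp: pair_perm_def tr intro!: prod.cong\<close>)
  qed
  finally show ?thesis .
qed

section \<open>Orbits of the paired permutations\<close>

lemma in_support_self:
  assumes "permutation p" shows "a \<in> set (support p a)"
  using least_power_of_permutation(2)[OF assms, of a] by force

lemma in_support_iff:
  assumes "permutation p" shows "p x \<in> set (support p a) \<longleftrightarrow> x \<in> set (support p a)"
proof
  assume "x \<in> set (support p a)"
  then obtain i where "x = (p ^^ i) a" unfolding support_set[OF assms] by auto
  then have "p x = (p ^^ Suc i) a" by simp
  then show "p x \<in> set (support p a)" unfolding support_set[OF assms] by blast
next
  have inj: "inj p" using assms by (simp add: permutation bij_is_inj)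
  assume "p x \<in> set (support p a)"
  then obtain i where i: "p x = (p ^^ i) a" unfolding support_set[OF assms] by auto
  obtain k where k: "i + least_power p a = Suc k"
    using least_power_of_permutation(2)[OF assms, of a] by (metis add_gr_0 gr0_implies_Suc)
  have "p x = (p ^^ Suc k) a"
    by (simp only: k[symmetric] funpow_add o_apply least_power_of_permutation(1)[OF assms] i)
  then have "x = (p ^^ k) a" using inj by (auto dest: injD)
  then show "x \<in> set (support p a)" unfolding support_set[OF assms] by blast
qed

text \<open>An orbit of \<open>pair_perm N \<sigma>\<close> avoiding \<open>2 * N\<close> consists of pairs \<open>2 * i\<close>, \<open>2 * i + 1\<close>, so the
  cycle on it is odd, and conjugation by it changes the sign of the alternating sum.\<close>

lemma alternating_sum_eq_0:
  assumes \<sigma>: "\<sigma> permutes {..N}" and q: "q \<le> 2 * N" "2 * N \<notin> set (support (pair_perm N \<sigma>) q)"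
  shows "alternating_sum I (2 * N) M Y (pair_perm N \<sigma>) = 0"
proof -
  define \<pi> where "\<pi> = pair_perm N \<sigma>"
  have \<pi>: "\<pi> permutes {..2 * N}" unfolding \<pi>_def by (rule pair_perm_permutes[OF \<sigma>])
  then have perm: "permutation \<pi>" by (rule permutes_imp_permutation[rotated]) auto
  define O' where "O' = set (support \<pi> q)"
  define \<rho> where "\<rho> = cycle_of_list (support \<pi> q)"
  have le: "\<pi> p \<le> 2 * N \<longleftrightarrow> p \<le> 2 * N" for p using permutes_in_image[OF \<pi>, of p] by simp
  have "(\<pi> ^^ k) q \<le> 2 * N" for k using q by (induction k) (auto simp: le)
  then have O_sub: "O' \<subseteq> {..<2 * N}"
    using q unfolding O'_def \<pi>_def[symmetric] by (force simp: nat_less_le)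
  have iff: "\<pi> x \<in> O' \<longleftrightarrow> x \<in> O'" for x unfolding O'_def by (rule in_support_iff[OF perm])
  have inO: "\<rho> x = \<pi> x" if "x \<in> O'" for x
    using cycle_restrict[OF perm, of x q] that unfolding O'_def \<rho>_def by simp
  have notinO: "\<rho> x = x" if "x \<notin> O'" for x
    using id_outside_supp[of x] that unfolding O'_def \<rho>_def by simp
  have "\<rho> permutes {..<2 * N}"
    unfolding \<rho>_def by (rule permutes_subset[OF cycle_permutes]) (use O_sub in \<open>simp add: O'_def\<close>)
  moreover have "\<rho> (\<pi> p) = \<pi> (\<rho> p)" for p
    using inO[of p] inO[of "\<pi> p"] notinO[of p] notinO[of "\<pi> p"] iff by (cases "p \<in> O'") auto
  ultimately have eq: "alternating_sum I (2 * N) M Y \<pi> = of_int (sign \<rho>) * alternating_sum I (2 * N) M Y \<pi>"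
    by (intro alternating_sum_conjugate) (auto simp: le)
  define C where "C = {i. 2 * i \<in> O'}"
  have pair: "2 * i + 1 \<in> O' \<longleftrightarrow> 2 * i \<in> O'" for i
  proof (cases "i < N")
    case True
    then have "\<pi> (2 * i) = 2 * i + 1" by (simp add: \<pi>_def pair_perm_def)
    with iff[of "2 * i"] show ?thesis by simp
  next
    case False
    then show ?thesis using O_sub by auto
  qed
  have "O' = (\<lambda>i. 2 * i) ` C \<union> (\<lambda>i. 2 * i + 1) ` C"
  proof (intro Set.set_eqI)
    fix x :: nat
    obtain i where "x = 2 * i \<or> x = 2 * i + 1" by (metis evenE oddE)
    moreover have "2 * i \<noteq> 2 * k + (1::nat)" "2 * i + 1 \<noteq> 2 * k" for k by arith+
    ultimately show "x \<in> O' \<longleftrightarrow> x \<in> (\<lambda>i. 2 * i) ` C \<union> (\<lambda>i. 2 * i + 1) ` C"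
      using pair[of i] unfolding C_def by (auto simp del: One_nat_def add_Suc_right)
  qed
  moreover have "finite C"
    by (rule finite_subset[of _ "{..N}"]) (use O_sub in \<open>auto simp: C_def\<close>)
  moreover have "card ((\<lambda>i. 2 * i) ` C \<union> (\<lambda>i. 2 * i + 1) ` C) = 2 * card C"
  proof (subst card_Un_disjoint)
    have "2 * x \<noteq> 2 * y + (1::nat)" for x y by arith
    then show "(\<lambda>i. 2 * i) ` C \<inter> (\<lambda>i. 2 * i + 1) ` C = {}" by (auto simp del: One_nat_def)
  qed (use \<open>finite C\<close> in \<open>auto simp: card_image inj_on_def\<close>)
  ultimately have "card O' = 2 * card C" by simp
  moreover have "card O' = length (support \<pi> q)"
    unfolding O'_def by (rule distinct_card[OF cycle_of_permutation[OF perm]])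
  moreover have "q \<in> O'" unfolding O'_def by (rule in_support_self[OF perm])
  ultimately have "even (length (support \<pi> q))" "support \<pi> q \<noteq> []"
    by (metis dvd_triv_left, metis O'_def empty_iff empty_set)
  then have "sign \<rho> = -1"
    unfolding \<rho>_def using cycle_of_permutation[OF perm, of q]
    by (subst sign_cycle_of_list) (simp_all add: minus_one_power_iff)
  with eq have "alternating_sum I (2 * N) M Y \<pi> = - alternating_sum I (2 * N) M Y \<pi>" by simp
  then show ?thesis by (simp add: \<pi>_def)
qed

definition pair_double :: "(nat \<Rightarrow> nat) \<Rightarrow> nat \<Rightarrow> nat" where
  "pair_double \<kappa> p = 2 * \<kappa> (p div 2) + p mod 2"

text \<open>Exchanging two blocks of length 2 is a product of two disjoint transpositions, hence
  even.\<close>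

lemma pair_double_permutes_sign:
  assumes "\<kappa> permutes {..<N}"
  shows "pair_double \<kappa> permutes {..<2 * N} \<and> sign (pair_double \<kappa>) = 1"
  using assms finite_lessThan
proof (induction rule: permutes_induct)
  case id
  have "pair_double id = id" by (auto simp: pair_double_def)
  then show ?case by (simp only: permutes_id sign_id simp_thms)
next
  case (swap a b p)
  have c: "pair_double (transpose a b \<circ> p) = pair_double (transpose a b) \<circ> pair_double p"
    by (auto simp: pair_double_def)
  have t: "pair_double (transpose a b) = transpose (2 * a) (2 * b) \<circ> transpose (2 * a + 1) (2 * b + 1)"
  proof
    fix x show "pair_double (transpose a b) x = (transpose (2 * a) (2 * b) \<circ> transpose (2 * a + 1) (2 * b + 1)) x"
      by (cases "even x") (auto simp: pair_double_def transpose_def elim!: evenE oddE, presburger+)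
  qed
  have s: "sign (pair_double (transpose a b)) = 1"
    unfolding t using swap by (subst sign_compose) (auto simp: permutation_swap_id sign_swap_id)
  have p: "pair_double (transpose a b) permutes {..<2 * N}"
    unfolding t using swap by (intro permutes_compose permutes_swap_id) auto
  from swap p have "pair_double (transpose a b \<circ> p) permutes {..<2 * N}"
    unfolding c by (auto intro: permutes_compose)
  moreover have "sign (pair_double (transpose a b \<circ> p)) = 1"
    unfolding c using swap p s by (subst sign_compose) (auto intro: permutes_imp_permutation)
  ultimately show ?case by (rule conjI)
qed

definition rotation :: "nat \<Rightarrow> nat \<Rightarrow> nat" where
  "rotation N i = (if i < N then Suc i else if i = N then 0 else i)"

lemma rotation_permutes: "rotation N permutes {..N}"
  by (rule inj_imp_permutes) (auto simp: rotation_def inj_on_def split: if_splits)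

text \<open>The positions reached from \<open>2 * N\<close> after 1, 3, 5, ... steps are even, and
  their halves list the cycle of \<open>\<sigma>\<close> starting after \<open>N\<close>;
  \<open>\<kappa>\<close> is this list. It has to fix \<open>N\<close> because \<open>Y\<close>
  stays in place.\<close>

lemma full_cycle_conjugate:
  assumes \<sigma>: "\<sigma> permutes {..N}"
    and full: "\<And>q. q \<le> 2 * N \<Longrightarrow> 2 * N \<in> set (support (pair_perm N \<sigma>) q)"
  obtains \<kappa> where "\<kappa> permutes {..<N}" "\<And>i. \<sigma> (\<kappa> i) = \<kappa> (rotation N i)"
proof -
  define \<pi> where "\<pi> = pair_perm N \<sigma>"
  have \<pi>: "\<pi> permutes {..2 * N}" unfolding \<pi>_def by (rule pair_perm_permutes[OF \<sigma>])
  then have perm: "permutation \<pi>" by (rule permutes_imp_permutation[rotated]) auto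
  have le: "\<pi> p \<le> 2 * N \<longleftrightarrow> p \<le> 2 * N" for p using permutes_in_image[OF \<pi>, of p] by simp
  have fle: "(\<pi> ^^ k) (2 * N) \<le> 2 * N" for k by (induction k) (auto simp: le)
  have "set (support \<pi> (2 * N)) = {..2 * N}"
  proof (intro equalityI subsetI)
    fix q assume "q \<in> {..2 * N}"
    then have "2 * N \<in> set (support \<pi> q)" using full by (simp add: \<pi>_def)
    then show "q \<in> set (support \<pi> (2 * N))"
      using disjoint_support'[OF perm, of q "2 * N"] disjoint_support'[OF perm, of "2 * N" q]
      by (metis Int_commute)
  qed (use fle in auto)
  then have lp: "least_power \<pi> (2 * N) = 2 * N + 1"
    using distinct_card[OF cycle_of_permutation[OF perm, of "2 * N"]] by simp
  have dist: "i = j" if "(\<pi> ^^ i) (2 * N) = (\<pi> ^^ j) (2 * N)" "i < 2 * N + 1" "j < 2 * N + 1" for i j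
    using cycle_of_permutation[OF perm, of "2 * N"] that
    unfolding lp distinct_map set_upt by (elim conjE inj_onD) auto
  have last: "(\<pi> ^^ (2 * N + 1)) (2 * N) = 2 * N"
    using least_power_of_permutation(1)[OF perm, of "2 * N"] unfolding lp .
  have lt: "(\<pi> ^^ (2 * i + 1)) (2 * N) < 2 * N" if "i < N" for i
    using dist[of "2 * i + 1" 0] fle[of "2 * i + 1"] that by (auto simp: nat_less_le)
  have ev: "even ((\<pi> ^^ (2 * i + 1)) (2 * N))" if "i \<le> N" for i
    using that
  proof (induction i)
    case 0
    show ?case by (simp add: \<pi>_def pair_perm_def)
  next
    case (Suc i)
    define x where "x = (\<pi> ^^ (2 * i + 1)) (2 * N)"
    have x: "even x" "x < 2 * N" using Suc lt[of i] by (auto simp: x_def)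
    have "(\<pi> ^^ (2 * Suc i + 1)) (2 * N) = \<pi> (\<pi> x)" by (simp add: x_def)
    also have "\<pi> x = x + 1" using x by (simp add: \<pi>_def pair_perm_def)
    also have "even (\<pi> (x + 1))" using x by (auto simp: \<pi>_def pair_perm_def)
    finally show ?case .
  qed
  define \<kappa> where "\<kappa> i = (if i < N then (\<pi> ^^ (2 * i + 1)) (2 * N) div 2 else i)" for i
  have \<kappa>2: "(\<pi> ^^ (2 * i + 1)) (2 * N) = 2 * \<kappa> i" if "i \<le> N" for i
    using ev[OF that] last that by (cases "i = N") (auto simp: \<kappa>_def)
  have \<kappa>_lt: "\<kappa> i < N" if "i < N" for i
    using lt[OF that] \<kappa>2[of i] that by simp
  have "\<kappa> permutes {..<N}"
  proof (rule inj_imp_permutes)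
    show "inj_on \<kappa> {..<N}"
    proof (rule inj_onI)
      fix i j assume "i \<in> {..<N}" "j \<in> {..<N}" "\<kappa> i = \<kappa> j"
      then show "i = j" using \<kappa>2[of i] \<kappa>2[of j] dist[of "2 * i + 1" "2 * j + 1"] by auto
    qed
  qed (auto simp: \<kappa>_lt, simp add: \<kappa>_def)
  moreover have "\<sigma> (\<kappa> i) = \<kappa> (rotation N i)" for i
  proof -
    consider "i < N" | "i = N" | "i > N" by linarith
    then show ?thesis
    proof cases
      case 1
      have "2 * \<kappa> (Suc i) = \<pi> (\<pi> (2 * \<kappa> i))"
        using \<kappa>2[of i] \<kappa>2[of "Suc i"] 1 by simp
      also have "\<pi> (2 * \<kappa> i) = 2 * \<kappa> i + 1" using \<kappa>_lt[OF 1] by (simp add: \<pi>_def pair_perm_def)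
      also have "\<pi> (2 * \<kappa> i + 1) = 2 * \<sigma> (\<kappa> i)" using \<kappa>_lt[OF 1] by (simp add: \<pi>_def pair_perm_def)
      finally show ?thesis using 1 by (simp add: rotation_def)
    next
      case 2
      have "2 * \<kappa> 0 = \<pi> (2 * N)" using \<kappa>2[of 0] by simp
      also have "\<dots> = 2 * \<sigma> N" by (simp add: \<pi>_def pair_perm_def)
      finally show ?thesis using 2 by (simp add: rotation_def \<kappa>_def)
    next
      case 3
      then show ?thesis using permutes_not_in[OF \<sigma>, of i] by (simp add: rotation_def \<kappa>_def)
    qed
  qed
  ultimately show ?thesis using that by blast
qed

text \<open>The signs agree because \<open>\<sigma>\<close> and the rotation are conjugate, and the
  alternating sums agree because \<open>pair_double \<kappa>\<close> is even. So the full cycles all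
  contribute the same term and cannot cancel each other.\<close>

lemma alternating_sum_full_cycle:
  assumes \<sigma>: "\<sigma> permutes {..N}"
    and full: "\<And>q. q \<le> 2 * N \<Longrightarrow> 2 * N \<in> set (support (pair_perm N \<sigma>) q)"
  shows "of_int (sign \<sigma>) * alternating_sum I (2 * N) M Y (pair_perm N \<sigma>) =
    of_int (sign (rotation N)) * (alternating_sum I (2 * N) M Y (pair_perm N (rotation N)) :: 'c::field_char_0)"
proof -
  obtain \<kappa> where \<kappa>: "\<kappa> permutes {..<N}" and conj: "\<And>i. \<sigma> (\<kappa> i) = \<kappa> (rotation N i)"
    using full_cycle_conjugate[OF assms] by blast
  have \<kappa>N: "\<kappa> N = N" using permutes_not_in[OF \<kappa>, of N] by simp
  have \<kappa>_lt: "\<kappa> i < N \<longleftrightarrow> i < N" for i using permutes_in_image[OF \<kappa>, of i] by simp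
  have p\<kappa>: "permutation \<kappa>" using \<kappa> by (rule permutes_imp_permutation[rotated]) auto
  have p: "permutation \<sigma>" "permutation (rotation N)"
    using \<sigma> rotation_permutes by (auto intro: permutes_imp_permutation)
  have "\<sigma> \<circ> \<kappa> = \<kappa> \<circ> rotation N" using conj by auto
  then have "sign \<sigma> * sign \<kappa> = sign \<kappa> * sign (rotation N)"
    using p p\<kappa> by (metis sign_compose)
  then have sgn: "sign \<sigma> = sign (rotation N)" by simp
  have le: "pair_perm N \<rho> p \<le> 2 * N" if "p \<le> 2 * N" "\<rho> permutes {..N}" for \<rho> p
    using permutes_in_image[OF pair_perm_permutes[OF that(2)], of p] that by simp
  have "alternating_sum I (2 * N) M Y (pair_perm N \<sigma>) =
    of_int (sign (pair_double \<kappa>)) * alternating_sum I (2 * N) M Y (pair_perm N (rotation N))"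
  proof (rule alternating_sum_conjugate)
    fix p assume p: "p \<le> 2 * N"
    show "pair_double \<kappa> (pair_perm N (rotation N) p) = pair_perm N \<sigma> (pair_double \<kappa> p)"
    proof (cases "even p")
      case True
      then obtain i where i: "p = 2 * i" by (rule evenE)
      show ?thesis
      proof (cases "i < N")
        case True
        then show ?thesis using \<kappa>_lt[of i] by (simp add: i pair_double_def pair_perm_def)
      next
        case False
        then have "i = N" using p i by simp
        then show ?thesis using conj[of N] by (simp add: i pair_double_def pair_perm_def \<kappa>N)
      qed
    next
      case False
      then obtain i where i: "p = 2 * i + 1" by (rule oddE)
      then have "i < N" using p by simp
      then show ?thesis using \<kappa>_lt[of i] conj[of i] by (simp add: i pair_double_def pair_perm_def)
    qed
  qed (use pair_double_permutes_sign[OF \<kappa>] le \<sigma> rotation_permutes in auto)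
  then show ?thesis using pair_double_permutes_sign[OF \<kappa>] by (simp add: sgn)
qed

text \<open>For the rotation the paired permutation is the successor function below
  \<open>2 * N\<close>; its term is therefore a single trace of the matrices in their written
  order.\<close>

lemma rotation_full_cycle:
  assumes "q \<le> 2 * N"
  shows "2 * N \<in> set (support (pair_perm N (rotation N)) q)"
proof -
  have step: "pair_perm N (rotation N) p = p + 1" if "p < 2 * N" for p
    using that by (cases "even p") (auto simp: pair_perm_def rotation_def elim!: oddE)
  have "(pair_perm N (rotation N) ^^ k) q = q + k" if "q + k \<le> 2 * N" for k
    using that by (induction k) (auto simp: step)
  from this[of "2 * N - q"] have "(pair_perm N (rotation N) ^^ (2 * N - q)) q = 2 * N"
    using assms by simp
  moreover have "permutation (pair_perm N (rotation N))"
    by (rule permutes_imp_permutation[OF _ pair_perm_permutes[OF rotation_permutes]]) simp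
  ultimately show ?thesis by (metis support_set rangeI)
qed

text \<open>Taking matrix units for the test matrix \<open>Y\<close> gives the usual form of the theorem. The proof alternates
  the fundamental trace identity of \<open>N + 1\<close> matrices over substitutions of products of two factors
  (Razmyslov).\<close>

theorem amitsur_levitzki_trace:
  fixes M :: "nat \<Rightarrow> 'a \<Rightarrow> 'a \<Rightarrow> 'c::field_char_0"
  assumes "finite I" "card I = N"
  shows "(\<Sum>\<tau> | \<tau> permutes {..<2 * N}. of_int (sign \<tau>) * (\<Sum>j\<in>PiE {..2 * N} (\<lambda>_. I).
           (\<Prod>p<2 * N. M (\<tau> p) (j p) (j (Suc p))) * Y (j (2 * N)) (j 0))) = 0"
proof -
  let ?F = "{\<sigma>. \<sigma> permutes {..N} \<and> (\<forall>q\<le>2 * N. 2 * N \<in> set (support (pair_perm N \<sigma>) q))}"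
  let ?A = "\<lambda>\<sigma>. of_int (sign \<sigma>) * alternating_sum I (2 * N) M Y (pair_perm N \<sigma>)"
  have "(\<Sum>\<sigma> | \<sigma> permutes {..N}. ?A \<sigma>) = (\<Sum>\<tau> | \<tau> permutes {..<2 * N}. of_int (sign \<tau>) *
      (\<Sum>\<sigma> | \<sigma> permutes {..N}. of_int (sign \<sigma>) *
        cyclic_sum I (2 * N) (\<lambda>p. if p = 2 * N then Y else M (\<tau> p)) (pair_perm N \<sigma>)))"
    unfolding alternating_sum_def sum_distrib_left by (subst sum.swap) (simp add: mult.left_commute)
  also have "\<dots> = 0" by (simp add: sum_sign_cyclic_sum_pair_perm[OF assms])
  finally have "0 = (\<Sum>\<sigma> | \<sigma> permutes {..N}. ?A \<sigma>)" by simp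
  also have "\<dots> = (\<Sum>\<sigma>\<in>?F. ?A \<sigma>)"
    by (rule sum.mono_neutral_right) (use alternating_sum_eq_0 in \<open>fastforce simp: finite_permutations simp del: set_map set_upt\<close>)+
  also have "\<dots> = (\<Sum>\<sigma>\<in>?F. ?A (rotation N))"
    by (rule sum.cong) (auto intro: alternating_sum_full_cycle)
  also have "\<dots> = of_nat (card ?F) * ?A (rotation N)" by simp
  finally have "of_nat (card ?F) * ?A (rotation N) = 0" by simp
  \<comment> \<open>The common term of the full cycles can be divided by their number:
    characteristic 0 is used here, and the rotation shows that there is at least one.\<close>
  moreover have "card ?F \<noteq> 0"
  proof -
    have "finite ?F" by (rule finite_subset[OF _ finite_permutations[of "{..N}"]]) auto
    moreover have "rotation N \<in> ?F" by (simp add: rotation_permutes rotation_full_cycle del: set_map set_upt)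
    ultimately show ?thesis by auto
  qed
  ultimately have "alternating_sum I (2 * N) M Y (pair_perm N (rotation N)) = 0"
    by (auto simp: sign_def split: if_splits)
  moreover have "cyclic_sum I (2 * N) (\<lambda>p. if p = 2 * N then Y else M (\<tau> p)) (pair_perm N (rotation N)) =
    (\<Sum>j\<in>PiE {..2 * N} (\<lambda>_. I). (\<Prod>p<2 * N. M (\<tau> p) (j p) (j (Suc p))) * Y (j (2 * N)) (j 0))" for \<tau>
  proof -
    have step: "pair_perm N (rotation N) p = Suc p" if "p < 2 * N" for p
      using that by (cases "even p") (auto simp: pair_perm_def rotation_def elim!: oddE)
    have last: "pair_perm N (rotation N) (2 * N) = 0" by (simp add: pair_perm_def rotation_def)
    have set: "{..2 * N} = insert (2 * N) {..<2 * N}" by auto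
    show ?thesis
      unfolding cyclic_sum_def set
      by (intro sum.cong refl) (simp add: last step mult.commute[of "Y (j (2 * N)) (j 0)" for j])
  qed
  ultimately show ?thesis unfolding alternating_sum_def by simp
qed

section \<open>Evaluation of noncommutative polynomials\<close>

text \<open>The algebra structure is a central ring homomorphism \<open>C\<close>, so that one
  evaluation map \<open>ev\<close> serves both the free algebra and the algebra of
  operators.\<close>

locale complex_scalars =
  fixes C :: "complex \<Rightarrow> 'a::ring_1"
  assumes C_add: "C (a + b) = C a + C b"
    and C_mult: "C (a * b) = C a * C b"
    and C_1: "C 1 = 1"
    and C_commute: "x * C a = C a * x"
begin

lemma C_0: "C 0 = 0"
  using C_add[of 0 0] by simp

lemma C_minus: "C (- a) = - C a"
  using C_add[of a "- a"] by (simp add: C_0 eq_neg_iff_add_eq_0 add.commute)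

lemma C_diff: "C (a - b) = C a - C b"
  using C_add[of a "- b"] by (simp add: C_minus)

lemma C_left_commute: "x * (C a * y) = C a * (x * y)"
  by (metis C_commute mult.assoc)

definition ev :: "('x \<Rightarrow> 'a) \<Rightarrow> 'x free_alg \<Rightarrow> 'a" where
  "ev g f = (\<Sum>w\<in>Poly_Mapping.keys f. C (Poly_Mapping.lookup f w) * prod_list (map g (letters w)))"

lemma ev_superset:
  assumes "finite S" "Poly_Mapping.keys f \<subseteq> S"
  shows "ev g f = (\<Sum>w\<in>S. C (Poly_Mapping.lookup f w) * prod_list (map g (letters w)))"
  unfolding ev_def using assms by (intro sum.mono_neutral_left) (auto simp: C_0 in_keys_iff)

lemma ev_add: "ev g (f + h) = ev g f + ev g h"
proof -
  let ?S = "Poly_Mapping.keys f \<union> Poly_Mapping.keys h"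
  have "Poly_Mapping.keys (f + h) \<subseteq> ?S" by (rule Poly_Mapping.keys_add)
  then show ?thesis
    by (simp add: ev_superset[of ?S] lookup_add C_add distrib_right sum.distrib)
qed

lemma ev_0: "ev g 0 = 0"
  by (simp add: ev_def)

lemma ev_single: "ev g (Poly_Mapping.single w c) = C c * prod_list (map g (letters w))"
  by (subst ev_superset[of "{w}"]) auto

lemma ev_scalar: "ev g (scalar c) = C c"
  by (simp add: scalar_def ev_single zero_fword_def)

lemma ev_1: "ev g 1 = 1"
  using ev_scalar[of g 1] by (simp add: scalar_def C_1)

lemma ev_var: "ev g (var x) = g x"
  by (simp add: var_def ev_single C_1)

lemma ev_minus: "ev g (- f) = - ev g f"
  using ev_add[of g f "- f"] by (simp add: ev_0 eq_neg_iff_add_eq_0 add.commute)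

lemma ev_diff: "ev g (f - h) = ev g f - ev g h"
  using ev_add[of g f "- h"] by (simp add: ev_minus)

lemma ev_sum: "ev g (sum f S) = (\<Sum>x\<in>S. ev g (f x))"
  by (induction S rule: infinite_finite_induct) (simp_all add: ev_0 ev_add)

end

lemma free_alg_sum_single:
  "f = (\<Sum>w\<in>Poly_Mapping.keys f. Poly_Mapping.single w (Poly_Mapping.lookup f w))"
proof (rule poly_mapping_eqI)
  fix k
  have "(\<Sum>w\<in>Poly_Mapping.keys f. Poly_Mapping.lookup (Poly_Mapping.single w (Poly_Mapping.lookup f w)) k) =
    (\<Sum>w\<in>Poly_Mapping.keys f. if k = w then Poly_Mapping.lookup f w else 0)"
    by (intro sum.cong refl) (auto simp: lookup_single when_def)
  also have "\<dots> = Poly_Mapping.lookup f k" by (simp add: in_keys_iff)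
  finally show "Poly_Mapping.lookup f k = Poly_Mapping.lookup
    (\<Sum>w\<in>Poly_Mapping.keys f. Poly_Mapping.single w (Poly_Mapping.lookup f w)) k"
    by (simp add: lookup_sum)
qed

context complex_scalars
begin

lemma ev_mult: "ev g (f * h) = ev g f * ev g h"
proof -
  have s: "ev g (Poly_Mapping.single v a * Poly_Mapping.single w b) =
      ev g (Poly_Mapping.single v a) * ev g (Poly_Mapping.single w b)" for v w a b
    by (simp add: mult_single ev_single plus_fword_def C_mult mult.assoc C_left_commute[of "prod_list (map g (letters v))"])
  have "f * h = (\<Sum>v\<in>Poly_Mapping.keys f. Poly_Mapping.single v (Poly_Mapping.lookup f v)) *
     (\<Sum>w\<in>Poly_Mapping.keys h. Poly_Mapping.single w (Poly_Mapping.lookup h w))"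
    by (simp only: free_alg_sum_single[symmetric])
  also have "ev g \<dots> = (\<Sum>v\<in>Poly_Mapping.keys f. ev g (Poly_Mapping.single v (Poly_Mapping.lookup f v))) *
     (\<Sum>w\<in>Poly_Mapping.keys h. ev g (Poly_Mapping.single w (Poly_Mapping.lookup h w)))"
    by (simp add: sum_product ev_sum s)
  also have "\<dots> = ev g f * ev g h"
    by (simp only: ev_sum[symmetric] free_alg_sum_single[symmetric])
  finally show ?thesis .
qed

lemma ev_power: "ev g (f ^ n) = ev g f ^ n"
  by (induction n) (simp_all add: ev_1 ev_mult)

lemma ev_prod_list: "ev g (prod_list (map f xs)) = prod_list (map (\<lambda>x. ev g (f x)) xs)"
  by (induction xs) (simp_all add: ev_1 ev_mult)

lemmas ev_simps = ev_add ev_minus ev_diff ev_mult ev_power ev_0 ev_1 ev_var ev_scalar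

end

lemma mult_scalar:
  fixes f :: "'x free_alg"
  shows "f * scalar c = scalar c * f"
proof -
  have "Poly_Mapping.single w a * scalar c = scalar c * Poly_Mapping.single w a" for w :: "'x fword" and a
    by (simp add: scalar_def mult_single mult.commute)
  then have "(\<Sum>w\<in>Poly_Mapping.keys f. Poly_Mapping.single w (Poly_Mapping.lookup f w)) * scalar c =
      scalar c * (\<Sum>w\<in>Poly_Mapping.keys f. Poly_Mapping.single w (Poly_Mapping.lookup f w))"
    unfolding sum_distrib_left sum_distrib_right by (intro sum.cong refl)
  then show ?thesis by (simp only: free_alg_sum_single[symmetric])
qed

interpretation free: complex_scalars "scalar :: complex \<Rightarrow> 'x free_alg"
  by unfold_locales (rule mult_scalar | simp add: scalar_def single_add mult_single)+

lemma (in complex_scalars) ev_free_ev: "ev g (free.ev h f) = ev (\<lambda>x. ev g (h x)) f"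
  by (simp add: free.ev_def ev_sum ev_simps ev_prod_list) (simp add: ev_def)

section \<open>Quotients of free algebras\<close>

lemma ring_of_type: "ring (ring_of_type_algebra :: 'a::ring_1 ring)"
proof -
  have "\<exists>y. x + y = 0" for x :: 'a
    by (rule exI[of _ "- x"]) simp
  then show ?thesis
    unfolding ring_of_type_algebra_def
    by unfold_locales (auto simp: algebra_simps Units_def add_eq_0_iff2)
qed

abbreviation free_ring :: "'x free_alg ring" where
  "free_ring \<equiv> ring_of_type_algebra"

lemma free_ring_simps [simp]:
  "carrier free_ring = UNIV" "x \<otimes>\<^bsub>free_ring\<^esub> y = x * y" "\<one>\<^bsub>free_ring\<^esub> = 1"
  "x \<oplus>\<^bsub>free_ring\<^esub> y = x + y" "\<zero>\<^bsub>free_ring\<^esub> = 0"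
  by (simp_all add: ring_of_type_algebra_def)

definition relation_ideal :: "'x free_alg set \<Rightarrow> 'x free_alg set" where
  "relation_ideal R = Idl\<^bsub>free_ring\<^esub> R"

lemma relation_ideal: "ideal (relation_ideal R) free_ring"
  unfolding relation_ideal_def by (rule ring.genideal_ideal[OF ring_of_type]) simp

lemma relation_ideal_props:
  shows relation_ideal_rel: "x \<in> R \<Longrightarrow> x \<in> relation_ideal R"
    and relation_ideal_0: "0 \<in> relation_ideal R"
    and relation_ideal_add: "x \<in> relation_ideal R \<Longrightarrow> y \<in> relation_ideal R \<Longrightarrow> x + y \<in> relation_ideal R"
    and relation_ideal_left: "x \<in> relation_ideal R \<Longrightarrow> z * x \<in> relation_ideal R"
    and relation_ideal_right: "x \<in> relation_ideal R \<Longrightarrow> x * z \<in> relation_ideal R"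
proof -
  interpret ideal "relation_ideal R" free_ring by (rule relation_ideal)
  show "x \<in> R \<Longrightarrow> x \<in> relation_ideal R"
    unfolding relation_ideal_def using ring.genideal_self[OF ring_of_type, of R] by auto
  show "0 \<in> relation_ideal R" using additive_subgroup.zero_closed[OF ideal.axioms(1)[OF relation_ideal], of R] by simp
  show "x \<in> relation_ideal R \<Longrightarrow> y \<in> relation_ideal R \<Longrightarrow> x + y \<in> relation_ideal R"
    using additive_subgroup.a_closed[OF ideal.axioms(1)[OF relation_ideal], of x R y] by simp
  show "x \<in> relation_ideal R \<Longrightarrow> z * x \<in> relation_ideal R"
    using I_l_closed[of x z] by simp
  show "x \<in> relation_ideal R \<Longrightarrow> x * z \<in> relation_ideal R"
    using I_r_closed[of x z] by simp
qed

lemma relation_ideal_minus: "x \<in> relation_ideal R \<Longrightarrow> - x \<in> relation_ideal R"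
  using relation_ideal_left[of x R "- 1"] by simp

lemma relation_ideal_diff: "x \<in> relation_ideal R \<Longrightarrow> y \<in> relation_ideal R \<Longrightarrow> x - y \<in> relation_ideal R"
  using relation_ideal_add[of x R "- y"] relation_ideal_minus[of y] by simp

lemma (in complex_scalars) ev_relation_ideal:
  assumes "\<And>x. x \<in> R \<Longrightarrow> ev g x = 0" "f \<in> relation_ideal R"
  shows "ev g f = 0"
proof -
  have "ideal {f. ev g f = 0} free_ring"
  proof (rule idealI[OF ring_of_type])
    have grp: "Group.group (add_monoid (free_ring :: 'b free_alg ring))"
      using ring_of_type by (meson abelian_group.a_group ring.is_abelian_group)
    show "subgroup {f. ev g f = 0} (add_monoid free_ring)"
    proof (rule group.subgroupI)
      show "Group.group (add_monoid (free_ring :: 'b free_alg ring))" by (rule grp)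
      show "{f. ev g f = 0} \<noteq> {}" using ev_0[of g] by blast
    next
      fix a :: "'b free_alg" assume "a \<in> {f. ev g f = 0}"
      moreover have "inv\<^bsub>add_monoid free_ring\<^esub> a = - a"
        using ring_of_type[where ?'a = "'b free_alg"]
        by (intro group.inv_equality[OF grp]) auto
      ultimately show "inv\<^bsub>add_monoid free_ring\<^esub> a \<in> {f. ev g f = 0}" by (simp add: ev_simps)
    qed (simp_all add: ev_simps)
  qed (simp_all add: ev_simps)
  then have "relation_ideal R \<subseteq> {f. ev g f = 0}"
    unfolding relation_ideal_def by (rule ring.genideal_minimal[OF ring_of_type]) (use assms(1) in blast)
  then show ?thesis using assms(2) by blast
qed

definition coset :: "'x free_alg set \<Rightarrow> 'x free_alg \<Rightarrow> 'x free_alg set" where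
  "coset R f = relation_ideal R +>\<^bsub>free_ring\<^esub> f"

lemma coset_altdef: "coset R f = (\<lambda>x. x + f) ` relation_ideal R"
  by (auto simp: coset_def a_r_coset_def r_coset_def)

lemma coset_eq_iff: "coset R f = coset R g \<longleftrightarrow> f - g \<in> relation_ideal R"
proof
  assume "coset R f = coset R g"
  moreover have "f \<in> coset R f" 
    unfolding coset_altdef by (rule image_eqI[of _ _ 0]) (auto simp: relation_ideal_0)
  ultimately show "f - g \<in> relation_ideal R" unfolding coset_altdef by auto
next
  assume *: "f - g \<in> relation_ideal R"
  have "x + f \<in> coset R g" if "x \<in> relation_ideal R" for x
    unfolding coset_altdef by (rule image_eqI[of _ _ "x + (f - g)"]) (use that * relation_ideal_add in auto)
  moreover have "x + g \<in> coset R f" if "x \<in> relation_ideal R" for x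
    unfolding coset_altdef by (rule image_eqI[of _ _ "x - (f - g)"]) (use that * relation_ideal_diff in auto)
  ultimately show "coset R f = coset R g" by (auto simp: coset_altdef)
qed

lemma presented_algebra_simps:
  shows carrier_presented: "carrier (presented_algebra R) = range (coset R)"
    and mult_presented: "coset R f \<otimes>\<^bsub>presented_algebra R\<^esub> coset R g = coset R (f * g)"
    and one_presented: "\<one>\<^bsub>presented_algebra R\<^esub> = coset R 1"
    and zero_presented: "\<zero>\<^bsub>presented_algebra R\<^esub> = coset R 0"
    and add_presented: "coset R f \<oplus>\<^bsub>presented_algebra R\<^esub> coset R g = coset R (f + g)"
    and smult_presented: "c \<odot>\<^bsub>presented_algebra R\<^esub> coset R f = coset R (scalar c * f)"
proof -
  interpret ideal "relation_ideal R" free_ring by (rule relation_ideal)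
  note defs = presented_algebra_def Let_def ring.extend_def module.fields_def FactRing_def relation_ideal_def[symmetric]
  show "carrier (presented_algebra R) = range (coset R)"
    by (auto simp: defs A_RCOSETS_def RCOSETS_def coset_def a_r_coset_def)
  show "coset R f \<otimes>\<^bsub>presented_algebra R\<^esub> coset R g = coset R (f * g)"
    using rcoset_mult_add[of f g] by (simp add: defs coset_def)
  show "\<one>\<^bsub>presented_algebra R\<^esub> = coset R 1" by (simp add: defs coset_def)
  show "\<zero>\<^bsub>presented_algebra R\<^esub> = coset R 0"
    by (simp add: defs coset_altdef)
  show "coset R f \<oplus>\<^bsub>presented_algebra R\<^esub> coset R g = coset R (f + g)"
    using a_rcos_sum[of f g] by (simp add: defs coset_def)
  \<comment> \<open>In \<open>presented_algebra\<close> the scalar multiple is a union over the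
    members of the coset. All members yield the same coset, so the union collapses to it.\<close>
  have "coset R (scalar c * x) = coset R (scalar c * f)" if "x \<in> coset R f" for x
    using that relation_ideal_left[of "x - f" R "scalar c"] unfolding coset_eq_iff
    by (auto simp: coset_altdef right_diff_distrib)
  moreover have "coset R f \<noteq> {}" unfolding coset_altdef using relation_ideal_0[of R] by auto
  ultimately show "c \<odot>\<^bsub>presented_algebra R\<^esub> coset R f = coset R (scalar c * f)"
    by (auto simp: defs coset_def)
qed

text \<open>This is the structure in which the finite sums of \<open>eval_free\<close> are
  computed.\<close>

lemma abelian_monoid_presented: "abelian_monoid (presented_algebra R)"
proof -
  have ex: "\<exists>f. x = coset R f" if "x \<in> carrier (presented_algebra R)" for x
    using that unfolding carrier_presented by blast
  show ?thesis
  proof (rule abelian_monoidI)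
    fix x y z assume "x \<in> carrier (presented_algebra R)" "y \<in> carrier (presented_algebra R)"
      "z \<in> carrier (presented_algebra R)"
    then obtain f g h where [simp]: "x = coset R f" "y = coset R g" "z = coset R h" using ex by metis
    show "x \<oplus>\<^bsub>presented_algebra R\<^esub> y \<oplus>\<^bsub>presented_algebra R\<^esub> z =
        x \<oplus>\<^bsub>presented_algebra R\<^esub> (y \<oplus>\<^bsub>presented_algebra R\<^esub> z)"
      by (simp add: add_presented add.assoc)
  next
    fix x y assume "x \<in> carrier (presented_algebra R)" "y \<in> carrier (presented_algebra R)"
    then obtain f g where [simp]: "x = coset R f" "y = coset R g" using ex by metis
    show "x \<oplus>\<^bsub>presented_algebra R\<^esub> y \<in> carrier (presented_algebra R)"
      by (simp add: add_presented carrier_presented)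
    show "x \<oplus>\<^bsub>presented_algebra R\<^esub> y = y \<oplus>\<^bsub>presented_algebra R\<^esub> x"
      by (simp add: add_presented add.commute)
  next
    fix x assume "x \<in> carrier (presented_algebra R)"
    then obtain f where [simp]: "x = coset R f" using ex by metis
    show "\<zero>\<^bsub>presented_algebra R\<^esub> \<oplus>\<^bsub>presented_algebra R\<^esub> x = x"
      by (simp add: add_presented zero_presented)
  qed (simp add: zero_presented carrier_presented)
qed

lemma eval_free_presented:
  "eval_free (presented_algebra R) (\<lambda>i. coset R (g i)) f = coset R (free.ev g f)"
proof -
  interpret abelian_monoid "presented_algebra R" by (rule abelian_monoid_presented)
  have word: "eval_word (presented_algebra R) (\<lambda>i. coset R (g i)) w = coset R (prod_list (map g (letters w)))" for w
  proof -
    have "foldr (\<lambda>x. (\<otimes>\<^bsub>presented_algebra R\<^esub>) (coset R (g x))) xs \<one>\<^bsub>presented_algebra R\<^esub> =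
       coset R (prod_list (map g xs))" for xs
      by (induction xs) (simp_all add: presented_algebra_simps)
    then show ?thesis by (simp add: eval_word_def)
  qed
  have sum: "(\<Oplus>\<^bsub>presented_algebra R\<^esub>w\<in>S. coset R (h w)) = coset R (\<Sum>w\<in>S. h w)" if "finite S" for S and h :: "'b fword \<Rightarrow> _"
    using that by (induction S) (simp_all add: presented_algebra_simps)
  show ?thesis
    unfolding eval_free_def free.ev_def word smult_presented by (rule sum) simp
qed

lemma polynomial_identity_presented_iff:
  "polynomial_identity (presented_algebra R) f \<longleftrightarrow> f \<noteq> 0 \<and> (\<forall>g. free.ev g f \<in> relation_ideal R)"
proof -
  let ?A = "presented_algebra R"
  have "(\<forall>a. (\<forall>i. a i \<in> carrier ?A) \<longrightarrow> eval_free ?A a f = \<zero>\<^bsub>?A\<^esub>) \<longleftrightarrow>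
    (\<forall>g. eval_free ?A (\<lambda>i. coset R (g i)) f = \<zero>\<^bsub>?A\<^esub>)" (is "?L \<longleftrightarrow> ?R")
  proof
    assume ?L
    then show ?R by (simp add: carrier_presented)
  next
    assume ?R
    show ?L
    proof (intro allI impI)
      fix a :: "nat \<Rightarrow> 'a free_alg set"
      assume "\<forall>i. a i \<in> carrier ?A"
      then have "\<forall>i. \<exists>g. a i = coset R g" unfolding carrier_presented by blast
      then obtain g where "\<forall>i. a i = coset R (g i)" by (rule choice[THEN exE])
      then have "a = (\<lambda>i. coset R (g i))" by (intro ext) simp
      then show "eval_free ?A a f = \<zero>\<^bsub>?A\<^esub>" using \<open>?R\<close> by simp
    qed
  qed
  then show ?thesis
    by (simp only: polynomial_identity_def eval_free_presented zero_presented coset_eq_iff diff_0_right)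
qed

section \<open>Root vectors and the spanning set of ordered monomials\<close>

lemma central_left_commute: "(\<And>y::'a::ring_1. y * c = c * y) \<Longrightarrow> y * (c * z) = c * (y * z)"
  by (metis mult.assoc)

text \<open>Here \<open>r1\<close> and \<open>r2\<close> are the defining relations, so the last two identities put the other commutation
  relations of the root vectors into the ideal.\<close>

lemma B2_root_vector_identities:
  fixes e1 e2 R S :: "'a::ring_1"
  assumes R: "\<And>y. y * R = R * y" and S: "\<And>y. y * S = S * y"
  defines "e3 \<equiv> e1 * e2 - S * S * e2 * e1"
  defines "e4 \<equiv> e3 * e2 - R * S * e2 * e3"
  defines "r1 \<equiv> e1 * e3 - R * R * e3 * e1"
  defines "r2 \<equiv> e4 * e2 - R * R * e2 * e4"
  defines "r14 \<equiv> e1 * e4 - R * R * S * S * e4 * e1 - R * (R - S) * e3 * e3"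
  shows "e1\<^sup>2 * e2 - (R * R + S * S) * e1 * e2 * e1 + R * R * S * S * e2 * e1\<^sup>2 = r1"
    and "e1 * e2 ^ 3 - (R * R + R * S + S * S) * e2 * e1 * e2\<^sup>2
         + R * S * (R * R + R * S + S * S) * e2\<^sup>2 * e1 * e2 - R * R * R * S * S * S * e2 ^ 3 * e1 = r2"
    and "r14 = r1 * e2 - R * S * S * S * e2 * r1"
    and "- (R * S * (e3 * e4 - R * R * e4 * e3)) =
           e1 * r2 - R * R * S * S * S * S * r2 * e1 - r14 * e2 + R * R * S * S * e2 * r14"
proof -
  note Rl = central_left_commute[of R, OF R] and Sl = central_left_commute[of S, OF S]
  note c = R[of e1] R[of e2] R[of S] S[of e1] S[of e2] Rl[of e1] Rl[of e2] Rl[of S] Sl[of e1] Sl[of e2]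
  show "e1\<^sup>2 * e2 - (R * R + S * S) * e1 * e2 * e1 + R * R * S * S * e2 * e1\<^sup>2 = r1"
    by (simp add: r1_def e3_def c algebra_simps power2_eq_square)
  show "e1 * e2 ^ 3 - (R * R + R * S + S * S) * e2 * e1 * e2\<^sup>2
         + R * S * (R * R + R * S + S * S) * e2\<^sup>2 * e1 * e2 - R * R * R * S * S * S * e2 ^ 3 * e1 = r2"
    by (simp add: r2_def e4_def e3_def c algebra_simps power2_eq_square power3_eq_cube)
  show r14: "r14 = r1 * e2 - R * S * S * S * e2 * r1"
    by (simp add: r14_def r1_def e4_def e3_def c algebra_simps)
  show "- (R * S * (e3 * e4 - R * R * e4 * e3)) =
           e1 * r2 - R * R * S * S * S * S * r2 * e1 - r14 * e2 + R * R * S * S * e2 * r14"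
    by (simp add: r14 r2_def r1_def e4_def e3_def c algebra_simps)
qed

text \<open>\<open>T\<close> stands for \<open>s / r\<close>, which makes every coefficient a
  monomial in central elements. Read from left to right, the six relations sort the variables into
  the order \<open>x4, x2, x3, x1\<close>, and the claims compare normal forms. The coefficient of
  \<open>x3 * x2\<close> is \<open>S * S\<close>, so that product drops out of \<open>e3\<close>. By
  \<open>B2_root_vector_identities\<close>, the last two claims are the defining relations.\<close>

lemma B2_quantum_torus_embedding:
  fixes x1 x2 x3 x4 R T :: "'a::ring_1"
  assumes R: "\<And>y. y * R = R * y" and T: "\<And>y. y * T = T * y"
    and q: "x1 * x2 = R * R * x2 * x1" "x1 * x4 = R * R * x4 * x1" "x3 * x4 = R * R * x4 * x3"
      "x3 * x2 = T * T * R * R * x2 * x3" "x1 * x3 = T * T * x3 * x1" "x2 * x4 = T * x4 * x2"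
  defines "S \<equiv> T * R"
  defines "e1 \<equiv> x1 + x3" and "e2 \<equiv> x2 + x4"
  defines "e3 \<equiv> e1 * e2 - S * S * e2 * e1"
  defines "e4 \<equiv> e3 * e2 - R * S * e2 * e3"
  shows "e3 = (R * R - S * S) * (x2 * x1 + x4 * x1 + x4 * x3)"
    and "e4 = (R * R - S * S) * ((R * R - R * S) * (x2 * x2 * x1 + x4 * x4 * x1 + x4 * x4 * x3)
           + (R * R - S * S) * x4 * x2 * x1)"
    and "e1 * e3 = R * R * e3 * e1"
    and "e4 * e2 = R * R * e2 * e4"
proof -
  note Rl = central_left_commute[of R, OF R] and Tl = central_left_commute[of T, OF T]
  have ql: "x1 * (x2 * z) = R * (R * (x2 * (x1 * z)))" "x1 * (x4 * z) = R * (R * (x4 * (x1 * z)))"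
     "x3 * (x4 * z) = R * (R * (x4 * (x3 * z)))" "x3 * (x2 * z) = T * (T * (R * (R * (x2 * (x3 * z)))))"
     "x1 * (x3 * z) = T * (T * (x3 * (x1 * z)))" "x2 * (x4 * z) = T * (x4 * (x2 * z))" for z
    using q by (metis mult.assoc)+
  note c = R[of x1] R[of x2] R[of x3] R[of x4] R[of T] T[of x1] T[of x2] T[of x3] T[of x4]
    Rl[of x1] Rl[of x2] Rl[of x3] Rl[of x4] Rl[of T] Tl[of x1] Tl[of x2] Tl[of x3] Tl[of x4]
  note d = q[unfolded mult.assoc] ql c algebra_simps
  show 3: "e3 = (R * R - S * S) * (x2 * x1 + x4 * x1 + x4 * x3)"
    by (simp add: e3_def e1_def e2_def S_def d)
  show 4: "e4 = (R * R - S * S) * ((R * R - R * S) * (x2 * x2 * x1 + x4 * x4 * x1 + x4 * x4 * x3)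
           + (R * R - S * S) * x4 * x2 * x1)"
    unfolding e4_def 3 by (simp add: e2_def S_def d)
  show "e1 * e3 = R * R * e3 * e1"
    unfolding 3 by (simp add: e1_def S_def d)
  show "e4 * e2 = R * R * e2 * e4"
    unfolding 4 by (simp add: e2_def S_def d)
qed

section \<open>Linear spans modulo the relations\<close>

inductive_set span_mod :: "'x free_alg set \<Rightarrow> 'x free_alg set \<Rightarrow> 'x free_alg set" for R B where
  rel: "f \<in> relation_ideal R \<Longrightarrow> f \<in> span_mod R B"
| base: "b \<in> B \<Longrightarrow> b \<in> span_mod R B"
| add: "f \<in> span_mod R B \<Longrightarrow> g \<in> span_mod R B \<Longrightarrow> f + g \<in> span_mod R B"
| scale: "f \<in> span_mod R B \<Longrightarrow> scalar c * f \<in> span_mod R B"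

lemma span_mod_minus: "f \<in> span_mod R B \<Longrightarrow> - f \<in> span_mod R B"
  using span_mod.scale[of f R B "- 1"] by (simp add: free.C_minus free.C_1)

lemma span_mod_diff: "f \<in> span_mod R B \<Longrightarrow> g \<in> span_mod R B \<Longrightarrow> f - g \<in> span_mod R B"
  using span_mod.add[of f R B "- g"] span_mod_minus[of g] by simp

lemma span_mod_cong: "f - g \<in> relation_ideal R \<Longrightarrow> g \<in> span_mod R B \<Longrightarrow> f \<in> span_mod R B"
  using span_mod.add[OF span_mod.rel[of "f - g"], of R g B] by simp

lemma span_mod_left_mult:
  assumes "\<And>b. b \<in> B \<Longrightarrow> x * b \<in> span_mod R B" "f \<in> span_mod R B"
  shows "x * f \<in> span_mod R B"
  using assms(2)
proof induction
  case (scale f c)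
  then show ?case by (simp add: free.C_left_commute span_mod.scale)
qed (use assms(1) in \<open>auto simp: distrib_left intro: span_mod.intros relation_ideal_left\<close>)

lemma span_mod_expansion:
  assumes "f \<in> span_mod R (range b)"
  shows "\<exists>S k. finite S \<and> f - (\<Sum>q\<in>S. scalar (k q) * b q) \<in> relation_ideal R"
  using assms
proof induction
  case (rel f)
  then show ?case by (intro exI[of _ "{}"]) simp
next
  case (base g)
  then obtain q where "g = b q" by auto
  then show ?case
    by (intro exI[of _ "{q}"] exI[of _ "\<lambda>_. 1"]) (simp add: free.C_1 relation_ideal_0)
next
  case (add f g)
  then obtain S k T l where S: "finite S" "f - (\<Sum>q\<in>S. scalar (k q) * b q) \<in> relation_ideal R"
    and T: "finite T" "g - (\<Sum>q\<in>T. scalar (l q) * b q) \<in> relation_ideal R" by blast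
  have "(\<Sum>q\<in>S. scalar (k q) * b q) = (\<Sum>q\<in>S \<union> T. scalar (if q \<in> S then k q else 0) * b q)"
    using S(1) T(1) by (intro sum.mono_neutral_cong_left) (auto simp: free.C_0)
  moreover have "(\<Sum>q\<in>T. scalar (l q) * b q) = (\<Sum>q\<in>S \<union> T. scalar (if q \<in> T then l q else 0) * b q)"
    using S(1) T(1) by (intro sum.mono_neutral_cong_left) (auto simp: free.C_0)
  ultimately have "f + g - (\<Sum>q\<in>S \<union> T. scalar ((if q \<in> S then k q else 0) + (if q \<in> T then l q else 0)) * b q)
    = (f - (\<Sum>q\<in>S. scalar (k q) * b q)) + (g - (\<Sum>q\<in>T. scalar (l q) * b q))"
    by (simp add: free.C_add distrib_right sum.distrib)
  moreover have "\<dots> \<in> relation_ideal R"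
    by (rule relation_ideal_add[OF S(2) T(2)])
  ultimately show ?case using S(1) T(1)
    by (intro exI[of _ "S \<union> T"] exI[of _ "\<lambda>q. (if q \<in> S then k q else 0) + (if q \<in> T then l q else 0)"])
      (simp only: finite_Un simp_thms)
next
  case (scale f c)
  then obtain S k where S: "finite S" "f - (\<Sum>q\<in>S. scalar (k q) * b q) \<in> relation_ideal R" by blast
  have "scalar c * f - (\<Sum>q\<in>S. scalar (c * k q) * b q) = scalar c * (f - (\<Sum>q\<in>S. scalar (k q) * b q))"
    by (simp add: right_diff_distrib sum_distrib_left free.C_mult mult.assoc)
  then show ?case using S relation_ideal_left
    by (intro exI[of _ S] exI[of _ "\<lambda>q. c * k q"]) auto
qed

definition B2_relations :: "complex \<Rightarrow> complex \<Rightarrow> B2_gen free_alg set" where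
  "B2_relations r s =
    {(var E1)\<^sup>2 * var E2 - scalar (r\<^sup>2 + s\<^sup>2) * var E1 * var E2 * var E1 + scalar (r\<^sup>2 * s\<^sup>2) * var E2 * (var E1)\<^sup>2,
     var E1 * var E2 ^ 3 - scalar (r\<^sup>2 + r * s + s\<^sup>2) * var E2 * var E1 * (var E2)\<^sup>2
       + scalar (r * s * (r\<^sup>2 + r * s + s\<^sup>2)) * (var E2)\<^sup>2 * var E1 * var E2
       - scalar (r ^ 3 * s ^ 3) * var E2 ^ 3 * var E1}"

lemma U_plus_B2_eq: "U_plus_B2 r s = presented_algebra (B2_relations r s)"
  by (simp add: U_plus_B2_def B2_relations_def Let_def)

definition e3 :: "complex \<Rightarrow> complex \<Rightarrow> B2_gen free_alg" where
  "e3 r s = var E1 * var E2 - scalar s * scalar s * var E2 * var E1"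

definition e4 :: "complex \<Rightarrow> complex \<Rightarrow> B2_gen free_alg" where
  "e4 r s = e3 r s * var E2 - scalar r * scalar s * var E2 * e3 r s"

definition pbw :: "complex \<Rightarrow> complex \<Rightarrow> nat \<times> nat \<times> nat \<times> nat \<Rightarrow> B2_gen free_alg" where
  "pbw r s = (\<lambda>(a, b, c, d). var E2 ^ a * (e4 r s ^ b * (e3 r s ^ c * var E1 ^ d)))"

text \<open>Together with the definitions of \<open>e3\<close> and \<open>e4\<close>, these
  straighten all six products of two root vectors that violate the order
  \<open>e2, e4, e3, e1\<close>.\<close>

lemma B2_root_vector_relations:
  assumes "r \<noteq> 0" "s \<noteq> 0"
  defines "I \<equiv> relation_ideal (B2_relations r s)"
  defines "R \<equiv> scalar r :: B2_gen free_alg" and "S \<equiv> scalar s :: B2_gen free_alg"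
  shows "var E1 * e3 r s - R * R * e3 r s * var E1 \<in> I" (is ?g1)
    and "e4 r s * var E2 - R * R * var E2 * e4 r s \<in> I" (is ?g2)
    and "var E1 * e4 r s - R * R * S * S * e4 r s * var E1 - R * (R - S) * e3 r s * e3 r s \<in> I" (is ?g3)
    and "e3 r s * e4 r s - R * R * e4 r s * e3 r s \<in> I" (is ?g4)
proof -
  have R: "y * R = R * y" and S: "y * S = S * y" for y
    unfolding R_def S_def by (rule mult_scalar)+
  note id = B2_root_vector_identities[of R S "var E1" "var E2", OF R S,
      folded e3_def[of r s, folded S_def], folded e4_def[of r s, folded S_def R_def]]
  note rel = relation_ideal_rel[of _ "B2_relations r s", folded I_def]
    and left = relation_ideal_left[of _ "B2_relations r s", folded I_def]
    and right = relation_ideal_right[of _ "B2_relations r s", folded I_def]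
    and add = relation_ideal_add[of _ "B2_relations r s", folded I_def]
    and diff = relation_ideal_diff[of _ "B2_relations r s", folded I_def]
    and minus = relation_ideal_minus[of _ "B2_relations r s", folded I_def]
  have sc: "scalar (r\<^sup>2 + s\<^sup>2) = R * R + S * S" "scalar (r\<^sup>2 * s\<^sup>2) = R * R * S * S"
    "scalar (r\<^sup>2 + r * s + s\<^sup>2) = R * R + R * S + S * S"
    "scalar (r * s * (r\<^sup>2 + r * s + s\<^sup>2)) = R * S * (R * R + R * S + S * S)"
    "scalar (r ^ 3 * s ^ 3) = R * R * R * S * S * S"
    by (simp_all only: R_def S_def free.C_mult free.C_add power2_eq_square power3_eq_cube mult.assoc)
  show 1: ?g1
    unfolding id(1)[symmetric] by (rule rel) (simp add: B2_relations_def sc)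
  show 2: ?g2
    unfolding id(2)[symmetric] by (rule rel) (simp add: B2_relations_def sc)
  show 3: ?g3
    unfolding id(3) by (rule diff[OF right[OF 1] left[OF 1]])
  \<comment> \<open>The identity only yields \<open>r * s\<close> times the relation; the factor is
    invertible because \<open>r\<close> and \<open>s\<close> are nonzero.\<close>
  have "- (R * S * (e3 r s * e4 r s - R * R * e4 r s * e3 r s)) \<in> I"
    unfolding id(4) by (rule add[OF diff[OF diff[OF left[OF 2] right[OF left[OF 2]]] right[OF 3]] left[OF 3]])
  then have "scalar (inverse (r * s)) * - (- (R * S * (e3 r s * e4 r s - R * R * e4 r s * e3 r s))) \<in> I"
    by (rule left[OF minus])
  moreover have "scalar (inverse (r * s)) * - (- (R * S * z)) = z" for z
  proof -
    have "scalar (inverse (r * s)) * - (- (R * S * z)) = scalar (inverse (r * s)) * (R * S) * z"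
      by (simp only: minus_minus mult.assoc)
    also have "scalar (inverse (r * s)) * (R * S) = scalar (inverse (r * s) * (r * s))"
      by (simp only: R_def S_def free.C_mult)
    also have "\<dots> = 1"
      using assms(1,2) by (subst left_inverse) (simp_all add: free.C_1)
    finally show ?thesis by simp
  qed
  ultimately show ?g4 by (simp only:)
qed

text \<open>The span contains 1 and is stable under left multiplication by the generators. Stability
  is shown for \<open>e2, e4, e3, e1\<close> in this order: moving one of them past an earlier one
  creates, besides the exchanged product, only root vectors already treated.\<close>

lemma pbw_spanning:
  assumes "r \<noteq> 0" "s \<noteq> 0"
  shows "f \<in> span_mod (B2_relations r s) (range (pbw r s))"
proof -
  let ?V = "span_mod (B2_relations r s) (range (pbw r s))"
  define e1 e2 where "e1 = (var E1 :: B2_gen free_alg)" and "e2 = (var E2 :: B2_gen free_alg)"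
  define x3 x4 where "x3 = e3 r s" and "x4 = e4 r s"
  define R S where "R = (scalar r :: B2_gen free_alg)" and "S = (scalar s :: B2_gen free_alg)"
  note rels = B2_root_vector_relations[OF assms, folded e1_def e2_def x3_def x4_def R_def S_def]
  have sc: "R * g \<in> ?V" "S * g \<in> ?V" if "g \<in> ?V" for g
    using that by (simp_all add: R_def S_def span_mod.scale)
  have mono: "e2 ^ a * (x4 ^ b * (x3 ^ c * e1 ^ d)) \<in> ?V" for a b c d
    by (rule span_mod.base, rule range_eqI[of _ _ "(a, b, c, d)"]) (simp add: pbw_def e1_def e2_def x3_def x4_def)
  have cong: "x * g \<in> ?V" if "x - y \<in> relation_ideal (B2_relations r s)" "y * g \<in> ?V" for x y g
    by (rule span_mod_cong[OF _ that(2)]) (use relation_ideal_right[OF that(1), of g] in \<open>simp add: left_diff_distrib\<close>)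
  have lmult: "x * g \<in> ?V" if "g \<in> ?V" "\<And>a b c d. x * (e2 ^ a * (x4 ^ b * (x3 ^ c * e1 ^ d))) \<in> ?V" for x g
    by (rule span_mod_left_mult[OF _ that(1)])
      (use that(2) in \<open>auto simp: pbw_def e1_def e2_def x3_def x4_def\<close>)
  have m2: "e2 * g \<in> ?V" if "g \<in> ?V" for g
  proof (rule lmult[OF that])
    fix a b c d show "e2 * (e2 ^ a * (x4 ^ b * (x3 ^ c * e1 ^ d))) \<in> ?V"
      using mono[of "Suc a"] by (simp add: mult.assoc)
  qed
  have m4: "x4 * g \<in> ?V" if "g \<in> ?V" for g
  proof (rule lmult[OF that])
    fix a b c d show "x4 * (e2 ^ a * (x4 ^ b * (x3 ^ c * e1 ^ d))) \<in> ?V"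
    proof (induction a)
      case 0
      then show ?case using mono[of 0 "Suc b"] by (simp add: mult.assoc)
    next
      case (Suc a)
      have "x4 * e2 * (e2 ^ a * (x4 ^ b * (x3 ^ c * e1 ^ d))) \<in> ?V"
        by (rule cong[OF rels(2)]) (use Suc in \<open>simp add: mult.assoc sc m2\<close>)
      then show ?case by (simp add: mult.assoc)
    qed
  qed
  have m3: "x3 * g \<in> ?V" if "g \<in> ?V" for g
  proof (rule lmult[OF that])
    have comm: "x3 * e2 = x4 + R * S * e2 * x3"
      by (simp add: x4_def x3_def e4_def R_def S_def e2_def)
    fix a b c d show "x3 * (e2 ^ a * (x4 ^ b * (x3 ^ c * e1 ^ d))) \<in> ?V"
    proof (induction a)
      case 0
      have "x3 * (x4 ^ b * (x3 ^ c * e1 ^ d)) \<in> ?V"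
      proof (induction b)
        case 0
        then show ?case using mono[of 0 0 "Suc c"] by (simp add: mult.assoc)
      next
        case (Suc b)
        have "x3 * x4 * (x4 ^ b * (x3 ^ c * e1 ^ d)) \<in> ?V"
          by (rule cong[OF rels(4)]) (use Suc in \<open>simp add: mult.assoc sc m4\<close>)
        then show ?case by (simp add: mult.assoc)
      qed
      then show ?case by simp
    next
      case (Suc a)
      have "x3 * e2 * (e2 ^ a * (x4 ^ b * (x3 ^ c * e1 ^ d))) \<in> ?V"
        unfolding comm distrib_right
        by (intro span_mod.add m4 mono) (use Suc in \<open>simp add: mult.assoc sc m2\<close>)
      then show ?case by (simp add: mult.assoc)
    qed
  qed
  have m1: "e1 * g \<in> ?V" if "g \<in> ?V" for g
  proof (rule lmult[OF that])
    have comm: "e1 * e2 = x3 + S * S * e2 * e1"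
      by (simp add: x3_def e3_def S_def e1_def e2_def)
    fix a b c d show "e1 * (e2 ^ a * (x4 ^ b * (x3 ^ c * e1 ^ d))) \<in> ?V"
    proof (induction a)
      case 0
      have "e1 * (x4 ^ b * (x3 ^ c * e1 ^ d)) \<in> ?V"
      proof (induction b)
        case 0
        have "e1 * (x3 ^ c * e1 ^ d) \<in> ?V"
        proof (induction c)
          case 0
          then show ?case using mono[of 0 0 0 "Suc d"] by simp
        next
          case (Suc c)
          have "e1 * x3 * (x3 ^ c * e1 ^ d) \<in> ?V"
            by (rule cong[OF rels(1)]) (use Suc in \<open>simp add: mult.assoc sc m3\<close>)
          then show ?case by (simp add: mult.assoc)
        qed
        then show ?case by simp
      next
        case (Suc b)
        have "(e1 * x4) * (x4 ^ b * (x3 ^ c * e1 ^ d)) \<in> ?V"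
        proof (rule cong)
          show "e1 * x4 - (R * R * S * S * x4 * e1 + R * (R - S) * x3 * x3) \<in> relation_ideal (B2_relations r s)"
            using rels(3) by (simp add: diff_diff_eq)
          show "(R * R * S * S * x4 * e1 + R * (R - S) * x3 * x3) * (x4 ^ b * (x3 ^ c * e1 ^ d)) \<in> ?V"
            unfolding distrib_right mult.assoc left_diff_distrib
            by (intro span_mod.add span_mod_diff sc m4 m3 Suc) (use mono[of 0] in simp_all)
        qed
        then show ?case by (simp add: mult.assoc)
      qed
      then show ?case by simp
    next
      case (Suc a)
      have "e1 * e2 * (e2 ^ a * (x4 ^ b * (x3 ^ c * e1 ^ d))) \<in> ?V"
        unfolding comm distrib_right
        by (intro span_mod.add m3 mono) (use Suc in \<open>simp add: mult.assoc sc m2\<close>)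
      then show ?case by (simp add: mult.assoc)
    qed
  qed
  have words: "prod_list (map var xs) \<in> ?V" for xs
  proof (induction xs)
    case Nil
    then show ?case using mono[of 0 0 0 0] by simp
  next
    case (Cons x xs)
    then show ?case using m1 m2 by (cases x) (auto simp: e1_def e2_def)
  qed
  have single: "Poly_Mapping.single w c = scalar c * prod_list (map var (letters w))" for w :: "B2_gen fword" and c
  proof -
    have "prod_list (map var xs) = Poly_Mapping.single (FWord xs) 1" for xs :: "B2_gen list"
      by (induction xs) (simp_all add: var_def mult_single plus_fword_def flip: zero_fword_def)
    then show ?thesis by (simp add: scalar_def mult_single)
  qed
  have "sum h T \<in> ?V" if "finite T" "\<And>w. w \<in> T \<Longrightarrow> h w \<in> ?V" for T and h :: "B2_gen fword \<Rightarrow> _"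
    using that by (induction T) (auto intro: span_mod.intros relation_ideal_0)
  then have "(\<Sum>w\<in>Poly_Mapping.keys f. Poly_Mapping.single w (Poly_Mapping.lookup f w)) \<in> ?V"
    by (simp add: single words span_mod.scale)
  then show ?thesis by (simp only: free_alg_sum_single[symmetric])
qed

section \<open>Linear operators on functions\<close>

text \<open>A type of its own makes the operators an instance of \<open>ring_1\<close>, so that the
  ring identities above and \<open>complex_scalars\<close> apply to them.\<close>

typedef 'i linop = "{T :: ('i \<Rightarrow> complex) \<Rightarrow> 'i \<Rightarrow> complex.
    \<forall>a F G. T (\<lambda>x. a * F x + G x) = (\<lambda>x. a * T F x + T G x)}"
  morphisms app Abs_linop
  by (rule exI[of _ "\<lambda>F. F"]) simp

setup_lifting type_definition_linop

lemma app_linear: "app T (\<lambda>x. a * F x + G x) = (\<lambda>x. a * app T F x + app T G x)"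
  using app[of T] by blast

lemma app_plus: "app T (\<lambda>x. F x + G x) = (\<lambda>x. app T F x + app T G x)"
  using app_linear[of T 1 F G] by simp

lemma app_zero: "app T (\<lambda>x. 0) = (\<lambda>x. 0)"
  using app_linear[of T "- 1" "\<lambda>_. 0" "\<lambda>_. 0"] by (simp add: fun_eq_iff)

lemma app_scale: "app T (\<lambda>x. a * F x) = (\<lambda>x. a * app T F x)"
  using app_linear[of T a F "\<lambda>_. 0"] by (simp add: app_zero)

lemma app_sum: "app T (\<lambda>x. \<Sum>k\<in>K. a k * F k x) = (\<lambda>x. \<Sum>k\<in>K. a k * app T (F k) x)"
  by (induction K rule: infinite_finite_induct) (simp_all add: app_zero app_linear)

lemma linop_eqI: "(\<And>F x. app S F x = app T F x) \<Longrightarrow> S = T"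
  by (metis app_inject ext)

instantiation linop :: (type) ring_1
begin

lift_definition zero_linop :: "'a linop" is "\<lambda>F x. 0" by simp
lift_definition one_linop :: "'a linop" is "\<lambda>F. F" by simp
lift_definition plus_linop :: "'a linop \<Rightarrow> 'a linop \<Rightarrow> 'a linop" is "\<lambda>S T F x. S F x + T F x"
  by (simp add: algebra_simps)
lift_definition minus_linop :: "'a linop \<Rightarrow> 'a linop \<Rightarrow> 'a linop" is "\<lambda>S T F x. S F x - T F x"
  by (simp add: algebra_simps)
lift_definition uminus_linop :: "'a linop \<Rightarrow> 'a linop" is "\<lambda>S F x. - S F x"
  by (simp add: algebra_simps)
lift_definition times_linop :: "'a linop \<Rightarrow> 'a linop \<Rightarrow> 'a linop" is "\<lambda>S T F. S (T F)"
  by simp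

lemmas app_simps = zero_linop.rep_eq one_linop.rep_eq plus_linop.rep_eq minus_linop.rep_eq
  uminus_linop.rep_eq times_linop.rep_eq

instance
proof
  fix R S T :: "'a linop"
  show "R * S * T = R * (S * T)" "R + S + T = R + (S + T)" "R + S = S + R" "0 + R = R" "- R + R = 0"
    "R - S = R + - S" "1 * R = R" "R * 1 = R" "(R + S) * T = R * T + S * T" "R * (S + T) = R * S + R * T"
    by (rule linop_eqI, simp only: app_simps app_plus; simp)+
  have "app (0 :: 'a linop) (\<lambda>_. 1) x \<noteq> app 1 (\<lambda>_. 1) x" for x
    by (simp add: app_simps)
  then show "(0 :: 'a linop) \<noteq> 1" by metis
qed

end

lift_definition cop :: "complex \<Rightarrow> 'i linop" is "\<lambda>c F x. c * F x"
  by (simp add: algebra_simps)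

lift_definition wshift :: "('i \<Rightarrow> 'i) \<Rightarrow> ('i \<Rightarrow> complex) \<Rightarrow> 'i linop" is "\<lambda>\<sigma> g F x. g x * F (\<sigma> x)"
  by (simp add: algebra_simps)

interpretation op: complex_scalars cop
  by unfold_locales
    (rule linop_eqI, simp add: app_simps cop.rep_eq app_scale algebra_simps)+

lemma app_sum_linop: "app (sum T K) F x = (\<Sum>k\<in>K. app (T k) F x)"
  by (induction K rule: infinite_finite_induct) (simp_all add: app_simps)

lemma cop_mult_power: "(cop a * x) ^ n = cop (a ^ n) * x ^ n"
  by (induction n) (simp_all add: op.C_1 op.C_mult mult.assoc op.C_left_commute[of x])

locale torus_rep =
  fixes r s :: complex and A p :: nat
  assumes r0: "r \<noteq> 0" and s0: "s \<noteq> 0" and rs: "r\<^sup>2 \<noteq> s\<^sup>2"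
    and A0: "A > 0" and A1: "(r * s) ^ A = 1" and A_min: "\<And>k. 0 < k \<Longrightarrow> k < A \<Longrightarrow> (r * s) ^ k \<noteq> 1"
    and p0: "p > 0" and p1: "(r / s) ^ (2 * p) = 1" "(r / s) ^ (p * A) = 1"
    and p_min: "\<And>k. 0 < k \<Longrightarrow> k < p \<Longrightarrow> (r / s) ^ (2 * k) = 1 \<Longrightarrow> (r / s) ^ (k * A) = 1 \<Longrightarrow> False"
begin

definition "b = r / s"
definition "c = r * s"

lemma b0: "b \<noteq> 0" and c0: "c \<noteq> 0"
  using r0 s0 by (simp_all add: b_def c_def)

lemma powi_add_b: "b powi (i + j) = b powi i * b powi j"
  by (simp add: power_int_add b0)

text \<open>Up to constants, \<open>X1 X3\<^sup>-\<^sup>1\<close> and \<open>X1 X2 X4\<^sup>-\<^sup>1\<close> are the diagonal operators \<open>b\<^sup>2\<^sup>i\<close> and \<open>c\<^sup>j\<close>, \<open>X2 X4\<^sup>-\<^sup>1\<close> is a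
  shift in \<open>i\<close> and \<open>X4\<close> a weighted shift in \<open>j\<close>: this is a normal form of the commutation matrix of the
  quantum torus.\<close>

definition "X1 = wshift (\<lambda>(i, j). (i + 1, j)) (\<lambda>(i :: int, j :: int). c powi j)"
definition "X2 = wshift (\<lambda>(i, j). (i - 1, j - 1)) (\<lambda>(i :: int, j :: int). b powi i)"
definition "X3 = wshift (\<lambda>(i, j). (i + 1, j)) (\<lambda>(i :: int, j :: int). c powi j / (b powi i)\<^sup>2)"
definition "X4 = wshift (\<lambda>(i, j). (i, j - 1)) (\<lambda>(i :: int, j :: int). b powi i)"

lemma app_X:
  "app X1 F (i, j) = c powi j * F (i + 1, j)"
  "app X2 F (i, j) = b powi i * F (i - 1, j - 1)"
  "app X3 F (i, j) = c powi j / (b powi i)\<^sup>2 * F (i + 1, j)"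
  "app X4 F (i, j) = b powi i * F (i, j - 1)"
  by (simp_all add: X1_def X2_def X3_def X4_def wshift.rep_eq)

lemma powi_shift:
  "b powi (i + 1) = b powi i * b" "b powi (i - 1) = b powi i / b" "c powi (i - 1) = c powi i / c"
  by (simp_all add: power_int_diff b0 c0 powi_add_b)

lemma X_relations:
  "X1 * X2 = cop r * cop r * X2 * X1" "X1 * X4 = cop r * cop r * X4 * X1"
  "X3 * X4 = cop r * cop r * X4 * X3"
  "X3 * X2 = cop (s / r) * cop (s / r) * cop r * cop r * X2 * X3"
  "X1 * X3 = cop (s / r) * cop (s / r) * X3 * X1" "X2 * X4 = cop (s / r) * X4 * X2"
proof -
  have nz: "b powi i \<noteq> 0" "c powi i \<noteq> 0" for i
    by (simp_all add: b0 c0)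
  have sr: "s / r = 1 / b" "r * r = b * c" by (simp_all add: b_def c_def r0 s0)
  have r: "cop r * (cop r * T) = cop (b * c) * T" for T :: "(int \<times> int) linop"
    by (simp add: op.C_mult[symmetric] mult.assoc[symmetric] sr)
  show "X1 * X2 = cop r * cop r * X2 * X1" "X1 * X4 = cop r * cop r * X4 * X1"
    "X3 * X4 = cop r * cop r * X4 * X3"
    "X3 * X2 = cop (s / r) * cop (s / r) * cop r * cop r * X2 * X3"
    "X1 * X3 = cop (s / r) * cop (s / r) * X3 * X1" "X2 * X4 = cop (s / r) * X4 * X2"
    unfolding mult.assoc r sr(1)
    by (rule linop_eqI, rename_tac F x, case_tac x,
        simp add: app_simps app_X cop.rep_eq powi_shift b0 c0 nz field_simps power2_eq_square)+
qed

end

section \<open>The finite-dimensional representations\<close>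

context torus_rep
begin

lemma bp_sq: "b ^ p * b ^ p = 1"
  using p1(1) by (simp add: b_def mult_2 power_add)

lemma bp_add: "(b ^ p) powi (i + j) = (b ^ p) powi i * (b ^ p) powi j"
  and bp_diff: "(b ^ p) powi (i - j) = (b ^ p) powi i / (b ^ p) powi j"
  by (simp_all add: power_int_add power_int_diff b0)

lemma bp_even: "even k \<Longrightarrow> (b ^ p) powi k = 1"
  by (elim evenE) (simp add: power_int_mult bp_sq power2_eq_square)

lemma bp_A: "(b ^ p) ^ A = 1"
  using p1(2) by (simp add: b_def power_mult)

text \<open>The operators commute with the shifts of \<open>i\<close> by \<open>p\<close> and of \<open>j\<close> by \<open>A\<close> only up to the sign \<open>b ^ p\<close>,
  hence the functions are quasi-periodic in \<open>i\<close>.\<close>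

definition Q :: "(int \<times> int \<Rightarrow> complex) set" where
  "Q = {F. \<forall>i j. F (i + int p, j) = (b ^ p) powi j * F (i, j) \<and> F (i, j + int A) = F (i, j)}"

definition preserves :: "(int \<times> int) linop \<Rightarrow> bool" where
  "preserves T \<longleftrightarrow> (\<forall>F\<in>Q. app T F \<in> Q)"

lemma Q_shift_p: "F \<in> Q \<Longrightarrow> F (i + int p * k, j) = (b ^ p) powi (j * k) * F (i, j)"
proof (induction k arbitrary: i rule: int_induct[where k = 0])
  case (step1 k)
  have "F (i + int p * (k + 1), j) = F (i + int p * k + int p, j)" by (simp add: algebra_simps)
  also have "\<dots> = (b ^ p) powi j * F (i + int p * k, j)" using step1(3) by (simp add: Q_def)
  finally show ?case using step1 by (simp add: distrib_left bp_add mult.commute)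
next
  case (step2 k)
  have "F (i + int p * (k - 1) + int p, j) = (b ^ p) powi j * F (i + int p * (k - 1), j)"
    using step2(3) by (simp add: Q_def)
  moreover have "i + int p * (k - 1) + int p = i + int p * k" by (simp add: algebra_simps)
  ultimately have "(b ^ p) powi j * F (i + int p * (k - 1), j) = (b ^ p) powi (j * k) * F (i, j)"
    using step2 by simp
  then have "F (i + int p * (k - 1), j) = (b ^ p) powi (j * k) / (b ^ p) powi j * F (i, j)"
    by (simp add: b0 field_simps)
  then show ?case by (simp add: right_diff_distrib bp_diff)
qed auto

lemma Q_shift_A: "F \<in> Q \<Longrightarrow> F (i, j + int A * k) = F (i, j)"
proof (induction k rule: int_induct[where k = 0])
  case (step1 k)
  have "F (i, j + int A * (k + 1)) = F (i, j + int A * k + int A)" by (simp add: algebra_simps)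
  then show ?case using step1 by (simp add: Q_def)
next
  case (step2 k)
  have "F (i, j + int A * (k - 1) + int A) = F (i, j + int A * k)" by (simp add: algebra_simps)
  then show ?case using step2 by (simp add: Q_def)
qed auto

lemma Q_reduce: "F \<in> Q \<Longrightarrow> F (i, j) = (b ^ p) powi (j * (i div int p)) * F (i mod int p, j mod int A)"
  using Q_shift_p[of F "i mod int p" "i div int p" j] Q_shift_A[of F "i mod int p" "j mod int A" "j div int A"]
  by simp

definition box :: "(int \<times> int) set" where
  "box = {0..<int p} \<times> {0..<int A}"

text \<open>The quasi-periodic extension of the indicator function of \<open>y\<close>. For
  \<open>y\<close> in \<open>box\<close> these functions form a basis of \<open>Q\<close>, whose
  coordinates are the values on \<open>box\<close>.\<close>

definition delta :: "int \<times> int \<Rightarrow> int \<times> int \<Rightarrow> complex" where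
  "delta y = (\<lambda>(i, j). if (i mod int p, j mod int A) = y then (b ^ p) powi (j * (i div int p)) else 0)"

lemma finite_box: "finite box" and card_box: "card box = p * A"
  by (simp_all add: box_def card_cartesian_product)

lemma mod_in_box: "(i mod int p, j mod int A) \<in> box"
  using p0 A0 by (simp add: box_def)

lemma delta_box: "x \<in> box \<Longrightarrow> delta y x = (if x = y then 1 else 0)"
  by (auto simp: delta_def box_def)

lemma delta_nonzero: "delta (i mod int p, j mod int A) (i, j) \<noteq> 0"
  by (simp add: delta_def b0)

text \<open>The quasi-periods in \<open>i\<close> and \<open>j\<close> are compatible because
  \<open>(b ^ p) ^ A = 1\<close>, one of the two conditions on \<open>p\<close>.\<close>

lemma delta_Q: "delta y \<in> Q"
proof -
  have "(b ^ p) powi ((j + int A) * k) = (b ^ p) powi (j * k)" for j k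
    using bp_A by (simp add: distrib_right bp_add power_int_mult[of _ "int A" k])
  then have "delta y (i, j + int A) = delta y (i, j)" for i j
    unfolding delta_def case_prod_conv by simp
  moreover have "(i + int p) div int p = i div int p + 1" for i using p0 by simp
  then have "delta y (i + int p, j) = (b ^ p) powi j * delta y (i, j)" for i j
    by (simp add: delta_def distrib_left bp_add mult.commute)
  ultimately show ?thesis unfolding Q_def by blast
qed

lemma Q_expand:
  assumes "F \<in> Q" shows "F = (\<lambda>x. \<Sum>y\<in>box. F y * delta y x)"
proof
  fix x :: "int \<times> int"
  obtain i j where x: "x = (i, j)" by (cases x)
  have "(\<Sum>y\<in>box. F y * delta y x) =
    (\<Sum>y\<in>box. if y = (i mod int p, j mod int A) then F y * (b ^ p) powi (j * (i div int p)) else 0)"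
    by (intro sum.cong) (auto simp: x delta_def)
  also have "\<dots> = F x"
    using finite_box mod_in_box Q_reduce[OF assms, of i j] by (simp add: x)
  finally show "F x = (\<Sum>y\<in>box. F y * delta y x)" ..
qed

lemma Q_eqI:
  assumes "F \<in> Q" "G \<in> Q" "\<And>x. x \<in> box \<Longrightarrow> F x = G x"
  shows "F = G"
proof -
  have "F = (\<lambda>x. \<Sum>y\<in>box. F y * delta y x)" by (rule Q_expand[OF assms(1)])
  also have "\<dots> = (\<lambda>x. \<Sum>y\<in>box. G y * delta y x)" using assms(3) by simp
  also have "\<dots> = G" by (rule Q_expand[OF assms(2), symmetric])
  finally show ?thesis .
qed

lemma app_Q_expand: "F \<in> Q \<Longrightarrow> app T F x = (\<Sum>y\<in>box. F y * app T (delta y) x)"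
  by (subst Q_expand, assumption) (simp add: app_sum)

lemma Q_linear: "F \<in> Q \<Longrightarrow> G \<in> Q \<Longrightarrow> (\<lambda>x. a * F x + G x) \<in> Q"
  by (auto simp: Q_def algebra_simps)

lemma Q_zero: "(\<lambda>_. 0) \<in> Q"
  by (simp add: Q_def)

lemma preserves_simps:
  "preserves 0" "preserves 1" "preserves (cop a)"
  "preserves S \<Longrightarrow> preserves T \<Longrightarrow> preserves (S + T)"
  "preserves S \<Longrightarrow> preserves T \<Longrightarrow> preserves (S * T)"
proof -
  have 1: "(\<lambda>x. a * F x) \<in> Q" if "F \<in> Q" for F a using Q_linear[OF that Q_zero] by simp
  have 2: "(\<lambda>x. F x + G x) \<in> Q" if "F \<in> Q" "G \<in> Q" for F G using Q_linear[OF that, of 1] by simp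
  show "preserves 0" "preserves 1" "preserves (cop a)"
    "preserves S \<Longrightarrow> preserves T \<Longrightarrow> preserves (S + T)"
    "preserves S \<Longrightarrow> preserves T \<Longrightarrow> preserves (S * T)"
    by (simp_all add: preserves_def app_simps cop.rep_eq Q_zero 1 2)
qed

lemma preserves_prod_list: "(\<And>T. T \<in> set Ts \<Longrightarrow> preserves T) \<Longrightarrow> preserves (prod_list Ts)"
  by (induction Ts) (auto intro: preserves_simps)

lemma preserves_sum: "(\<And>k. k \<in> K \<Longrightarrow> preserves (T k)) \<Longrightarrow> preserves (sum T K)"
  by (induction K rule: infinite_finite_induct) (auto intro: preserves_simps)

lemma preserves_ev: "(\<And>x. preserves (g x)) \<Longrightarrow> preserves (op.ev g f)"
  unfolding op.ev_def by (intro preserves_sum preserves_simps(5) preserves_simps(3) preserves_prod_list) auto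

lemma c_A: "c powi (j + int A) = c powi j"
  using A1 by (simp add: power_int_add c0) (simp add: c_def)

lemma b_p: "b powi (i + int p) = b powi i * b ^ p"
  by (simp add: power_int_add b0)

text \<open>Under \<open>i + p\<close> the weight \<open>b powi i\<close> gains the factor
  \<open>b ^ p\<close>. In \<open>X2\<close> and \<open>X4\<close> this factor compensates the shift
  of \<open>j\<close> by one; in \<open>X3\<close> it is squared and becomes 1 by the other
  condition on \<open>p\<close>.\<close>

lemma preserves_X: "preserves X1" "preserves X2" "preserves X3" "preserves X4"
proof -
  have e: "(b ^ p) powi (j - 1) = (b ^ p) powi j * b ^ p" for j
    using bp_sq b0 by (simp add: bp_diff divide_eq_eq mult.assoc)
  have sq: "(x * b ^ p)\<^sup>2 = x\<^sup>2" for x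
    using bp_sq by (simp add: power_mult_distrib power2_eq_square)
  have Q1: "F (i + int p, j) = (b ^ p) powi j * F (i, j)" and Q2: "F (i, j + int A) = F (i, j)" if "F \<in> Q" for F i j
    using that by (simp_all add: Q_def)
  have Q3: "F (i + int p + 1, j) = (b ^ p) powi j * F (i + 1, j)" if "F \<in> Q" for F i j
    using Q1[OF that, of "i + 1" j] by (simp add: algebra_simps)
  have Q4: "F (i + int p - 1, j) = (b ^ p) powi j * F (i - 1, j)" if "F \<in> Q" for F i j
    using Q1[OF that, of "i - 1" j] by (simp add: algebra_simps)
  have Q5: "F (i, j + int A - 1) = F (i, j - 1)" if "F \<in> Q" for F i j
    using Q2[OF that, of i "j - 1"] by (simp add: algebra_simps)
  have QI: "F \<in> Q" if "\<And>i j. F (i + int p, j) = (b ^ p) powi j * F (i, j)" "\<And>i j. F (i, j + int A) = F (i, j)" for F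
    using that by (simp add: Q_def)
  have bp': "x * b ^ p * (y * b ^ p * z) = x * y * z" for x y z
  proof -
    have "x * b ^ p * (y * b ^ p * z) = x * y * z * (b ^ p * b ^ p)" by (simp only: ac_simps)
    then show ?thesis by (simp only: bp_sq mult_1_right)
  qed
  show "preserves X1" unfolding preserves_def
    by (intro ballI QI) (simp_all add: app_X c_A Q2 Q3)
  show "preserves X2" unfolding preserves_def
    by (intro ballI QI) (simp_all add: app_X b_p Q4 Q5 e bp')
  show "preserves X3" unfolding preserves_def
    by (intro ballI QI) (simp_all add: app_X c_A b_p sq Q2 Q3)
  show "preserves X4" unfolding preserves_def
    by (intro ballI QI) (simp_all add: app_X b_p Q1 Q5 e bp')
qed

end

section \<open>Limits of the representations\<close>

context torus_rep
begin

text \<open>The argument may vary with \<open>n\<close> as well (continuous convergence). This makes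
  limits multiplicative at once, without norms or uniform bounds.\<close>

definition conv :: "(nat \<Rightarrow> (int \<times> int) linop) \<Rightarrow> (int \<times> int) linop \<Rightarrow> bool" where
  "conv T T' \<longleftrightarrow> (\<forall>n. preserves (T n)) \<and> preserves T' \<and>
    (\<forall>F F'. (\<forall>n. F n \<in> Q) \<longrightarrow> F' \<in> Q \<longrightarrow> (\<forall>x. (\<lambda>n. F n x) \<longlonglongrightarrow> F' x) \<longrightarrow>
      (\<forall>x. (\<lambda>n. app (T n) (F n) x) \<longlonglongrightarrow> app T' F' x))"

lemma convI:
  assumes "\<And>n. preserves (T n)" "preserves T'"
    and "\<And>F F' x. (\<And>n. F n \<in> Q) \<Longrightarrow> F' \<in> Q \<Longrightarrow> (\<And>x. (\<lambda>n. F n x) \<longlonglongrightarrow> F' x) \<Longrightarrow>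
      (\<lambda>n. app (T n) (F n) x) \<longlonglongrightarrow> app T' F' x"
  shows "conv T T'"
  using assms unfolding conv_def by blast

lemma conv_preserves: "conv T T' \<Longrightarrow> preserves (T n)" "conv T T' \<Longrightarrow> preserves T'"
  by (auto simp: conv_def)

lemma convD:
  "conv T T' \<Longrightarrow> (\<And>n. F n \<in> Q) \<Longrightarrow> F' \<in> Q \<Longrightarrow> (\<And>x. (\<lambda>n. F n x) \<longlonglongrightarrow> F' x) \<Longrightarrow>
    (\<lambda>n. app (T n) (F n) x) \<longlonglongrightarrow> app T' F' x"
  unfolding conv_def by blast

lemma conv_mult:
  assumes "conv S S'" "conv T T'" shows "conv (\<lambda>n. S n * T n) (S' * T')"
proof (rule convI)
  fix F F' x assume F: "\<And>n. F n \<in> Q" "F' \<in> Q" "\<And>x. (\<lambda>n. F n x) \<longlonglongrightarrow> F' x"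
  show "(\<lambda>n. app (S n * T n) (F n) x) \<longlonglongrightarrow> app (S' * T') F' x"
    unfolding app_simps
    by (rule convD[OF assms(1)])
      (use conv_preserves[OF assms(2)] F convD[OF assms(2) F] in \<open>auto simp: preserves_def\<close>)
qed (use assms in \<open>auto intro: preserves_simps conv_preserves\<close>)

lemma conv_add:
  assumes "conv S S'" "conv T T'" shows "conv (\<lambda>n. S n + T n) (S' + T')"
proof (rule convI)
  fix F F' x assume F: "\<And>n. F n \<in> Q" "F' \<in> Q" "\<And>x. (\<lambda>n. F n x) \<longlonglongrightarrow> F' x"
  show "(\<lambda>n. app (S n + T n) (F n) x) \<longlonglongrightarrow> app (S' + T') F' x"
    unfolding app_simps by (intro tendsto_add convD[OF assms(1) F] convD[OF assms(2) F])
qed (use assms in \<open>auto intro: preserves_simps conv_preserves\<close>)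

lemma conv_cop:
  assumes "a \<longlonglongrightarrow> a'" shows "conv (\<lambda>n. cop (a n)) (cop a')"
  by (rule convI) (auto simp: cop.rep_eq preserves_simps intro!: tendsto_mult assms)

lemma conv_wshift: "preserves (wshift \<sigma> g) \<Longrightarrow> conv (\<lambda>_. wshift \<sigma> g) (wshift \<sigma> g)"
  by (rule convI, assumption, assumption, unfold wshift.rep_eq, intro tendsto_mult tendsto_const)

lemma conv_1: "conv (\<lambda>_. 1) 1"
  by (rule convI) (auto simp: app_simps preserves_simps)

lemma conv_0: "conv (\<lambda>_. 0) 0"
  by (rule convI) (auto simp: app_simps preserves_simps)

lemma conv_sum: "(\<And>k. k \<in> K \<Longrightarrow> conv (\<lambda>n. T n k) (T' k)) \<Longrightarrow> conv (\<lambda>n. sum (T n) K) (sum T' K)"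
  by (induction K rule: infinite_finite_induct) (simp_all add: conv_0 conv_add)

lemma conv_power: "conv T T' \<Longrightarrow> conv (\<lambda>n. T n ^ k) (T' ^ k)"
  by (induction k) (simp_all add: conv_1 conv_mult)

lemma conv_prod_list:
  "(\<And>x. x \<in> set xs \<Longrightarrow> conv (\<lambda>n. T n x) (T' x)) \<Longrightarrow> conv (\<lambda>n. prod_list (map (T n) xs)) (prod_list (map T' xs))"
  by (induction xs) (simp_all add: conv_1 conv_mult)

lemma conv_ev:
  assumes "\<And>x. conv (\<lambda>n. T n x) (T' x)" shows "conv (\<lambda>n. op.ev (T n) f) (op.ev T' f)"
  unfolding op.ev_def by (intro conv_sum conv_mult conv_cop tendsto_const conv_prod_list assms)

lemma conv_X: "conv (\<lambda>_. X1) X1" "conv (\<lambda>_. X2) X2" "conv (\<lambda>_. X3) X3" "conv (\<lambda>_. X4) X4"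
  by (rule conv_wshift[OF preserves_X(1)[unfolded X1_def], folded X1_def]
      conv_wshift[OF preserves_X(2)[unfolded X2_def], folded X2_def]
      conv_wshift[OF preserves_X(3)[unfolded X3_def], folded X3_def]
      conv_wshift[OF preserves_X(4)[unfolded X4_def], folded X4_def])+

lemma conv_cong:
  assumes "conv T T'" "preserves T''" "\<And>F. F \<in> Q \<Longrightarrow> app T' F = app T'' F"
  shows "conv T T''"
proof (rule convI)
  fix F F' x assume F: "\<And>n. F n \<in> Q" "F' \<in> Q" "\<And>x. (\<lambda>n. F n x) \<longlonglongrightarrow> F' x"
  show "(\<lambda>n. app (T n) (F n) x) \<longlonglongrightarrow> app T'' F' x"
    using convD[OF assms(1) F, of x] assms(3)[OF F(2)] by simp
qed (use assms in \<open>auto intro: conv_preserves\<close>)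

lemma conv_unique:
  assumes "conv T T'" "\<And>n F. F \<in> Q \<Longrightarrow> app (T n) F = (\<lambda>_. 0)" "F \<in> Q"
  shows "app T' F = (\<lambda>_. 0)"
proof
  fix x
  have "(\<lambda>n. app (T n) F x) \<longlonglongrightarrow> app T' F x" by (rule convD[OF assms(1)]) (use assms(3) in auto)
  then show "app T' F x = 0" using assms(2)[OF assms(3)] by (simp add: LIMSEQ_const_iff)
qed

text \<open>The parameter \<open>t\<close> runs through the positive integers \<open>Suc n\<close>,
  which are nonzero, so that negative weights behave.\<close>

definition pw :: "int \<Rightarrow> nat \<Rightarrow> complex" where
  "pw w n = of_nat (Suc n) powi w"

lemma pw_add: "pw (v + w) n = pw v n * pw w n"
  unfolding pw_def by (rule power_int_add) (simp del: of_nat_Suc)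

lemma pw_0: "pw 0 n = 1"
  by (simp add: pw_def)

lemma pw_power: "pw (w * int k) n = pw w n ^ k"
  by (simp add: pw_def power_int_mult)

lemma pw_tendsto_0: "w < 0 \<Longrightarrow> (\<lambda>n. pw w n) \<longlonglongrightarrow> 0"
proof -
  assume "w < 0"
  define k where "k = nat (- w)"
  have k: "k > 0" "w = - int k" using \<open>w < 0\<close> by (simp_all add: k_def)
  have "(\<lambda>n. inverse (of_nat (Suc n)) :: complex) \<longlonglongrightarrow> 0"
    by (rule LIMSEQ_Suc[OF lim_inverse_n])
  then have "(\<lambda>n. (inverse (of_nat (Suc n)) :: complex) ^ k) \<longlonglongrightarrow> 0 ^ k"
    by (rule tendsto_power)
  moreover have "(0 :: complex) ^ k = 0" using k by simp
  ultimately have "(\<lambda>n. (inverse (of_nat (Suc n)) :: complex) ^ k) \<longlonglongrightarrow> 0" by (simp only:)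
  then show ?thesis using k by (simp add: pw_def power_int_minus power_inverse)
qed

text \<open>The generators \<open>e1\<close>, \<open>e2\<close> act as \<open>t\<^sup>w\<^sup>1 X1 + t\<^sup>w\<^sup>3 X3\<close>, \<open>t\<^sup>w\<^sup>2 X2 + t\<^sup>w\<^sup>4 X4\<close> (an analogue of the
  Feigin homomorphism). The exponents are expressed through the weights that the root vectors
  \<open>e2\<close>, \<open>e4\<close>, \<open>e3\<close>, \<open>e1\<close> are to have as \<open>t\<close> tends to infinity.\<close>

definition gen :: "int \<Rightarrow> int \<Rightarrow> int \<Rightarrow> int \<Rightarrow> nat \<Rightarrow> B2_gen \<Rightarrow> (int \<times> int) linop" where
  "gen al be ga de n x = (case x of
     E1 \<Rightarrow> cop (pw (be - 2 * al) n) * X1 + cop (pw de n) * X3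
   | E2 \<Rightarrow> cop (pw al n) * X2 + cop (pw (ga - de) n) * X4)"

lemma preserves_gen: "preserves (gen al be ga de n x)"
  by (cases x) (auto simp: gen_def intro!: preserves_simps preserves_X)

lemma ev_gen_relations:
  fixes al be ga de :: int and n :: nat
  defines "e1 \<equiv> gen al be ga de n E1" and "e2 \<equiv> gen al be ga de n E2"
  shows "op.ev (gen al be ga de n) (e3 r s) = cop (r\<^sup>2 - s\<^sup>2) *
      (cop (pw (be - al) n) * (X2 * X1) + cop (pw (ga - de + be - 2 * al) n) * (X4 * X1) + cop (pw ga n) * (X4 * X3))" (is ?g3)
    and "op.ev (gen al be ga de n) (e4 r s) = cop (r\<^sup>2 - s\<^sup>2) * (cop (r\<^sup>2 - r * s) *
      (cop (pw be n) * (X2 * X2 * X1) + cop (pw (2 * ga - 2 * de + be - 2 * al) n) * (X4 * X4 * X1)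
        + cop (pw (2 * ga - de) n) * (X4 * X4 * X3))
      + cop (r\<^sup>2 - s\<^sup>2) * (cop (pw (ga - de + be - al) n) * (X4 * X2 * X1)))" (is ?g4)
    and "f \<in> relation_ideal (B2_relations r s) \<Longrightarrow> op.ev (gen al be ga de n) f = 0"
proof -
  \<comment> \<open>The commutation relations are homogeneous in each variable and survive
    rescaling, so \<open>B2_quantum_torus_embedding\<close> applies for every
    \<open>n\<close>.\<close>
  define x1 x2 x3 x4 where "x1 = cop (pw (be - 2 * al) n) * X1" "x2 = cop (pw al n) * X2"
    "x3 = cop (pw de n) * X3" "x4 = cop (pw (ga - de) n) * X4"
  note x_def = this
  have comm: "y * cop a = cop a * y" for y and a by (rule op.C_commute)
  have ex: "cop l * U * (cop m * V) = cop (l * m) * (U * V)" for l m U and V :: "(int \<times> int) linop"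
    by (simp add: op.C_mult mult.assoc op.C_left_commute[of U])
  \<comment> \<open>The coefficient is kept in the shape of two scalars, as most relations have it;
    below, \<open>cop 1\<close> fills the second place for the remaining two.\<close>
  have swap: "cop l * U * (cop m * V) = cop a * cop a2 * (cop m * V) * (cop l * U)"
    if "U * V = cop a * cop a2 * V * U" for l m a a2 U and V :: "(int \<times> int) linop"
  proof -
    have "cop l * U * (cop m * V) = cop (l * m) * (cop (a * a2) * (V * U))"
      unfolding ex that by (simp only: op.C_mult mult.assoc)
    also have "\<dots> = cop (a * a2) * (cop m * V * (cop l * U))"
      unfolding ex unfolding mult.assoc[symmetric] op.C_mult[symmetric] by (simp only: ac_simps)
    finally show ?thesis by (simp only: op.C_mult mult.assoc)
  qed
  have S: "cop s = cop (s / r) * cop r" using r0 by (simp add: op.C_mult[symmetric])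
  have q: "x1 * x2 = cop r * cop r * x2 * x1" "x1 * x4 = cop r * cop r * x4 * x1" "x3 * x4 = cop r * cop r * x4 * x3"
      "x3 * x2 = cop (s / r) * cop (s / r) * cop r * cop r * x2 * x3"
      "x1 * x3 = cop (s / r) * cop (s / r) * x3 * x1" "x2 * x4 = cop (s / r) * x4 * x2"
  proof -
    show "x1 * x2 = cop r * cop r * x2 * x1" "x1 * x4 = cop r * cop r * x4 * x1" "x3 * x4 = cop r * cop r * x4 * x3"
      "x1 * x3 = cop (s / r) * cop (s / r) * x3 * x1"
      unfolding x_def by (intro swap X_relations)+
    have ss: "cop (s / r) * cop (s / r) * cop r * cop r = cop (s * s) * cop 1"
      using r0 by (simp only: op.C_mult[symmetric]) (simp add: op.C_1)
    show "x3 * x2 = cop (s / r) * cop (s / r) * cop r * cop r * x2 * x3"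
      unfolding ss x_def by (rule swap) (rule X_relations(4)[unfolded ss])
    have one: "cop (s / r) = cop (s / r) * cop 1" by (simp only: op.C_1 mult_1_right)
    have "X2 * X4 = cop (s / r) * cop 1 * X4 * X2"
      unfolding one[symmetric] by (rule X_relations(6))
    then have "x2 * x4 = cop (s / r) * cop 1 * x4 * x2" unfolding x_def by (rule swap)
    then show "x2 * x4 = cop (s / r) * x4 * x2" unfolding one[symmetric] .
  qed
  have e: "e1 = x1 + x3" "e2 = x2 + x4"
    by (simp_all add: e1_def e2_def gen_def x_def)
  note emb = B2_quantum_torus_embedding[OF comm comm q, folded S e]
  have ev3: "op.ev (gen al be ga de n) (e3 r s) = e1 * e2 - cop s * cop s * e2 * e1"
    by (simp add: e3_def op.ev_simps e1_def e2_def)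
  have ev4: "op.ev (gen al be ga de n) (e4 r s) = (e1 * e2 - cop s * cop s * e2 * e1) * e2
      - cop r * cop s * e2 * (e1 * e2 - cop s * cop s * e2 * e1)"
    by (simp add: e4_def op.ev_simps ev3 e1_def e2_def)
  have K: "cop r * cop r - cop s * cop s = cop (r\<^sup>2 - s\<^sup>2)" "cop r * cop r - cop r * cop s = cop (r\<^sup>2 - r * s)"
    by (simp_all add: op.C_diff op.C_mult power2_eq_square)
  have pws: "pw al n * pw (be - 2 * al) n = pw (be - al) n"
    "pw (ga - de) n * pw (be - 2 * al) n = pw (ga - de + be - 2 * al) n"
    "pw (ga - de) n * pw de n = pw ga n"
    "pw al n * pw (be - al) n = pw be n"
    "pw (ga - de) n * pw (ga - de + be - 2 * al) n = pw (2 * ga - 2 * de + be - 2 * al) n"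
    "pw (ga - de) n * pw ga n = pw (2 * ga - de) n"
    "pw (ga - de) n * pw (be - al) n = pw (ga - de + be - al) n"
    by (simp_all add: pw_add[symmetric] algebra_simps)
  have xx: "x2 * x1 = cop (pw (be - al) n) * (X2 * X1)" "x4 * x1 = cop (pw (ga - de + be - 2 * al) n) * (X4 * X1)"
    "x4 * x3 = cop (pw ga n) * (X4 * X3)"
    unfolding x_def ex pws by simp_all
  have xxx: "x2 * x2 * x1 = cop (pw be n) * (X2 * X2 * X1)"
    "x4 * x4 * x1 = cop (pw (2 * ga - 2 * de + be - 2 * al) n) * (X4 * X4 * X1)"
    "x4 * x4 * x3 = cop (pw (2 * ga - de) n) * (X4 * X4 * X3)"
    "x4 * x2 * x1 = cop (pw (ga - de + be - al) n) * (X4 * X2 * X1)"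
    unfolding mult.assoc xx unfolding x_def ex pws by simp_all
  show ?g3
    unfolding ev3 emb(1) K xx ..
  have "cop (r\<^sup>2 - s\<^sup>2) * x4 * x2 * x1 = cop (r\<^sup>2 - s\<^sup>2) * (x4 * x2 * x1)"
    by (simp only: mult.assoc)
  from emb(2)[unfolded K this xxx] show ?g4
    unfolding ev4 .
  have "op.ev (gen al be ga de n) x = 0" if "x \<in> B2_relations r s" for x
  proof -
    note id = B2_root_vector_identities[of "cop r" "cop s" e1 e2, OF comm comm]
    have sc: "cop (r\<^sup>2 + s\<^sup>2) = cop r * cop r + cop s * cop s" "cop (r\<^sup>2 * s\<^sup>2) = cop r * cop r * cop s * cop s"
      "cop (r\<^sup>2 + r * s + s\<^sup>2) = cop r * cop r + cop r * cop s + cop s * cop s"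
      "cop (r * s * (r\<^sup>2 + r * s + s\<^sup>2)) = cop r * cop s * (cop r * cop r + cop r * cop s + cop s * cop s)"
      "cop (r ^ 3 * s ^ 3) = cop r * cop r * cop r * cop s * cop s * cop s"
      by (simp_all only: op.C_mult op.C_add power2_eq_square power3_eq_cube mult.assoc)
    have "e1\<^sup>2 * e2 - (cop r * cop r + cop s * cop s) * e1 * e2 * e1 + cop r * cop r * cop s * cop s * e2 * e1\<^sup>2 = 0"
      unfolding id(1) emb(3) by (rule diff_self)
    moreover have "e1 * e2 ^ 3 - (cop r * cop r + cop r * cop s + cop s * cop s) * e2 * e1 * e2\<^sup>2
         + cop r * cop s * (cop r * cop r + cop r * cop s + cop s * cop s) * e2\<^sup>2 * e1 * e2
         - cop r * cop r * cop r * cop s * cop s * cop s * e2 ^ 3 * e1 = 0"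
      unfolding id(2) emb(4) by (rule diff_self)
    ultimately show ?thesis
      using that unfolding B2_relations_def insert_iff empty_iff
      by (elim disjE) (simp_all only: op.ev_simps sc e1_def e2_def)
  qed
  then show "f \<in> relation_ideal (B2_relations r s) \<Longrightarrow> op.ev (gen al be ga de n) f = 0"
    by (rule op.ev_relation_ideal)
qed

end

section \<open>The representations separate points\<close>

lemma cop_mult_mult: "cop a * U * (cop a' * V) = cop (a * a') * (U * V)"
  by (simp only: op.C_mult mult.assoc op.C_left_commute[of U])

lemma base_expansion_inj:
  fixes K :: nat
  assumes "a * K\<^sup>2 + b * K + c + d * K ^ 3 = a' * K\<^sup>2 + b' * K + c' + d' * K ^ 3"
    and "a < K" "b < K" "c < K" "a' < K" "b' < K" "c' < K"
  shows "a = a' \<and> b = b' \<and> c = c' \<and> d = d'"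
proof -
  have e: "a * K\<^sup>2 + b * K + c + d * K ^ 3 = ((d * K + a) * K + b) * K + c" for a b c d
    by (simp add: algebra_simps power2_eq_square power3_eq_cube)
  have step: "x = x' \<and> y = y'" if "x * K + y = x' * K + y'" "y < K" "y' < K" for x x' y y'
  proof -
    have "(x * K + y) mod K = y" "(x' * K + y') mod K = y'" using that(2,3) by simp_all
    then have "y = y'" using that(1) by metis
    then show ?thesis using that by simp
  qed
  have 1: "(d * K + a) * K + b = (d' * K + a') * K + b' \<and> c = c'"
    by (rule step) (use assms in \<open>simp_all only: e\<close>)
  then have 2: "d * K + a = d' * K + a' \<and> b = b'"
    by (intro step) (use assms in simp_all)
  then have "d = d' \<and> a = a'"
    by (intro step) (use assms in simp_all)
  then show ?thesis using 1 2 by simp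
qed

context torus_rep
begin

lemma conv_pw_0: "w < 0 \<Longrightarrow> conv (\<lambda>_. T) T \<Longrightarrow> conv (\<lambda>n. cop (pw w n) * T) 0"
  using conv_mult[OF conv_cop[OF pw_tendsto_0], of w "\<lambda>_. T" T] by (simp add: op.C_0)

lemma cop_pw: "cop (pw v n) * (cop (pw w n) * T) = cop (pw (v + w) n) * T"
  by (simp only: pw_add op.C_mult mult.assoc)

text \<open>The inequalities say that the correction terms of the straightening, \<open>e4\<close>
  in \<open>e3 * e2\<close> and \<open>e3 * e3\<close> in \<open>e1 * e4\<close>, weigh less than
  these products. They imply \<open>ga < al + de\<close> and \<open>be < 2 * al + de\<close>, and
  then each root vector has exactly one term of top weight.\<close>

lemma conv_root_vectors:
  assumes w: "be < al + ga" "2 * ga < be + de"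
  shows "conv (\<lambda>n. cop (pw (- de) n) * gen al be ga de n E1) X3"
    and "conv (\<lambda>n. cop (pw (- al) n) * gen al be ga de n E2) X2"
    and "conv (\<lambda>n. cop (pw (- ga) n) * op.ev (gen al be ga de n) (e3 r s)) (cop (r\<^sup>2 - s\<^sup>2) * (X4 * X3))"
    and "conv (\<lambda>n. cop (pw (- be) n) * op.ev (gen al be ga de n) (e4 r s))
           (cop ((r\<^sup>2 - s\<^sup>2) * (r\<^sup>2 - r * s)) * (X2 * X2 * X1))"
proof -
  have "conv (\<lambda>n. cop (pw (- de + (be - 2 * al)) n) * X1 + X3) (0 + X3)"
    by (intro conv_add conv_pw_0 conv_X) (use w in linarith)
  then show "conv (\<lambda>n. cop (pw (- de) n) * gen al be ga de n E1) X3"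
    by (simp add: gen_def distrib_left cop_pw pw_0 op.C_1)
  have "conv (\<lambda>n. X2 + cop (pw (- al + (ga - de)) n) * X4) (X2 + 0)"
    by (intro conv_add conv_pw_0 conv_X) (use w in linarith)
  then show "conv (\<lambda>n. cop (pw (- al) n) * gen al be ga de n E2) X2"
    by (simp add: gen_def distrib_left cop_pw pw_0 op.C_1)
  have "conv (\<lambda>n. cop (r\<^sup>2 - s\<^sup>2) * (cop (pw (- ga + (be - al)) n) * (X2 * X1)
      + cop (pw (- ga + (ga - de + be - 2 * al)) n) * (X4 * X1) + X4 * X3)) (cop (r\<^sup>2 - s\<^sup>2) * (0 + 0 + X4 * X3))"
    by (intro conv_mult conv_cop tendsto_const conv_add conv_pw_0 conv_X) (use w in linarith)+
  then show "conv (\<lambda>n. cop (pw (- ga) n) * op.ev (gen al be ga de n) (e3 r s)) (cop (r\<^sup>2 - s\<^sup>2) * (X4 * X3))"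
    by (simp only: ev_gen_relations op.C_left_commute[of "cop (pw _ _)" "r\<^sup>2 - s\<^sup>2"] op.C_left_commute[of "cop (pw _ _)" "r\<^sup>2 - r * s"] distrib_left cop_pw add.left_inverse pw_0 op.C_1 mult_1_left add_0)
  have "conv (\<lambda>n. cop (r\<^sup>2 - s\<^sup>2) * (cop (r\<^sup>2 - r * s) *
      (X2 * X2 * X1 + cop (pw (- be + (2 * ga - 2 * de + be - 2 * al)) n) * (X4 * X4 * X1)
        + cop (pw (- be + (2 * ga - de)) n) * (X4 * X4 * X3))
      + cop (r\<^sup>2 - s\<^sup>2) * (cop (pw (- be + (ga - de + be - al)) n) * (X4 * X2 * X1))))
     (cop (r\<^sup>2 - s\<^sup>2) * (cop (r\<^sup>2 - r * s) * (X2 * X2 * X1 + 0 + 0) + cop (r\<^sup>2 - s\<^sup>2) * 0))"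
    by (intro conv_mult conv_cop tendsto_const conv_add conv_pw_0 conv_X) (use w in linarith)+
  then show "conv (\<lambda>n. cop (pw (- be) n) * op.ev (gen al be ga de n) (e4 r s))
           (cop ((r\<^sup>2 - s\<^sup>2) * (r\<^sup>2 - r * s)) * (X2 * X2 * X1))"
    by (simp only: ev_gen_relations op.C_left_commute[of "cop (pw _ _)" "r\<^sup>2 - s\<^sup>2"] op.C_left_commute[of "cop (pw _ _)" "r\<^sup>2 - r * s"] distrib_left cop_pw add.left_inverse pw_0 op.C_1 mult_1_left
        add_0_right mult_zero_right op.C_mult mult.assoc)
qed

definition pbw_limit :: "nat \<times> nat \<times> nat \<times> nat \<Rightarrow> (int \<times> int) linop" where
  "pbw_limit = (\<lambda>(i, j, k, l). X2 ^ i * ((cop ((r\<^sup>2 - s\<^sup>2) * (r\<^sup>2 - r * s)) * (X2 * X2 * X1)) ^ j *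
     ((cop (r\<^sup>2 - s\<^sup>2) * (X4 * X3)) ^ k * X3 ^ l)))"

lemma conv_pbw:
  assumes w: "be < al + ga" "2 * ga < be + de"
  shows "conv (\<lambda>n. cop (pw (- (al * int i + be * int j + ga * int k + de * int l)) n) *
      op.ev (gen al be ga de n) (pbw r s (i, j, k, l))) (pbw_limit (i, j, k, l))"
proof -
  have "- (al * int i + be * int j + ga * int k + de * int l) =
    - al * int i + (- be * int j + (- ga * int k + - de * int l))" by simp
  then have eq: "cop (pw (- (al * int i + be * int j + ga * int k + de * int l)) n) *
      op.ev (gen al be ga de n) (pbw r s (i, j, k, l)) =
    (cop (pw (- al) n) * gen al be ga de n E2) ^ i * ((cop (pw (- be) n) * op.ev (gen al be ga de n) (e4 r s)) ^ j *
     ((cop (pw (- ga) n) * op.ev (gen al be ga de n) (e3 r s)) ^ k * (cop (pw (- de) n) * gen al be ga de n E1) ^ l))" for n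
    by (simp only: pbw_def case_prod_conv op.ev_simps cop_mult_power cop_mult_mult pw_add pw_power)
  show ?thesis
    unfolding eq pbw_limit_def case_prod_conv
    by (intro conv_mult conv_power conv_root_vectors[OF w])
qed

definition injective_op :: "(int \<times> int) linop \<Rightarrow> bool" where
  "injective_op T \<longleftrightarrow> (\<forall>F. app T F = (\<lambda>_. 0) \<longrightarrow> F = (\<lambda>_. 0))"

lemma injective_op_mult: "injective_op S \<Longrightarrow> injective_op T \<Longrightarrow> injective_op (S * T)"
  unfolding injective_op_def app_simps by blast

lemma injective_op_power: "injective_op T \<Longrightarrow> injective_op (T ^ n)"
  by (induction n) (simp_all add: injective_op_mult, simp add: injective_op_def app_simps)

lemma injective_op_cop: "a \<noteq> 0 \<Longrightarrow> injective_op (cop a)"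
  by (auto simp: injective_op_def cop.rep_eq fun_eq_iff)

lemma injective_op_X: "injective_op X1" "injective_op X2" "injective_op X3" "injective_op X4"
proof -
  show "injective_op X1" unfolding injective_op_def
  proof (intro allI impI ext)
    fix F x assume *: "app X1 F = (\<lambda>_. 0)"
    show "F x = 0" using fun_cong[OF *, of "(fst x - 1, snd x)"] by (simp add: app_X b0 c0)
  qed
  show "injective_op X2" unfolding injective_op_def
  proof (intro allI impI ext)
    fix F x assume *: "app X2 F = (\<lambda>_. 0)"
    show "F x = 0" using fun_cong[OF *, of "(fst x + 1, snd x + 1)"] by (simp add: app_X b0 c0)
  qed
  show "injective_op X3" unfolding injective_op_def
  proof (intro allI impI ext)
    fix F x assume *: "app X3 F = (\<lambda>_. 0)"
    show "F x = 0" using fun_cong[OF *, of "(fst x - 1, snd x)"] by (simp add: app_X b0 c0)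
  qed
  show "injective_op X4" unfolding injective_op_def
  proof (intro allI impI ext)
    fix F x assume *: "app X4 F = (\<lambda>_. 0)"
    show "F x = 0" using fun_cong[OF *, of "(fst x, snd x + 1)"] by (simp add: app_X b0 c0)
  qed
qed

lemma rs_nonzero: "r\<^sup>2 - s\<^sup>2 \<noteq> 0" "r\<^sup>2 - r * s \<noteq> 0"
proof -
  show "r\<^sup>2 - s\<^sup>2 \<noteq> 0" using rs by simp
  have "r \<noteq> s" using rs by auto
  moreover have "r\<^sup>2 - r * s = r * (r - s)" by (simp add: power2_eq_square algebra_simps)
  ultimately show "r\<^sup>2 - r * s \<noteq> 0" using r0 by simp
qed

lemma injective_op_pbw_limit: "injective_op (pbw_limit q)"
  using rs_nonzero unfolding pbw_limit_def
  by (cases q) (auto intro!: injective_op_mult injective_op_power injective_op_cop injective_op_X)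

text \<open>The weights are chosen as powers of a large base, so that the ordered monomials occurring in \<open>f\<close> have
  different weights and the limit isolates the one of largest weight.\<close>

theorem separation:
  assumes zero: "\<And>al be ga de n F. F \<in> Q \<Longrightarrow> app (op.ev (gen al be ga de n) f) F = (\<lambda>_. 0)"
  shows "f \<in> relation_ideal (B2_relations r s)"
proof -
  let ?I = "relation_ideal (B2_relations r s)"
  obtain S k where S: "finite S" "f - (\<Sum>q\<in>S. scalar (k q) * pbw r s q) \<in> ?I"
    using span_mod_expansion[OF pbw_spanning[OF r0 s0]] by blast
  define S' where "S' = {q \<in> S. k q \<noteq> 0}"
  have S': "finite S'" using S by (simp add: S'_def)
  have sum: "(\<Sum>q\<in>S. scalar (k q) * pbw r s q) = (\<Sum>q\<in>S'. scalar (k q) * pbw r s q)"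
    unfolding S'_def using S(1) by (intro sum.mono_neutral_right) (auto simp: free.C_0)
  have "S' = {}"
  proof (rule ccontr)
    assume "S' \<noteq> {}"
    obtain B where B: "\<And>i j k l. (i, j, k, l) \<in> S' \<Longrightarrow> i < B \<and> j < B \<and> k < B \<and> l < B"
    proof -
      define m where "m = (\<lambda>(i, j, k, l). i + j + k + (l :: nat))"
      have m: "m q \<le> (\<Sum>q\<in>S'. m q)" if "q \<in> S'" for q
        using S' that by (intro member_le_sum) auto
      show ?thesis
      proof (rule that[of "Suc (\<Sum>q\<in>S'. m q)"])
        fix i j k l assume "(i, j, k, l) \<in> S'"
        from m[OF this] have "i + j + k + l \<le> (\<Sum>q\<in>S'. m q)" by (simp add: m_def)
        then show "i < Suc (sum m S') \<and> j < Suc (sum m S') \<and> k < Suc (sum m S') \<and> l < Suc (sum m S')"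
          by linarith
      qed
    qed
    \<comment> \<open>\<open>K\<close> exceeds all exponents, so \<open>W\<close> is a
      base-\<open>K\<close> expansion and injective on \<open>S'\<close>. With the weights
      \<open>K^2, K, 1, K^3\<close> for \<open>al, be, ga, de\<close>, the inequality
      \<open>2 < K + K^3\<close> requires \<open>K\<close> to be at least 2.\<close>
    define K where "K = B + 2"
    define W where "W = (\<lambda>(i, j, k, l). i * K\<^sup>2 + j * K + k + l * K ^ 3)"
    have inj: "inj_on W S'"
    proof (rule inj_onI)
      fix q q' assume q: "q \<in> S'" "q' \<in> S'" "W q = W q'"
      obtain i j k l i' j' k' l' where [simp]: "q = (i, j, k, l)" "q' = (i', j', k', l')"
        by (cases q, cases q')
      have "i < K \<and> j < K \<and> k < K" "i' < K \<and> j' < K \<and> k' < K"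
        using q B[of i j k l] B[of i' j' k' l'] by (simp_all add: K_def)
      moreover have "i * K\<^sup>2 + j * K + k + l * K ^ 3 = i' * K\<^sup>2 + j' * K + k' + l' * K ^ 3"
        using q(3) by (simp only: W_def case_prod_conv \<open>q = (i, j, k, l)\<close> \<open>q' = (i', j', k', l')\<close>)
      ultimately have "i = i' \<and> j = j' \<and> k = k' \<and> l = l'"
        by (intro base_expansion_inj) blast+
      then show "q = q'" by simp
    qed
    have "Max (W ` S') \<in> W ` S'" using S' \<open>S' \<noteq> {}\<close> by (intro Max_in) auto
    then obtain q0 where q0: "q0 \<in> S'" "Max (W ` S') = W q0" by blast
    have q0_max: "W q \<le> W q0" if "q \<in> S'" for q
      unfolding q0(2)[symmetric] using S' that by (intro Max_ge) auto
    have W_less: "W q < W q0" if "q \<in> S'" "q \<noteq> q0" for q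
      using q0_max[OF that(1)] inj_onD[OF inj, of q q0] that q0(1) by (auto simp: less_le)
    have K2: "int K \<ge> 2" by (simp add: K_def)
    define g where "g = gen (int (K\<^sup>2)) (int K) 1 (int (K ^ 3))"
    have w: "int K < int (K\<^sup>2) + 1" "2 * 1 < int K + int (K ^ 3)"
    proof -
      have "int K * 1 \<le> int K * int K" by (rule mult_left_mono) (simp_all add: K_def)
      moreover have "1 \<le> K ^ 3" by (simp add: K_def)
      ultimately show "int K < int (K\<^sup>2) + 1" by (simp add: power2_eq_square)
      show "2 * 1 < int K + int (K ^ 3)" using K2 \<open>1 \<le> K ^ 3\<close> by linarith
    qed
    have lim: "conv (\<lambda>n. cop (pw (- int (W q)) n) * op.ev (g n) (pbw r s q)) (pbw_limit q)" for q
    proof -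
      obtain i j k l where q: "q = (i, j, k, l)" by (cases q)
      have "- int (W q) = - (int (K\<^sup>2) * int i + int K * int j + 1 * int k + int (K ^ 3) * int l)"
        unfolding W_def q case_prod_conv by (simp only: of_nat_add of_nat_mult ac_simps mult_1)
      then show ?thesis
        using conv_pbw[OF w, of i j k l] unfolding g_def q by (simp only:)
    qed
    have "conv (\<lambda>n. \<Sum>q\<in>S'. cop (k q) * (cop (pw (- int (W q0)) n) * op.ev (g n) (pbw r s q)))
      (\<Sum>q\<in>S'. if q = q0 then cop (k q0) * pbw_limit q0 else 0)"
    proof (rule conv_sum)
      fix q assume q: "q \<in> S'"
      show "conv (\<lambda>n. cop (k q) * (cop (pw (- int (W q0)) n) * op.ev (g n) (pbw r s q)))
        (if q = q0 then cop (k q0) * pbw_limit q0 else 0)"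
      proof (cases "q = q0")
        case True
        then show ?thesis using conv_mult[OF conv_cop[OF tendsto_const, of "k q0"] lim[of q0]] by simp
      next
        case False
        have "conv (\<lambda>n. cop (pw (int (W q) - int (W q0)) n) * (cop (pw (- int (W q)) n) * op.ev (g n) (pbw r s q)))
          (cop 0 * pbw_limit q)"
          by (intro conv_mult conv_cop pw_tendsto_0 lim) (use W_less[OF q False] in simp)
        then have "conv (\<lambda>n. cop (pw (- int (W q0)) n) * op.ev (g n) (pbw r s q)) 0"
          by (simp add: cop_pw op.C_0)
        from conv_mult[OF conv_cop[OF tendsto_const, of "k q"] this] show ?thesis using False by simp
      qed
    qed
    moreover have "(\<Sum>q\<in>S'. cop (k q) * (cop (pw (- int (W q0)) n) * op.ev (g n) (pbw r s q))) =
        cop (pw (- int (W q0)) n) * op.ev (g n) f" for n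
    proof -
      have "op.ev (g n) (f - (\<Sum>q\<in>S. scalar (k q) * pbw r s q)) = 0"
        unfolding g_def by (rule ev_gen_relations(3)[OF S(2)])
      then have "op.ev (g n) f = op.ev (g n) (\<Sum>q\<in>S. scalar (k q) * pbw r s q)" by (simp add: op.ev_simps)
      then have f: "op.ev (g n) f = (\<Sum>q\<in>S'. cop (k q) * op.ev (g n) (pbw r s q))"
        unfolding sum by (simp only: op.ev_sum op.ev_simps)
      show ?thesis unfolding f sum_distrib_left
        by (intro sum.cong refl op.C_left_commute)
    qed
    moreover have "(\<Sum>q\<in>S'. if q = q0 then cop (k q0) * pbw_limit q0 else 0) = cop (k q0) * pbw_limit q0"
      using S' q0(1) by simp
    ultimately have "conv (\<lambda>n. cop (pw (- int (W q0)) n) * op.ev (g n) f) (cop (k q0) * pbw_limit q0)"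
      by (simp only:)
    then have "app (cop (k q0) * pbw_limit q0) (delta (0, 0)) = (\<lambda>_. 0)"
    proof (rule conv_unique)
      fix n F assume "F \<in> Q"
      from zero[OF this] show "app (cop (pw (- int (W q0)) n) * op.ev (g n) f) F = (\<lambda>_. 0)"
        unfolding g_def app_simps cop.rep_eq by simp
    qed (rule delta_Q)
    moreover have "injective_op (cop (k q0) * pbw_limit q0)"
      using q0(1) by (intro injective_op_mult injective_op_cop injective_op_pbw_limit) (simp add: S'_def)
    ultimately have "delta (0, 0) = (\<lambda>_. 0)" by (simp add: injective_op_def)
    moreover have "delta (0, 0) (0, 0) \<noteq> 0" using delta_nonzero[of 0 0] by simp
    ultimately show False by simp
  qed
  then show ?thesis using S(2) unfolding sum by simp
qed

end

section \<open>The standard identity\<close>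

definition standard_poly :: "nat \<Rightarrow> nat free_alg" where
  "standard_poly L = (\<Sum>\<tau> | \<tau> permutes {..<L}. Poly_Mapping.single (FWord (map \<tau> [0..<L])) (of_int (sign \<tau>)))"

lemma lookup_standard_poly: "Poly_Mapping.lookup (standard_poly L) (FWord [0..<L]) = 1"
proof -
  have "FWord (map \<tau> [0..<L]) = FWord [0..<L] \<longleftrightarrow> \<tau> = id" if "\<tau> permutes {..<L}" for \<tau>
  proof
    assume "FWord (map \<tau> [0..<L]) = FWord [0..<L]"
    then have "map \<tau> [0..<L] = map id [0..<L]" by simp
    then have "\<tau> i = i" if "i < L" for i using that unfolding map_eq_conv by simp
    moreover have "\<tau> i = i" if "\<not> i < L" for i
      using permutes_not_in[OF \<open>\<tau> permutes {..<L}\<close>, of i] that by simp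
    ultimately show "\<tau> = id" by (intro ext) (metis id_apply)
  qed simp
  then have "Poly_Mapping.lookup (standard_poly L) (FWord [0..<L]) =
    (\<Sum>\<tau> | \<tau> permutes {..<L}. if \<tau> = id then 1 else 0)"
    unfolding standard_poly_def lookup_sum by (intro sum.cong refl) (simp add: lookup_single when_def)
  also have "\<dots> = 1" by (simp add: finite_permutations permutes_id)
  finally show ?thesis .
qed

lemma standard_poly_nonzero: "standard_poly L \<noteq> 0"
  using lookup_standard_poly[of L] by auto

lemma free_degree_standard_poly: "free_degree (standard_poly L) = L"
proof -
  let ?K = "Poly_Mapping.keys (standard_poly L)"
  have "length (letters w) = L" if "w \<in> ?K" for w
  proof -
    have "?K \<subseteq> (\<Union>\<tau>\<in>{\<tau>. \<tau> permutes {..<L}}. Poly_Mapping.keys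
        (Poly_Mapping.single (FWord (map \<tau> [0..<L])) (of_int (sign \<tau>) :: complex)))"
      unfolding standard_poly_def by (rule keys_sum)
    then show ?thesis using that by (force split: if_splits)
  qed
  moreover have "FWord [0..<L] \<in> ?K" by (simp add: in_keys_iff lookup_standard_poly)
  ultimately have "(\<lambda>w. length (letters w)) ` ?K = {L}" by force
  then show ?thesis by (simp add: free_degree_def)
qed

section \<open>Products of operators as sums over index paths\<close>

lemma sum_PiE_Suc:
  fixes f :: "(nat \<Rightarrow> 'a) \<Rightarrow> 'b::comm_monoid_add"
  assumes "finite B"
  shows "(\<Sum>j\<in>PiE {..Suc L} (\<lambda>_. B). f j) = (\<Sum>j\<in>PiE {..L} (\<lambda>_. B). \<Sum>y\<in>B. f (j(Suc L := y)))"
proof -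
  have "(\<Sum>j\<in>PiE {..Suc L} (\<lambda>_. B). f j) = (\<Sum>(y, j)\<in>B \<times> PiE {..L} (\<lambda>_. B). f (j(Suc L := y)))"
    unfolding atMost_Suc PiE_insert_eq
    by (subst sum.reindex[OF inj_combinator]) (auto simp: case_prod_beta)
  also have "\<dots> = (\<Sum>y\<in>B. \<Sum>j\<in>PiE {..L} (\<lambda>_. B). f (j(Suc L := y)))"
    by (simp add: sum.cartesian_product)
  also have "\<dots> = (\<Sum>j\<in>PiE {..L} (\<lambda>_. B). \<Sum>y\<in>B. f (j(Suc L := y)))"
    by (rule sum.swap)
  finally show ?thesis .
qed

context torus_rep
begin

text \<open>Matrix multiplication in the basis of the \<open>delta y\<close>: the entry of
  \<open>T k\<close> at \<open>(x, y)\<close> is \<open>app (T k) (delta y) x\<close>, the column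
  vector is \<open>G\<close>, and \<open>H\<close> is a row vector.\<close>

lemma path_sum:
  assumes "\<And>k. preserves (T k)" "G \<in> Q"
  shows "(\<Sum>j\<in>PiE {..L} (\<lambda>_. box). (\<Prod>k<L. app (T k) (delta (j (Suc k))) (j k)) * (G (j L) * H (j 0))) =
    (\<Sum>x\<in>box. H x * app (prod_list (map T [0..<L])) G x)"
  using assms(2)
proof (induction L arbitrary: G)
  case 0
  have "(\<Sum>j\<in>PiE {0 :: nat} (\<lambda>_. box). G (j 0) * H (j 0)) = (\<Sum>x\<in>box. H x * G x)"
    by (rule sum.reindex_bij_witness[of _ "\<lambda>x. (\<lambda>k. if k = 0 then x else undefined)" "\<lambda>j. j 0"])
      (auto simp: PiE_iff extensional_def fun_eq_iff mult.commute)
  then show ?case by (simp add: app_simps)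
next
  case (Suc L)
  have TQ: "app (T L) G \<in> Q" using assms(1)[of L] Suc.prems by (auto simp: preserves_def)
  have "(\<Sum>j\<in>PiE {..Suc L} (\<lambda>_. box). (\<Prod>k<Suc L. app (T k) (delta (j (Suc k))) (j k)) * (G (j (Suc L)) * H (j 0))) =
    (\<Sum>j\<in>PiE {..L} (\<lambda>_. box). \<Sum>y\<in>box. (\<Prod>k<L. app (T k) (delta (j (Suc k))) (j k)) *
      (G y * app (T L) (delta y) (j L) * H (j 0)))"
    unfolding sum_PiE_Suc[OF finite_box] by (intro sum.cong refl) (simp add: mult_ac)
  also have "\<dots> = (\<Sum>j\<in>PiE {..L} (\<lambda>_. box). (\<Prod>k<L. app (T k) (delta (j (Suc k))) (j k)) *
      (app (T L) G (j L) * H (j 0)))"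
    unfolding app_Q_expand[OF Suc.prems, of "T L"] sum_distrib_left sum_distrib_right ..
  also have "\<dots> = (\<Sum>x\<in>box. H x * app (prod_list (map T [0..<L])) (app (T L) G) x)"
    by (rule Suc.IH[OF TQ])
  finally show ?case by (simp add: app_simps)
qed

lemma ev_standard_poly:
  "op.ev T (standard_poly L) = (\<Sum>\<tau> | \<tau> permutes {..<L}. cop (of_int (sign \<tau>)) * prod_list (map (\<lambda>k. T (\<tau> k)) [0..<L]))"
  by (simp add: standard_poly_def op.ev_sum op.ev_single comp_def)

lemma standard_poly_vanishes:
  assumes T: "\<And>k. preserves (T k)" and F: "F \<in> Q"
  shows "app (op.ev T (standard_poly (2 * (p * A)))) F = (\<lambda>_. 0)"
proof (rule Q_eqI[OF _ Q_zero])
  let ?L = "2 * (p * A)"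
  show "app (op.ev T (standard_poly ?L)) F \<in> Q"
    using preserves_ev[of T, OF T] F by (simp add: preserves_def)
  fix x assume x: "x \<in> box"
  \<comment> \<open>The test matrix for the trace identity has rank one, \<open>F a * ?H b\<close>,
    where \<open>?H\<close> selects the coordinate at \<open>x\<close>.\<close>
  let ?M = "\<lambda>k a b. app (T k) (delta b) a" and ?H = "\<lambda>y. if y = x then 1 else 0 :: complex"
  have "app (op.ev T (standard_poly ?L)) F x =
    (\<Sum>\<tau> | \<tau> permutes {..<?L}. of_int (sign \<tau>) * app (prod_list (map (\<lambda>k. T (\<tau> k)) [0..<?L])) F x)"
    by (simp add: ev_standard_poly app_sum_linop app_simps cop.rep_eq)
  also have "\<dots> = (\<Sum>\<tau> | \<tau> permutes {..<?L}. of_int (sign \<tau>) * (\<Sum>j\<in>PiE {..?L} (\<lambda>_. box).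
      (\<Prod>k<?L. ?M (\<tau> k) (j k) (j (Suc k))) * (F (j ?L) * ?H (j 0))))"
  proof (intro sum.cong refl, goal_cases)
    case (1 \<tau>)
    have "(\<Sum>y\<in>box. ?H y * app (prod_list (map (\<lambda>k. T (\<tau> k)) [0..<?L])) F y) =
        app (prod_list (map (\<lambda>k. T (\<tau> k)) [0..<?L])) F x"
      using x finite_box by (simp add: if_distrib[of "\<lambda>a. a * _"] cong: if_cong)
    then show ?case
      using path_sum[of "\<lambda>k. T (\<tau> k)" F ?L ?H] T F by simp
  qed
  also have "\<dots> = 0"
    using amitsur_levitzki_trace[OF finite_box card_box, of ?M "\<lambda>a b. F a * ?H b"] by simp
  finally show "app (op.ev T (standard_poly ?L)) F x = 0" .
qed

theorem standard_identity: "polynomial_identity (U_plus_B2 r s) (standard_poly (2 * (p * A)))"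
  unfolding U_plus_B2_eq polynomial_identity_presented_iff
proof (intro conjI allI)
  fix g :: "nat \<Rightarrow> B2_gen free_alg"
  show "free.ev g (standard_poly (2 * (p * A))) \<in> relation_ideal (B2_relations r s)"
  proof (rule separation)
    fix al be ga de n F assume "F \<in> Q"
    then show "app (op.ev (gen al be ga de n) (free.ev g (standard_poly (2 * (p * A))))) F = (\<lambda>_. 0)"
      unfolding op.ev_free_ev by (intro standard_poly_vanishes preserves_ev preserves_gen)
  qed
qed (rule standard_poly_nonzero)

end

section \<open>Lower bound for the degree of an identity\<close>

lemma prod_list_map_sum:
  fixes U :: "nat \<Rightarrow> 'a::semiring_1"
  assumes "finite S"
  shows "prod_list (map (\<lambda>i. \<Sum>k | k \<in> S \<and> idx k = i. U k) v) =
    (\<Sum>ks | set ks \<subseteq> S \<and> map idx ks = v. prod_list (map U ks))"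
proof (induction v)
  case Nil
  have "{ks. set ks \<subseteq> S \<and> map idx ks = []} = {[]}" by auto
  then show ?case by simp
next
  case (Cons i v)
  let ?A = "{k. k \<in> S \<and> idx k = i}" and ?B = "{ks. set ks \<subseteq> S \<and> map idx ks = v}"
  have eq: "{ks. set ks \<subseteq> S \<and> map idx ks = i # v} = (\<lambda>(k, ks). k # ks) ` (?A \<times> ?B)"
    by (auto simp: map_eq_Cons_conv image_iff)
  have "(\<Sum>ks | set ks \<subseteq> S \<and> map idx ks = i # v. prod_list (map U ks)) =
    (\<Sum>(k, ks)\<in>?A \<times> ?B. U k * prod_list (map U ks))"
    unfolding eq by (subst sum.reindex) (auto simp: inj_on_def case_prod_beta)
  also have "\<dots> = (\<Sum>k\<in>?A. U k) * (\<Sum>ks\<in>?B. prod_list (map U ks))"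
    by (simp add: sum_product sum.cartesian_product)
  finally show ?case by (simp add: Cons.IH)
qed

text \<open>The left-hand side is the expansion of a product over \<open>D\<close> with factor 1 at
  points of \<open>K\<close> and factor \<open>1 - 1\<close> elsewhere.\<close>

lemma alternating_sum_Pow:
  assumes "finite D" "K \<subseteq> D"
  shows "(\<Sum>S\<in>Pow D. if K \<subseteq> S then (- 1) ^ card (D - S) else 0) = (if K = D then 1 else 0 :: 'a::comm_ring_1)"
proof -
  have "(\<Prod>k\<in>D. 1 + (if k \<in> K then 0 else - 1 :: 'a)) =
    (\<Sum>S\<in>Pow D. (\<Prod>k\<in>S. 1) * (\<Prod>k\<in>D - S. if k \<in> K then 0 else - 1))"
    by (rule prod_add[OF assms(1)])
  also have "\<dots> = (\<Sum>S\<in>Pow D. if K \<subseteq> S then (- 1) ^ card (D - S) else 0)"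
  proof (intro sum.cong refl)
    fix S assume "S \<in> Pow D"
    show "(\<Prod>k\<in>S. 1) * (\<Prod>k\<in>D - S. if k \<in> K then 0 else - 1 :: 'a) = (if K \<subseteq> S then (- 1) ^ card (D - S) else 0)"
    proof (cases "K \<subseteq> S")
      case True
      then have "(\<Prod>k\<in>D - S. if k \<in> K then 0 else - 1 :: 'a) = (\<Prod>k\<in>D - S. - 1)"
        by (intro prod.cong) auto
      then show ?thesis using True by simp
    next
      case False
      then obtain k where "k \<in> D - S" "k \<in> K" using assms(2) by auto
      then have "(\<Prod>k\<in>D - S. if k \<in> K then 0 else - 1 :: 'a) = 0"
        using assms(1) by (intro prod_zero) auto
      then show ?thesis using False by simp
    qed
  qed
  also have "(\<Prod>k\<in>D. 1 + (if k \<in> K then 0 else - 1 :: 'a)) = (if K = D then 1 else 0)"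
  proof (cases "K = D")
    case False
    then obtain k where "k \<in> D" "k \<notin> K" using assms(2) by auto
    then have "(\<Prod>k\<in>D. 1 + (if k \<in> K then 0 else - 1 :: 'a)) = 0"
      using assms(1) by (intro prod_zero) auto
    then show ?thesis using False by simp
  qed simp
  finally show ?thesis by simp
qed

text \<open>After expanding the products of sums, inclusion-exclusion leaves the words that use
  every element of \<open>D\<close>. This replaces the multilinearisation of an identity and applies
  to inhomogeneous ones too.\<close>

lemma alternating_sum_prod_list:
  fixes U :: "nat \<Rightarrow> 'a::ring_1"
  assumes D: "finite D"
  shows "(\<Sum>S\<in>Pow D. (- 1) ^ card (D - S) * prod_list (map (\<lambda>i. \<Sum>k | k \<in> S \<and> idx k = i. U k) v)) =
    (\<Sum>ks | set ks = D \<and> map idx ks = v. prod_list (map U ks))"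
proof -
  let ?L = "{ks. set ks \<subseteq> D \<and> map idx ks = v}"
  have "?L \<subseteq> {ks. set ks \<subseteq> D \<and> length ks = length v}" by auto
  then have fin: "finite ?L" using finite_lists_length_eq[OF D] by (rule finite_subset)
  have "(\<Sum>S\<in>Pow D. (- 1) ^ card (D - S) * prod_list (map (\<lambda>i. \<Sum>k | k \<in> S \<and> idx k = i. U k) v)) =
    (\<Sum>S\<in>Pow D. \<Sum>ks\<in>?L. of_int (if set ks \<subseteq> S then (- 1) ^ card (D - S) else 0) * prod_list (map U ks))"
  proof (intro sum.cong refl)
    fix S assume S: "S \<in> Pow D"
    then have "finite S" using D finite_subset by auto
    have "(\<Sum>ks | set ks \<subseteq> S \<and> map idx ks = v. prod_list (map U ks)) =
      (\<Sum>ks\<in>?L. if set ks \<subseteq> S then prod_list (map U ks) else 0)"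
      using S fin by (subst sum.inter_filter[symmetric]) (auto intro!: sum.cong)
    then show "(- 1) ^ card (D - S) * prod_list (map (\<lambda>i. \<Sum>k | k \<in> S \<and> idx k = i. U k) v) =
      (\<Sum>ks\<in>?L. of_int (if set ks \<subseteq> S then (- 1) ^ card (D - S) else 0) * prod_list (map U ks))"
      unfolding prod_list_map_sum[OF \<open>finite S\<close>] by (auto simp: sum_distrib_left intro!: sum.cong)
  qed
  also have "\<dots> = (\<Sum>ks\<in>?L. of_int (\<Sum>S\<in>Pow D. if set ks \<subseteq> S then (- 1) ^ card (D - S) else 0) * prod_list (map U ks))"
    by (subst sum.swap) (simp add: sum_distrib_right)
  also have "\<dots> = (\<Sum>ks\<in>?L. if set ks = D then prod_list (map U ks) else 0)"
    by (intro sum.cong refl) (use alternating_sum_Pow[OF D, where 'a = int] in auto)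
  also have "\<dots> = (\<Sum>ks | set ks = D \<and> map idx ks = v. prod_list (map U ks))"
    using fin by (subst sum.inter_filter[symmetric]) (auto intro!: sum.cong)
  finally show ?thesis .
qed

context torus_rep
begin

text \<open>Polynomial identities of the algebra pass to these limits. The weights are one admissible choice in
  \<open>conv_root_vectors\<close>.\<close>

definition Z :: "(int \<times> int) linop set" where
  "Z = {T. \<exists>a. conv (\<lambda>n. op.ev (gen 4 2 1 8 n) (a n)) T}"

lemma Z_preserves: "T \<in> Z \<Longrightarrow> preserves T"
  by (auto simp: Z_def conv_def)

text \<open>Only the action on \<open>Q\<close> matters. This is essential for inverses: the period
  relations for powers of the \<open>X\<close> operators hold on \<open>Q\<close>.\<close>

lemma Z_cong:
  assumes "T \<in> Z" "preserves T'" "\<And>F. F \<in> Q \<Longrightarrow> app T F = app T' F"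
  shows "T' \<in> Z"
  using assms conv_cong unfolding Z_def by blast

lemma Z_add: "S \<in> Z \<Longrightarrow> T \<in> Z \<Longrightarrow> S + T \<in> Z"
proof -
  assume "S \<in> Z" "T \<in> Z"
  then obtain a a' where "conv (\<lambda>n. op.ev (gen 4 2 1 8 n) (a n)) S" "conv (\<lambda>n. op.ev (gen 4 2 1 8 n) (a' n)) T"
    by (auto simp: Z_def)
  from conv_add[OF this] show ?thesis
    unfolding Z_def by (auto simp: op.ev_simps intro!: exI[of _ "\<lambda>n. a n + a' n"])
qed

lemma Z_mult: "S \<in> Z \<Longrightarrow> T \<in> Z \<Longrightarrow> S * T \<in> Z"
proof -
  assume "S \<in> Z" "T \<in> Z"
  then obtain a a' where "conv (\<lambda>n. op.ev (gen 4 2 1 8 n) (a n)) S" "conv (\<lambda>n. op.ev (gen 4 2 1 8 n) (a' n)) T"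
    by (auto simp: Z_def)
  from conv_mult[OF this] show ?thesis
    unfolding Z_def by (auto simp: op.ev_simps intro!: exI[of _ "\<lambda>n. a n * a' n"])
qed

lemma Z_cop: "cop a \<in> Z"
  unfolding Z_def using conv_cop[of "\<lambda>_. a" a]
  by (auto simp: op.ev_simps intro!: exI[of _ "\<lambda>n. scalar a"])

lemma Z_0: "0 \<in> Z" and Z_1: "1 \<in> Z"
  using Z_cop[of 0] Z_cop[of 1] by (simp_all add: op.C_0 op.C_1)

lemma Z_power: "T \<in> Z \<Longrightarrow> T ^ n \<in> Z"
  by (induction n) (simp_all add: Z_1 Z_mult)

lemma Z_sum: "(\<And>k. k \<in> K \<Longrightarrow> T k \<in> Z) \<Longrightarrow> sum T K \<in> Z"
  by (induction K rule: infinite_finite_induct) (simp_all add: Z_0 Z_add)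

lemma Z_root_vectors: "X3 \<in> Z" "X2 \<in> Z" "X4 * X3 \<in> Z" "X2 * X2 * X1 \<in> Z"
proof -
  note lim = conv_root_vectors[of 2 4 1 8, simplified]
  show "X3 \<in> Z" unfolding Z_def mem_Collect_eq
    by (rule exI[of _ "\<lambda>n. scalar (pw (- 8) n) * var E1"]) (simp add: op.ev_simps lim(1))
  show "X2 \<in> Z" unfolding Z_def mem_Collect_eq
    by (rule exI[of _ "\<lambda>n. scalar (pw (- 4) n) * var E2"]) (simp add: op.ev_simps lim(2))
  have cancel: "T \<in> Z" if "cop k * T \<in> Z" "k \<noteq> 0" for k T
    using Z_mult[OF Z_cop[of "inverse k"] that(1)] that(2) by (simp add: mult.assoc[symmetric] op.C_mult[symmetric] op.C_1)
  have "cop (r\<^sup>2 - s\<^sup>2) * (X4 * X3) \<in> Z" unfolding Z_def mem_Collect_eq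
    by (rule exI[of _ "\<lambda>n. scalar (pw (- 1) n) * e3 r s"]) (simp add: op.ev_simps lim(3))
  then show "X4 * X3 \<in> Z" by (rule cancel) (rule rs_nonzero)
  have "cop ((r\<^sup>2 - s\<^sup>2) * (r\<^sup>2 - r * s)) * (X2 * X2 * X1) \<in> Z" unfolding Z_def mem_Collect_eq
    by (rule exI[of _ "\<lambda>n. scalar (pw (- 2) n) * e4 r s"]) (simp add: op.ev_simps lim(4))
  then show "X2 * X2 * X1 \<in> Z" by (rule cancel) (use rs_nonzero in simp)
qed

text \<open>A common period of \<open>X2\<close>, \<open>X3\<close> and \<open>X4\<close> on
  \<open>Q\<close>. The factor 2 makes the triangular number \<open>0 + ... + (M - 1)\<close> a
  multiple of \<open>p * A\<close> and removes the sign of the shifts in \<open>i\<close>.\<close>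

definition "M = 2 * (p * A)"

lemma M_pos: "M > 0"
  using p0 A0 by (simp add: M_def)

lemma app_power:
  "app (X3 ^ n) F (i, j) = (c powi j) ^ n / ((b powi i) ^ (2 * n) * b ^ (2 * (\<Sum>k<n. k))) * F (i + int n, j)"
  "app (X2 ^ n) F (i, j) = (b powi i) ^ n / b ^ (\<Sum>k<n. k) * F (i - int n, j - int n)"
  "app (X4 ^ n) F (i, j) = (b powi i) ^ n * F (i, j - int n)"
proof -
  have nz: "b powi i \<noteq> 0" for i by (simp add: b0)
  show "app (X3 ^ n) F (i, j) = (c powi j) ^ n / ((b powi i) ^ (2 * n) * b ^ (2 * (\<Sum>k<n. k))) * F (i + int n, j)"
  proof (induction n arbitrary: i)
    case (Suc n)
    have "(b powi (i + 1)) ^ (2 * n) = (b powi i) ^ (2 * n) * b ^ (2 * n)"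
      by (simp add: powi_shift power_mult_distrib)
    then show ?case using b0 nz
      by (simp add: app_simps app_X Suc.IH power_add power2_eq_square add.assoc add.commute[of 1] mult_ac)
  qed (simp add: app_simps)
  show "app (X2 ^ n) F (i, j) = (b powi i) ^ n / b ^ (\<Sum>k<n. k) * F (i - int n, j - int n)"
  proof (induction n arbitrary: i j)
    case (Suc n)
    have "(b powi (i - 1)) ^ n = (b powi i) ^ n / b ^ n"
      by (simp add: powi_shift power_divide)
    then show ?case using b0 nz
      by (simp add: app_simps app_X Suc.IH power_add diff_diff_eq mult_ac)
  qed (simp add: app_simps)
  show "app (X4 ^ n) F (i, j) = (b powi i) ^ n * F (i, j - int n)"
    by (induction n arbitrary: j) (simp_all add: app_simps app_X diff_diff_eq)
qed

lemma power_powi_swap: "(x powi i) ^ n = (x ^ n) powi i" for x :: complex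
  by (simp only: power_int_power power_int_power' mult.commute)

lemma powi_M: "(b powi i) ^ M = 1" "(c powi j) ^ M = 1"
proof -
  have "b ^ M = 1" using p1(2) by (simp add: M_def b_def power_mult mult.commute[of 2])
  then show "(b powi i) ^ M = 1" by (simp add: power_powi_swap)
  have "c ^ M = 1" using A1 by (simp add: M_def c_def power_mult mult.commute[of 2] mult.commute[of p])
  then show "(c powi j) ^ M = 1" by (simp add: power_powi_swap)
qed

lemma b_sum_M: "b ^ (\<Sum>k<M. k) = 1"
proof -
  have "(\<Sum>k<M. k) = (M * (M - 1)) div 2"
    using Sum_Ico_nat[of 0 M] by (simp add: lessThan_atLeast0)
  also have "\<dots> = p * A * (M - 1)" by (simp add: M_def)
  finally show ?thesis using p1(2) by (simp add: b_def power_mult)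
qed

lemma X_period:
  assumes "F \<in> Q"
  shows "app (X2 ^ M) F = F" "app (X3 ^ M) F = F" "app (X4 ^ M) F = F"
proof -
  have A: "F (i, j - int M) = F (i, j)" for i j
    using Q_shift_A[OF assms, of i j "- 2 * int p"] by (simp add: M_def mult_ac)
  have p: "F (i + int M * k, j) = F (i, j)" for i j k
    using Q_shift_p[OF assms, of i "2 * int A * k" j] bp_even[of "j * (2 * int A * k)"] by (simp add: M_def mult_ac)
  show "app (X2 ^ M) F = F"
    using p[of _ "- 1"] by (auto simp: fun_eq_iff app_power powi_M b_sum_M A)
  show "app (X3 ^ M) F = F"
    using p[of _ 1] by (auto simp: fun_eq_iff app_power powi_M b_sum_M power_mult mult.commute[of 2])
  show "app (X4 ^ M) F = F"
    by (auto simp: fun_eq_iff app_power powi_M A)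
qed

text \<open>On \<open>Q\<close> the inverse of \<open>Y\<close> is \<open>Y ^ (M - 1)\<close>, which
  lies in \<open>Z\<close> again.\<close>

lemma Z_cancel:
  assumes Y: "Y \<in> Z" "\<And>F. F \<in> Q \<Longrightarrow> app (Y ^ M) F = F" and T: "preserves T"
  shows "T * Y \<in> Z \<Longrightarrow> T \<in> Z" "Y * T \<in> Z \<Longrightarrow> T \<in> Z"
proof -
  obtain m where m: "M = Suc m" using M_pos gr0_implies_Suc by blast
  show "T \<in> Z" if "T * Y \<in> Z"
  proof (rule Z_cong[OF Z_mult[OF that Z_power[OF Y(1)]] T])
    fix F assume "F \<in> Q"
    then show "app (T * Y * Y ^ m) F = app T F" using Y(2)[of F] by (simp add: m app_simps)
  qed
  show "T \<in> Z" if "Y * T \<in> Z"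
  proof (rule Z_cong[OF Z_mult[OF Z_power[OF Y(1)] that] T])
    fix F assume "F \<in> Q"
    then have "app T F \<in> Q" using T by (simp add: preserves_def)
    then show "app (Y ^ m * (Y * T)) F = app T F"
      using Y(2)[of "app T F"] by (simp add: m app_simps power_commutes[symmetric])
  qed
qed

lemma Z_X: "X1 \<in> Z" "X4 \<in> Z"
proof -
  show "X4 \<in> Z"
    by (rule Z_cancel(1)[OF Z_root_vectors(1) X_period(2) preserves_X(4) Z_root_vectors(3)])
  have 21: "preserves (X2 * X1)" by (intro preserves_simps preserves_X)
  have 221: "X2 * (X2 * X1) \<in> Z" using Z_root_vectors(4) by (simp add: mult.assoc)
  have "X2 * X1 \<in> Z"
    by (rule Z_cancel(2)[OF Z_root_vectors(2) X_period(1) 21 221])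
  from Z_cancel(2)[OF Z_root_vectors(2) X_period(1) preserves_X(1) this] show "X1 \<in> Z" .
qed

section \<open>Diagonal operators and matrix units among the limits\<close>

definition diag :: "(int \<times> int \<Rightarrow> complex) \<Rightarrow> (int \<times> int) linop" where
  "diag g = wshift (\<lambda>x. x) g"

definition V :: "(int \<times> int) linop" where
  "V = wshift (\<lambda>(i, j). (i - 1, j)) (\<lambda>_. 1)"

lemma app_diag: "app (diag g) F x = g x * F x"
  by (simp add: diag_def wshift.rep_eq)

lemma app_V: "app V F (i, j) = F (i - 1, j)"
  by (simp add: V_def wshift.rep_eq)

lemma preserves_diag:
  assumes "\<And>i j. g (i + int p, j) = g (i, j)" "\<And>i j. g (i, j + int A) = g (i, j)"
  shows "preserves (diag g)"
  using assms by (simp add: preserves_def Q_def app_diag)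

lemma preserves_V: "preserves V"
proof -
  have "F (i + int p - 1, j) = (b ^ p) powi j * F (i - 1, j)" if "F \<in> Q" for F i j
  proof -
    have "F (i - 1 + int p, j) = (b ^ p) powi j * F (i - 1, j)" using that by (simp add: Q_def)
    then show ?thesis by (simp add: algebra_simps)
  qed
  then show ?thesis by (simp add: preserves_def Q_def app_V)
qed

lemma Z_V: "V \<in> Z"
proof -
  have "V * X4 = cop (1 / b) * X2"
    by (rule linop_eqI, rename_tac F x, case_tac x) (simp add: app_simps app_V app_X cop.rep_eq powi_shift b0)
  then have "V * X4 \<in> Z" by (simp add: Z_mult Z_cop Z_root_vectors)
  from Z_cancel(1)[OF Z_X(2) X_period(3) preserves_V this] show ?thesis .
qed

text \<open>The three operators are \<open>X1 * V\<close>, the quotient of \<open>X1\<close> by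
  \<open>X3\<close> on \<open>Q\<close>, and \<open>X4 ^ A\<close>, whose shift of \<open>j\<close>
  by \<open>A\<close> is invisible on \<open>Q\<close>.\<close>

lemma Z_diag:
  "diag (\<lambda>(i, j). c powi j) \<in> Z" "diag (\<lambda>(i, j). (b powi i)\<^sup>2) \<in> Z" "diag (\<lambda>(i, j). (b powi i) ^ A) \<in> Z"
proof -
  have "X1 * V = diag (\<lambda>(i, j). c powi j)"
    by (rule linop_eqI, rename_tac F x, case_tac x) (simp add: app_simps app_V app_X app_diag)
  then show "diag (\<lambda>(i, j). c powi j) \<in> Z" using Z_mult[OF Z_X(1) Z_V] by simp
  have "diag (\<lambda>(i, j). (b powi i)\<^sup>2) * X3 = X1"
    by (rule linop_eqI, rename_tac F x, case_tac x) (simp add: app_simps app_X app_diag b0)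
  then have X3: "diag (\<lambda>(i, j). (b powi i)\<^sup>2) * X3 \<in> Z" using Z_X by simp
  have "preserves (diag (\<lambda>(i, j). (b powi i)\<^sup>2))"
    using bp_sq by (intro preserves_diag) (simp_all add: b_p power_mult_distrib power2_eq_square)
  from Z_cancel(1)[OF Z_root_vectors(1) X_period(2) this X3]
  show "diag (\<lambda>(i, j). (b powi i)\<^sup>2) \<in> Z" .
  show "diag (\<lambda>(i, j). (b powi i) ^ A) \<in> Z"
  proof (rule Z_cong[OF Z_power[OF Z_X(2)]])
    show "preserves (diag (\<lambda>(i, j). (b powi i) ^ A))"
      using bp_A by (intro preserves_diag) (simp_all add: b_p power_mult_distrib)
    fix F assume F: "F \<in> Q"
    have "F (i, j - int A) = F (i, j)" for i j using Q_shift_A[OF F, of i j "- 1"] by simp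
    then show "app (X4 ^ A) F = app (diag (\<lambda>(i, j). (b powi i) ^ A)) F"
      by (auto simp: fun_eq_iff app_power app_diag)
  qed
qed

lemma powi_eq_imp:
  assumes "x \<noteq> 0" "(x powi i) ^ n = (x powi j) ^ n" "i < j"
  shows "x ^ (nat (j - i) * n) = (1 :: complex)"
proof -
  have "x powi j = x powi i * x ^ nat (j - i)"
    using assms(1,3) by (simp add: power_int_diff flip: power_int_nonneg_exp)
  then show ?thesis using assms by (simp add: power_mult_distrib power_mult)
qed

text \<open>If the functions of \<open>Z_diag\<close> agreed at two points of the box, the
  difference of the coordinates would contradict the minimality of \<open>A\<close> or of
  \<open>p\<close>.\<close>

lemma Z_separates:
  assumes "x \<in> box" "z \<in> box" "x \<noteq> z"
  shows "\<exists>g. diag g \<in> Z \<and> g x \<noteq> g z"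
proof -
  have *: "\<exists>g. diag g \<in> Z \<and> g (i, j) \<noteq> g (i', j')"
    if ij: "(i, j) \<in> box" "(i', j') \<in> box" "j < j' \<or> i < i'" for i j i' j'
  proof (cases "j < j'")
    case True
    have "(c powi j) ^ 1 \<noteq> (c powi j') ^ 1"
    proof
      assume "(c powi j) ^ 1 = (c powi j') ^ 1"
      from powi_eq_imp[OF c0 this True] have "(r * s) ^ nat (j' - j) = 1" by (simp add: c_def)
      then show False using A_min[of "nat (j' - j)"] ij True by (auto simp: box_def nat_less_iff)
    qed
    then show ?thesis using Z_diag(1) by (intro exI[of _ "\<lambda>(i, j). c powi j"]) simp
  next
    case False
    then have i: "i < i'" using ij by simp
    have "(b powi i)\<^sup>2 \<noteq> (b powi i')\<^sup>2 \<or> (b powi i) ^ A \<noteq> (b powi i') ^ A"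
    proof (rule ccontr)
      assume "\<not> ?thesis"
      then have "(r / s) ^ (nat (i' - i) * 2) = 1" "(r / s) ^ (nat (i' - i) * A) = 1"
        using powi_eq_imp[OF b0 _ i, of 2] powi_eq_imp[OF b0 _ i, of A] by (simp_all add: b_def)
      then show False using p_min[of "nat (i' - i)"] ij i by (auto simp: box_def mult.commute nat_less_iff)
    qed
    then show ?thesis
    proof
      assume "(b powi i)\<^sup>2 \<noteq> (b powi i')\<^sup>2"
      then show ?thesis using Z_diag(2) by (intro exI[of _ "\<lambda>(i, j). (b powi i)\<^sup>2"]) simp
    next
      assume "(b powi i) ^ A \<noteq> (b powi i') ^ A"
      then show ?thesis using Z_diag(3) by (intro exI[of _ "\<lambda>(i, j). (b powi i) ^ A"]) simp
    qed
  qed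
  obtain i j i' j' where [simp]: "x = (i, j)" "z = (i', j')" by (cases x, cases z)
  consider "j < j' \<or> i < i'" | "j' < j \<or> i' < i" using assms(3) by (auto simp: neq_iff)
  then show ?thesis
  proof cases
    case 1
    then show ?thesis using *[of i j i' j'] assms by simp
  next
    case 2
    then show ?thesis using *[of i' j' i j] assms by (simp add: eq_commute)
  qed
qed

text \<open>Lagrange interpolation: each other point contributes one factor that vanishes there and
  equals 1 at \<open>x\<close>.\<close>

lemma Z_projection:
  assumes "x \<in> box"
  shows "\<exists>g. diag g \<in> Z \<and> g x = 1 \<and> (\<forall>z\<in>box - {x}. g z = 0)"
proof -
  have "\<exists>g. diag g \<in> Z \<and> g x = 1 \<and> (\<forall>z\<in>B. g z = 0)" if "finite B" "B \<subseteq> box - {x}" for B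
    using that
  proof (induction B)
    case empty
    have "diag (\<lambda>_. 1) = 1" by (rule linop_eqI) (simp add: app_diag app_simps)
    then show ?case using Z_1 by (intro exI[of _ "\<lambda>_. 1"]) simp
  next
    case (insert z B)
    then obtain g where g: "diag g \<in> Z" "g x = 1" "\<forall>z\<in>B. g z = 0" by auto
    obtain h where h: "diag h \<in> Z" "h x \<noteq> h z" using Z_separates[of x z] insert assms by auto
    define e where "e = inverse (h x - h z)"
    have "diag (\<lambda>y. g y * ((h y - h z) * e)) = cop e * (diag g * (diag h + cop (- h z)))"
      by (rule linop_eqI) (simp add: app_diag app_simps cop.rep_eq algebra_simps)
    then have "diag (\<lambda>y. g y * ((h y - h z) * e)) \<in> Z"
      using g h by (simp add: Z_mult Z_add Z_cop)
    then show ?case using g h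
      by (intro exI[of _ "\<lambda>y. g y * ((h y - h z) * e)"]) (auto simp: e_def)
  qed
  from this[of "box - {x}"] show ?thesis using finite_box by simp
qed

text \<open>A product of shifts carries \<open>y\<close> to \<open>x\<close> with a nonzero
  coefficient, and projections on both sides remove everything else.\<close>

lemma Z_matrix_unit:
  assumes x: "x \<in> box" and y: "y \<in> box"
  shows "\<exists>U\<in>Z. \<forall>z\<in>box. app U (delta z) = (if z = y then delta x else (\<lambda>_. 0))"
proof -
  obtain i j i' j' where xy: "x = (i, j)" "y = (i', j')" by (cases x, cases y)
  \<comment> \<open>Nonnegative residues are taken so that powers of \<open>V\<close> and
    \<open>X4\<close> suffice; the error is absorbed by quasi-periodicity.\<close>
  define e f where "e = nat ((i - i') mod int p)" and "f = nat ((j - j') mod int A)"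
  have e: "(i - int e) mod int p = i'" "(j - int f) mod int A = j'"
    using p0 A0 y by (simp_all add: e_def f_def mod_diff_right_eq xy box_def)
  define T where "T = V ^ e * X4 ^ f"
  have T: "T \<in> Z" by (simp add: T_def Z_mult Z_power Z_V Z_X)
  have V: "app (V ^ n) F (i, j) = F (i - int n, j)" for n F i j
    by (induction n arbitrary: i) (simp_all add: app_simps app_V diff_diff_eq)
  have "app T (delta y) x = (b powi (i - int e)) ^ f * delta y (i - int e, j - int f)"
    by (simp add: T_def app_simps V app_power xy)
  moreover have "delta y (i - int e, j - int f) \<noteq> 0"
    using delta_nonzero[of "i - int e" "j - int f"] unfolding e xy .
  ultimately have nz: "app T (delta y) x \<noteq> 0" by (simp add: b0)
  obtain g h where g: "diag g \<in> Z" "g x = 1" "\<And>z. z \<in> box \<Longrightarrow> z \<noteq> x \<Longrightarrow> g z = 0"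
    and h: "diag h \<in> Z" "h y = 1" "\<And>z. z \<in> box \<Longrightarrow> z \<noteq> y \<Longrightarrow> h z = 0"
    using Z_projection[OF x] Z_projection[OF y] by (metis DiffI singletonD)
  define U where "U = cop (1 / app T (delta y) x) * (diag g * (T * diag h))"
  have U: "U \<in> Z" using g h T by (simp add: U_def Z_mult Z_cop)
  have diag: "app (diag h) (delta z) = (if z = y then delta y else (\<lambda>_. 0))" if "z \<in> box" for z
    using Z_preserves[OF h(1)] that h
    by (intro Q_eqI) (auto simp: preserves_def delta_Q Q_zero app_diag delta_box split: if_splits)
  have "app U (delta z) = (if z = y then delta x else (\<lambda>_. 0))" if z: "z \<in> box" for z
  proof (cases "z = y")
    case True
    have "app U (delta y) = delta x"
    proof (rule Q_eqI)
      show "app U (delta y) \<in> Q" using Z_preserves[OF U] by (simp add: preserves_def delta_Q)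
      fix w assume "w \<in> box"
      then show "app U (delta y) w = delta x w"
        using nz g diag[OF y] by (cases "w = x") (auto simp: U_def app_simps cop.rep_eq app_diag delta_box)
    qed (rule delta_Q)
    then show ?thesis using True by simp
  next
    case False
    then show ?thesis using diag[OF z] by (simp add: U_def app_simps app_zero)
  qed
  then show ?thesis using U by blast
qed

lemma identity_on_Z:
  assumes "polynomial_identity (U_plus_B2 r s) f" "\<And>i. u i \<in> Z" "F \<in> Q"
  shows "app (op.ev u f) F = (\<lambda>_. 0)"
proof -
  have "\<forall>i. \<exists>a. conv (\<lambda>n. op.ev (gen 4 2 1 8 n) (a n)) (u i)" using assms(2) by (auto simp: Z_def)
  then obtain a where a: "\<And>i. conv (\<lambda>n. op.ev (gen 4 2 1 8 n) (a i n)) (u i)" by metis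
  have "conv (\<lambda>n. op.ev (\<lambda>i. op.ev (gen 4 2 1 8 n) (a i n)) f) (op.ev u f)"
    by (rule conv_ev) (rule a)
  moreover have "op.ev (\<lambda>i. op.ev (gen 4 2 1 8 n) (a i n)) f = 0" for n
  proof -
    have "free.ev (\<lambda>i. a i n) f \<in> relation_ideal (B2_relations r s)"
      using assms(1) unfolding U_plus_B2_eq polynomial_identity_presented_iff by blast
    then show ?thesis unfolding op.ev_free_ev[symmetric] by (rule ev_gen_relations(3))
  qed
  ultimately have "conv (\<lambda>n. 0) (op.ev u f)" by simp
  then show ?thesis by (rule conv_unique) (simp_all add: app_simps assms(3) fun_eq_iff)
qed

text \<open>The staircase \<open>E\<^sub>0\<^sub>0, E\<^sub>0\<^sub>1, E\<^sub>1\<^sub>1, E\<^sub>1\<^sub>2, \<dots>\<close> of matrix units: among the products of \<open>d\<close> different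
  units only the one in the given order is nonzero. The sum over \<open>S\<close> below extracts the part of \<open>f\<close>
  that is multilinear in the units.\<close>

theorem identity_degree:
  assumes f: "polynomial_identity (U_plus_B2 r s) f"
  shows "2 * (p * A) \<le> free_degree f"
proof (rule ccontr)
  define N where "N = p * A"
  define d where "d = free_degree f"
  assume "\<not> 2 * (p * A) \<le> free_degree f"
  then have d: "d < 2 * N" by (simp add: N_def d_def)
  have "f \<noteq> 0" using f by (simp add: polynomial_identity_def)
  then have ne: "(\<lambda>w. length (letters w)) ` Poly_Mapping.keys f \<noteq> {}" by simp
  have "d \<in> (\<lambda>w. length (letters w)) ` Poly_Mapping.keys f"
    unfolding d_def free_degree_def by (rule Max_in) (use ne in auto)
  then obtain w0 where w0: "w0 \<in> Poly_Mapping.keys f" "length (letters w0) = d" by blast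
  have len: "length (letters w) \<le> d" if "w \<in> Poly_Mapping.keys f" for w
    unfolding d_def free_degree_def by (rule Max_ge) (use that in auto)
  \<comment> \<open>The unit \<open>U k\<close> will be substituted for the variable at place
    \<open>k\<close> of the longest word \<open>w0\<close>; a repeated variable receives a sum of
    units.\<close>
  define idx where "idx k = letters w0 ! k" for k
  have idx: "map idx [0..<d] = letters w0"
    unfolding idx_def w0(2)[symmetric] by (rule map_nth)
  obtain y where y: "bij_betw y {0..<N} box"
    using ex_bij_betw_nat_finite[OF finite_box] by (auto simp: card_box N_def)
  have y_box: "y k \<in> box" if "k < N" for k using bij_betwE[OF y] that by auto
  have y_inj: "y k = y l \<longleftrightarrow> k = l" if "k < N" "l < N" for k l
    using bij_betw_imp_inj_on[OF y] that by (auto simp: inj_on_def)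
  \<comment> \<open>The bound \<open>k < d < 2 * N\<close> keeps \<open>(k + 1) div 2\<close> below
    \<open>N\<close>: a staircase of at most \<open>2 * N - 1\<close> units fits.\<close>
  have "\<exists>U\<in>Z. \<forall>z\<in>box. app U (delta z) = (if z = y ((k + 1) div 2) then delta (y (k div 2)) else (\<lambda>_. 0))" if "k < d" for k
    using Z_matrix_unit[OF y_box y_box, of "k div 2" "(k + 1) div 2"] that d by auto
  then obtain U where U: "\<And>k. k < d \<Longrightarrow> U k \<in> Z"
    "\<And>k z. k < d \<Longrightarrow> z \<in> box \<Longrightarrow> app (U k) (delta z) = (if z = y ((k + 1) div 2) then delta (y (k div 2)) else (\<lambda>_. 0))"
    by metis
  have U': "app (U k) (delta (y l)) = (if l = (k + 1) div 2 then delta (y (k div 2)) else (\<lambda>_. 0))" if "k < d" "l < N" for k l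
    using U(2)[OF that(1) y_box[OF that(2)]] y_inj[OF that(2), of "(k + 1) div 2"] that d by auto
  \<comment> \<open>The right end of the staircase is tracked. If \<open>U k\<close> can stand
    directly before \<open>U h\<close>, then \<open>(k + 1) div 2 = h div 2\<close>, which forces
    \<open>k \<le> h\<close>.\<close>
  have path: "app (prod_list (map U ks)) (delta (y (d div 2))) = (\<lambda>_. 0) \<or>
      sorted ks \<and> app (prod_list (map U ks)) (delta (y (d div 2))) = delta (y (if ks = [] then d div 2 else hd ks div 2))"
    if "set ks \<subseteq> {..<d}" for ks
    using that
  proof (induction ks)
    case Nil
    then show ?case by (simp add: app_simps)
  next
    case (Cons k ks)
    let ?l = "if ks = [] then d div 2 else hd ks div 2"
    have k: "k < d" "?l < N" using Cons.prems d by (cases ks; auto)+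
    consider "app (prod_list (map U ks)) (delta (y (d div 2))) = (\<lambda>_. 0)"
      | "sorted ks" "app (prod_list (map U ks)) (delta (y (d div 2))) = delta (y ?l)"
      using Cons by auto
    then show ?case
    proof cases
      case 1
      then show ?thesis by (simp add: app_simps app_zero)
    next
      case 2
      have "sorted (k # ks)" if "?l = (k + 1) div 2"
      proof (cases ks)
        case (Cons h ks')
        then have "k \<le> h" using that by simp
        then show ?thesis using 2(1) Cons by (simp add: sorted2 del: sorted_wrt.simps)
      qed simp
      then show ?thesis using U'[OF k] 2(2) by (auto simp: app_simps simp del: sorted_wrt.simps)
    qed
  qed
  have stair: "app (prod_list (map U [k..<d])) (delta (y (d div 2))) = delta (y (k div 2))" if "k \<le> d" for k
    using that
  proof (induction k rule: inc_induct)
    case base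
    then show ?case by (simp add: app_simps)
  next
    case (step k)
    then show ?case using U'[of k "Suc k div 2"] d by (simp add: upt_conv_Cons app_simps)
  qed
  define u where "u S i = (\<Sum>k | k \<in> S \<and> idx k = i. U k)" for S i
  have uZ: "u S i \<in> Z" if "S \<in> Pow {..<d}" for S i
    unfolding u_def by (rule Z_sum) (use that U in auto)
  have words: "(\<Sum>ks | set ks = {..<d} \<and> map idx ks = letters w. app (prod_list (map U ks)) (delta (y (d div 2))) (y 0)) =
      (if w = w0 then 1 else 0)" if w: "w \<in> Poly_Mapping.keys f" for w
  proof -
    have N0: "0 < N" using p0 A0 by (simp add: N_def)
    have "app (prod_list (map U ks)) (delta (y (d div 2))) (y 0) = (if ks = [0..<d] then 1 else 0)"
      if ks: "set ks = {..<d}" "map idx ks = letters w" for ks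
    proof (cases "ks = [0..<d]")
      case True
      then show ?thesis using stair[of 0] y_box[OF N0] by (simp add: delta_box)
    next
      case False
      have "length ks \<le> d" using len[OF w] ks(2) by (metis length_map)
      \<comment> \<open>Nonzero products are only weakly sorted, as diagonal units may repeat.
        Strictness comes from counting: at most \<open>d\<close> letters cover all \<open>d\<close>
        units.\<close>
      then have "distinct ks" using ks(1) by (intro card_distinct) (use card_length[of ks] in simp)
      have "\<not> sorted ks"
      proof
        assume "sorted ks"
        then have "ks = [0..<d]"
          by (rule sorted_distinct_set_unique[OF _ \<open>distinct ks\<close>]) (simp_all add: ks(1) atLeast0LessThan)
        then show False using False by blast
      qed
      moreover have "set ks \<subseteq> {..<d}" by (simp only: ks(1) order_refl)
      ultimately have "app (prod_list (map U ks)) (delta (y (d div 2))) = (\<lambda>_. 0)"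
        using path by blast
      then show ?thesis using False by simp
    qed
    then have "(\<Sum>ks | set ks = {..<d} \<and> map idx ks = letters w. app (prod_list (map U ks)) (delta (y (d div 2))) (y 0)) =
      (\<Sum>ks | set ks = {..<d} \<and> map idx ks = letters w. if ks = [0..<d] then 1 else 0)"
      by (intro sum.cong) auto
    also have "\<dots> = (if [0..<d] \<in> {ks. set ks = {..<d} \<and> map idx ks = letters w} then 1 else 0)"
    proof -
      have "length ks = length (letters w)" if "map idx ks = letters w" for ks
        unfolding that[symmetric] by simp
      then have "{ks. set ks = {..<d} \<and> map idx ks = letters w} \<subseteq>
          {ks. set ks \<subseteq> {..<d} \<and> length ks = length (letters w)}" by blast
      then have "finite {ks. set ks = {..<d} \<and> map idx ks = letters w}"
        by (rule finite_subset) (rule finite_lists_length_eq[OF finite_lessThan])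
      then show ?thesis by (simp add: sum.delta)
    qed
    also have "\<dots> = (if w = w0 then 1 else 0)"
      using idx by (cases w, cases w0) (auto simp: atLeast0LessThan)
    finally show ?thesis .
  qed
  have "(\<Sum>S\<in>Pow {..<d}. (- 1) ^ card ({..<d} - S) * op.ev (u S) f) =
    (\<Sum>w\<in>Poly_Mapping.keys f. cop (Poly_Mapping.lookup f w) *
      (\<Sum>S\<in>Pow {..<d}. (- 1) ^ card ({..<d} - S) * prod_list (map (u S) (letters w))))"
    unfolding op.ev_def sum_distrib_left by (subst sum.swap) (simp add: op.C_left_commute)
  also have "\<dots> = (\<Sum>w\<in>Poly_Mapping.keys f. cop (Poly_Mapping.lookup f w) *
      (\<Sum>ks | set ks = {..<d} \<and> map idx ks = letters w. prod_list (map U ks)))"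
    unfolding u_def by (simp only: alternating_sum_prod_list[OF finite_lessThan])
  finally have "app (\<Sum>S\<in>Pow {..<d}. (- 1) ^ card ({..<d} - S) * op.ev (u S) f) (delta (y (d div 2))) (y 0) =
    (\<Sum>w\<in>Poly_Mapping.keys f. Poly_Mapping.lookup f w *
      (\<Sum>ks | set ks = {..<d} \<and> map idx ks = letters w. app (prod_list (map U ks)) (delta (y (d div 2))) (y 0)))"
    by (simp add: app_sum_linop app_simps cop.rep_eq)
  also have "\<dots> = (\<Sum>w\<in>Poly_Mapping.keys f. if w = w0 then Poly_Mapping.lookup f w else 0)"
    by (intro sum.cong refl) (simp add: words)
  also have "\<dots> = Poly_Mapping.lookup f w0" using w0(1) by simp
  finally have "app (\<Sum>S\<in>Pow {..<d}. (- 1) ^ card ({..<d} - S) * op.ev (u S) f) (delta (y (d div 2))) (y 0) =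
    Poly_Mapping.lookup f w0" .
  moreover have "app ((- 1) ^ card ({..<d} - S) * op.ev (u S) f) (delta (y (d div 2))) = (\<lambda>_. 0)" if "S \<in> Pow {..<d}" for S
    using identity_on_Z[OF f uZ[OF that] delta_Q] by (simp add: app_simps app_zero)
  ultimately have "Poly_Mapping.lookup f w0 = 0" by (simp add: app_sum_linop)
  then show False using w0(1) by (simp add: in_keys_iff)
qed

end

section \<open>Orders of roots of unity\<close>

lemma mult_order_dvd_iff:
  assumes "z \<noteq> 0" shows "z ^ k = 1 \<longleftrightarrow> mult_order z dvd k"
proof -
  let ?R = "ring_of_type_algebra :: complex ring"
  interpret R: Ring.field ?R by (rule field_from_type_algebra)
  interpret G: Group.group "Multiplicative_Group.mult_of ?R" by (rule R.field_mult_group)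
  have pow: "z [^]\<^bsub>Multiplicative_Group.mult_of ?R\<^esub> k = z ^ k"
    by (induction k) (simp_all add: nat_pow_def ring_of_type_algebra_def)
  have "z \<in> carrier (Multiplicative_Group.mult_of ?R)" using assms by (simp add: ring_of_type_algebra_def)
  from G.pow_eq_id[OF this, of k] show ?thesis
    unfolding pow by (simp add: mult_order_def ring_of_type_algebra_def)
qed

lemma mult_order_pos:
  assumes "root_of_unity z" shows "mult_order z > 0"
proof -
  obtain k where k: "k > 0" "z ^ k = 1" using assms by (auto simp: root_of_unity_def)
  then have "z \<noteq> 0" by (cases "z = 0") (auto simp: power_0_left)
  then have "mult_order z dvd k" using k mult_order_dvd_iff by blast
  then show ?thesis using k(1) by (rule dvd_pos_nat[rotated])
qed

lemma mult_order_root: "z \<noteq> 0 \<Longrightarrow> z ^ mult_order z = 1"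
  by (simp add: mult_order_dvd_iff)

lemma nat_eqI_dvd: "(\<And>k. a dvd k \<longleftrightarrow> b dvd k) \<Longrightarrow> a = (b :: nat)"
  by (meson dvd_antisym dvd_refl)

lemma mult_order_square:
  assumes "z \<noteq> 0"
  shows "mult_order z = (if even (mult_order z) then 2 * mult_order (z\<^sup>2) else mult_order (z\<^sup>2))"
proof -
  have iff: "mult_order (z\<^sup>2) dvd k \<longleftrightarrow> mult_order z dvd 2 * k" for k
    using assms by (simp add: mult_order_dvd_iff[symmetric] power_mult)
  show ?thesis
  proof (cases "even (mult_order z)")
    case True
    then obtain h where h: "mult_order z = 2 * h" by (rule evenE)
    have "mult_order (z\<^sup>2) = h" by (rule nat_eqI_dvd) (simp add: iff h)
    then show ?thesis using h by simp
  next
    case False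
    have "mult_order (z\<^sup>2) = mult_order z"
      by (rule nat_eqI_dvd) (use False in \<open>simp add: iff coprime_dvd_mult_right_iff\<close>)
    then show ?thesis using False by simp
  qed
qed

text \<open>For even \<open>A\<close> the condition on \<open>k * A\<close> follows from that on
  \<open>2 * k\<close>. For odd \<open>A\<close> we have \<open>gcd (2 * k) (k * A) = k\<close>, so
  both together say \<open>B dvd k\<close>.\<close>

lemma least_period:
  fixes A B B' :: nat
  assumes B: "B > 0" and B': "\<And>k. B' dvd k \<longleftrightarrow> B dvd 2 * k"
  defines "P \<equiv> \<lambda>k. 0 < k \<and> B dvd 2 * k \<and> B dvd k * A"
  shows "P (LEAST k. P k)" and "(LEAST k. P k) = (if even A then B' else B)"
proof -
  have "P B" using B by (simp add: P_def)
  then show "P (LEAST k. P k)" by (rule LeastI)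
  show "(LEAST k. P k) = (if even A then B' else B)"
  proof (cases "even A")
    case True
    then obtain h where h: "A = 2 * h" by (rule evenE)
    have *: "P k \<longleftrightarrow> 0 < k \<and> B' dvd k" for k
      using dvd_mult2[of B "2 * k" h] by (auto simp: P_def B' h mult_ac)
    have "B' dvd B" unfolding B' by simp
    then have "B' > 0" using B by (rule dvd_pos_nat[rotated])
    then have "(LEAST k. P k) = B'" by (intro Least_equality) (auto simp: * dvd_imp_le)
    then show ?thesis using True by simp
  next
    case False
    have *: "P k \<longleftrightarrow> 0 < k \<and> B dvd k" for k
    proof
      assume k: "P k"
      have "B dvd gcd (k * 2) (k * A)" using k by (simp add: P_def mult.commute)
      also have "gcd (k * 2) (k * A) = k * gcd 2 A" by (simp add: gcd_mult_distrib_nat)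
      also have "gcd 2 A = 1" using False by (simp add: coprime_iff_gcd_eq_1[symmetric])
      finally show "0 < k \<and> B dvd k" using k by (simp add: P_def)
    qed (simp add: P_def)
    have "(LEAST k. P k) = B" using B by (intro Least_equality) (auto simp: * dvd_imp_le)
    then show ?thesis using False by simp
  qed
qed

text \<open>An odd exponent killing both \<open>r * s\<close> and \<open>r / s\<close> gives the odd
  cases; if \<open>m\<close> and \<open>n\<close> are twice odd numbers, suitable odd powers of
  \<open>r\<close> and \<open>s\<close> are -1 and the signs cancel. An odd \<open>A\<close> makes
  \<open>m dvd A * n\<close> and \<open>n dvd A * m\<close>, so the 2-parts agree. If 4 divides
  \<open>m\<close>, then \<open>r^2 = (r * s) * (r / s)\<close> has even order.\<close>

lemma parity_of_orders:
  fixes r s :: complex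
  assumes r: "r \<noteq> 0" "root_of_unity r" and s: "s \<noteq> 0" "root_of_unity s"
  defines "m \<equiv> mult_order r" and "n \<equiv> mult_order s"
    and "A \<equiv> mult_order (r * s)" and "B \<equiv> mult_order (r / s)"
  shows "odd m \<Longrightarrow> odd n \<Longrightarrow> odd A \<and> odd B"
    and "multiplicity 2 m \<noteq> multiplicity 2 n \<Longrightarrow> even A"
    and "multiplicity 2 m = 1 \<Longrightarrow> multiplicity 2 n = 1 \<Longrightarrow> odd A \<and> odd B"
    and "multiplicity 2 m \<ge> 2 \<Longrightarrow> even A \<or> even B"
proof -
  have nz: "r * s \<noteq> 0" "r / s \<noteq> 0" using r s by auto
  have pos: "m > 0" "n > 0" using r s by (auto simp: m_def n_def mult_order_pos)
  have rm: "r ^ m = 1" "s ^ n = 1" "(r * s) ^ A = 1" "(r / s) ^ B = 1"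
    using r s nz by (simp_all add: m_def n_def A_def B_def mult_order_root)
  have odd_if: "odd A \<and> odd B" if "(r * s) ^ k = 1" "(r / s) ^ k = 1" "odd k" for k
    using that nz unfolding A_def B_def mult_order_dvd_iff[OF nz(1)] mult_order_dvd_iff[OF nz(2)]
    by (meson dvd_trans)
  show "odd m \<Longrightarrow> odd n \<Longrightarrow> odd A \<and> odd B"
  proof (rule odd_if)
    have "r ^ (m * n) = 1" "s ^ (n * m) = 1" by (simp_all add: power_mult rm)
    then show "(r * s) ^ (m * n) = 1" "(r / s) ^ (m * n) = 1"
      by (simp_all add: power_mult_distrib power_divide mult.commute[of n m])
  qed simp
  show "even A" if "multiplicity 2 m \<noteq> multiplicity 2 n"
  proof (rule ccontr)
    assume "odd A"
    have "r ^ A * s ^ A = 1" using rm by (simp add: power_mult_distrib)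
    then have rs: "(r ^ A) ^ k * (s ^ A) ^ k = 1" for k by (metis power_mult_distrib power_one)
    have "r ^ (A * n) = 1" using rs[of n] rm by (simp add: power_mult[symmetric] mult.commute[of A n]) (simp add: power_mult)
    then have 1: "m dvd A * n" using r by (simp add: m_def mult_order_dvd_iff)
    have "s ^ (A * m) = 1" using rs[of m] rm by (simp add: power_mult[symmetric] mult.commute[of A m]) (simp add: power_mult)
    then have 2: "n dvd A * m" using s by (simp add: n_def mult_order_dvd_iff)
    have A0: "A > 0" using \<open>odd A\<close> by (cases A) auto
    have e: "multiplicity 2 (A * k) = multiplicity 2 k" if "k > 0" for k
      using \<open>odd A\<close> A0 that by (subst prime_elem_multiplicity_mult_distrib) (auto simp: not_dvd_imp_multiplicity_0)
    have "multiplicity 2 m \<le> multiplicity 2 (A * n)" "multiplicity 2 n \<le> multiplicity 2 (A * m)"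
      using 1 2 A0 pos by (auto intro!: dvd_imp_multiplicity_le)
    then show False using that e pos by simp
  qed
  show "odd A \<and> odd B" if mult: "multiplicity 2 m = 1" "multiplicity 2 n = 1"
  proof -
    have half: "\<exists>k. odd k \<and> z ^ k = - 1" if q: "mult_order z = q" "multiplicity 2 q = 1" "z \<noteq> 0" "q > 0" for z :: complex and q
    proof -
      have "q = 2 ^ multiplicity 2 q * (q div 2 ^ multiplicity 2 q)"
        by (simp add: multiplicity_dvd)
      then obtain k where k: "q = 2 * k" using q(2) by auto
      have "odd k"
      proof
        assume "even k"
        then have "2 ^ 2 dvd q" using k by (auto elim!: evenE)
        then have "2 \<le> multiplicity 2 q" using q(4) by (intro multiplicity_geI) auto
        then show False using q(2) by simp
      qed
      have "(z ^ k)\<^sup>2 = 1" using mult_order_root[OF q(3)] q(1) k by (simp add: power_mult[symmetric] mult.commute)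
      moreover have "z ^ k \<noteq> 1"
      proof
        assume "z ^ k = 1"
        then have "2 * k dvd k" using mult_order_dvd_iff[OF q(3), of k] q(1) k by simp
        then show False using \<open>odd k\<close> by (auto dest: dvd_imp_le simp: odd_pos)
      qed
      ultimately have "z ^ k = - 1" by (simp add: power2_eq_1_iff)
      then show ?thesis using \<open>odd k\<close> by blast
    qed
    obtain k where k: "odd k" "r ^ k = - 1" using half[of r m] mult r pos by (auto simp: m_def)
    obtain l where l: "odd l" "s ^ l = - 1" using half[of s n] mult s pos by (auto simp: n_def)
    have "r ^ (k * l) = - 1" "s ^ (l * k) = - 1"
      using k l by (simp_all add: power_mult)
    then show ?thesis
      using k l by (intro odd_if[of "k * l"]) (simp_all add: power_mult_distrib power_divide mult.commute[of l k])
  qed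
  show "even A \<or> even B" if "multiplicity 2 m \<ge> 2"
  proof (rule ccontr)
    assume odd: "\<not> (even A \<or> even B)"
    have "r\<^sup>2 = (r * s) * (r / s)" using s by (simp add: power2_eq_square)
    then have "r ^ (2 * (A * B)) = (r * s) ^ (A * B) * (r / s) ^ (A * B)"
      by (simp only: power_mult power_mult_distrib)
    also have "(r * s) ^ (A * B) = 1" using rm by (simp add: power_mult)
    also have "(r / s) ^ (A * B) = 1" using rm by (simp only: mult.commute[of A] power_mult) simp
    finally have "m dvd 2 * (A * B)" using r by (simp add: m_def mult_order_dvd_iff)
    moreover have "2 ^ 2 dvd m" using that by (rule multiplicity_dvd')
    ultimately have "2 * 2 dvd 2 * (A * B)" by (metis dvd_trans power2_eq_square)
    then show False using odd by (subst (asm) nat_mult_dvd_cancel1) auto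
  qed
qed

section \<open>The PI degree\<close>

lemma (in torus_rep) PI_deg_eq: "PI_deg (U_plus_B2 r s) = real (p * A)"
proof -
  have "(LEAST d. \<exists>f. polynomial_identity (U_plus_B2 r s) f \<and> free_degree f = d) = 2 * (p * A)"
    using standard_identity free_degree_standard_poly identity_degree by (intro Least_equality) blast+
  then show ?thesis by (simp add: PI_deg_def)
qed

lemma PI_deg_U_plus_B2:
  fixes r s :: complex
  assumes "r \<noteq> 0" "s \<noteq> 0" "root_of_unity r" "root_of_unity s" "r\<^sup>2 \<noteq> s\<^sup>2"
  defines "A \<equiv> mult_order (r * s)" and "B \<equiv> mult_order (r / s)"
  shows "PI_deg (U_plus_B2 r s) =
    real ((if even A \<or> even B then 2 else 1) * mult_order (r\<^sup>2 * s\<^sup>2) * mult_order (r\<^sup>2 / s\<^sup>2))"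
proof -
  have nz: "r * s \<noteq> 0" "r / s \<noteq> 0" using assms by auto
  have "root_of_unity (r * s)" "root_of_unity (r / s)"
  proof -
    obtain k l where kl: "k > 0" "r ^ k = 1" "l > 0" "s ^ l = 1"
      using assms(3,4) by (auto simp: root_of_unity_def)
    have "r ^ (k * l) = 1" "s ^ (l * k) = 1" using kl by (simp_all add: power_mult)
    then have "(r * s) ^ (k * l) = 1" "(r / s) ^ (k * l) = 1"
      by (simp_all only: power_mult_distrib power_divide mult.commute[of l k] mult_1 div_by_1)
    moreover have "k * l > 0" using kl by simp
    ultimately show "root_of_unity (r * s)" "root_of_unity (r / s)"
      unfolding root_of_unity_def by blast+
  qed
  then have pos: "A > 0" "B > 0" by (simp_all add: A_def B_def mult_order_pos)
  define B' where "B' = mult_order ((r / s)\<^sup>2)"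
  have B': "B' dvd k \<longleftrightarrow> B dvd 2 * k" for k
    using nz unfolding B'_def B_def by (simp add: mult_order_dvd_iff[symmetric] power_mult del: power_divide)
  define P where "P k \<longleftrightarrow> 0 < k \<and> B dvd 2 * k \<and> B dvd k * A" for k
  define p where "p = (LEAST k. P k)"
  have p: "P p" "p = (if even A then B' else B)"
    unfolding p_def P_def using least_period[OF pos(2) B', of A] by simp_all
  interpret torus_rep r s A p
  proof
    show "r \<noteq> 0" "s \<noteq> 0" "r\<^sup>2 \<noteq> s\<^sup>2" "A > 0" by fact+
    show "(r * s) ^ A = 1" unfolding A_def by (rule mult_order_root[OF nz(1)])
    show "(r * s) ^ k \<noteq> 1" if "0 < k" "k < A" for k
      unfolding mult_order_dvd_iff[OF nz(1)] using that by (auto simp: A_def dest: dvd_imp_le)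
    show "p > 0" "(r / s) ^ (2 * p) = 1" "(r / s) ^ (p * A) = 1"
      using p(1) unfolding mult_order_dvd_iff[OF nz(2)] by (simp_all add: P_def B_def)
    show False if "0 < k" "k < p" "(r / s) ^ (2 * k) = 1" "(r / s) ^ (k * A) = 1" for k
      using that not_less_Least[of k P] unfolding mult_order_dvd_iff[OF nz(2)] by (simp add: P_def B_def p_def)
  qed
  have sq: "r\<^sup>2 * s\<^sup>2 = (r * s)\<^sup>2" "r\<^sup>2 / s\<^sup>2 = (r / s)\<^sup>2"
    by (simp_all add: power_mult_distrib power_divide)
  have "A = (if even A then 2 * mult_order ((r * s)\<^sup>2) else mult_order ((r * s)\<^sup>2))"
    "B = (if even B then 2 * B' else B')"
    unfolding A_def B_def B'_def by (rule mult_order_square nz)+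
  \<comment> \<open>For even \<open>A\<close> the factor 2 comes from \<open>A\<close>, while
    \<open>p = B'\<close>; for odd \<open>A\<close> it can only come from \<open>p = B\<close>. So
    it occurs once even if both orders are even.\<close>
  then have "p * A = (if even A \<or> even B then 2 else 1) * mult_order ((r * s)\<^sup>2) * B'"
    using p(2) by (auto split: if_splits)
  then show ?thesis unfolding PI_deg_eq sq B'_def by simp
qed

theorem theorem3p2:
  fixes r s :: complex and m n :: nat
  assumes "r \<noteq> 0" and "s \<noteq> 0"
    and "root_of_unity r" and "root_of_unity s"
    and "r\<^sup>2 \<noteq> s\<^sup>2"
    and "m = mult_order r" and "n = mult_order s"
  shows "(odd m \<and> odd n \<longrightarrow>
            PI_deg (U_plus_B2 r s) = mult_order (r\<^sup>2 * s\<^sup>2) * mult_order (r\<^sup>2 / s\<^sup>2)) \<and>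
         (even m \<or> even n \<longrightarrow>
            (multiplicity 2 m \<noteq> multiplicity 2 n \<longrightarrow>
               PI_deg (U_plus_B2 r s) = 2 * mult_order (r\<^sup>2 * s\<^sup>2) * mult_order (r\<^sup>2 / s\<^sup>2)) \<and>
            (multiplicity 2 m = 1 \<and> multiplicity 2 n = 1 \<longrightarrow>
               PI_deg (U_plus_B2 r s) = mult_order (r\<^sup>2 * s\<^sup>2) * mult_order (r\<^sup>2 / s\<^sup>2)) \<and>
            (\<forall>k\<ge>2. multiplicity 2 m = k \<and> multiplicity 2 n = k \<longrightarrow>
               PI_deg (U_plus_B2 r s) = 2 * mult_order (r\<^sup>2 * s\<^sup>2) * mult_order (r\<^sup>2 / s\<^sup>2)))"
proof -
  note deg = PI_deg_U_plus_B2[OF assms(1-5)]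
  note par = parity_of_orders[OF assms(1,3,2,4), folded assms(6,7)]
  show ?thesis
  proof (intro conjI impI allI)
    assume "odd m \<and> odd n"
    then show "PI_deg (U_plus_B2 r s) = mult_order (r\<^sup>2 * s\<^sup>2) * mult_order (r\<^sup>2 / s\<^sup>2)"
      using par(1) deg by simp
  next
    assume "multiplicity 2 m \<noteq> multiplicity 2 n"
    then show "PI_deg (U_plus_B2 r s) = 2 * mult_order (r\<^sup>2 * s\<^sup>2) * mult_order (r\<^sup>2 / s\<^sup>2)"
      using par(2) deg by simp
  next
    assume "multiplicity 2 m = 1 \<and> multiplicity 2 n = 1"
    then show "PI_deg (U_plus_B2 r s) = mult_order (r\<^sup>2 * s\<^sup>2) * mult_order (r\<^sup>2 / s\<^sup>2)"
      using par(3) deg by simp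
  next
    fix k :: nat assume "k \<ge> 2" "multiplicity 2 m = k \<and> multiplicity 2 n = k"
    then have "even (mult_order (r * s)) \<or> even (mult_order (r / s))" using par(4) by simp
    then show "PI_deg (U_plus_B2 r s) = 2 * mult_order (r\<^sup>2 * s\<^sup>2) * mult_order (r\<^sup>2 / s\<^sup>2)"
      using deg by simp
  qed
qed

end
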